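(* There is a randomized $\tilde{O}(m\sqrt n)$ time algorithm that, given an unweighted undirected graph $G=(V,E)$ with $n$ vertices and $m$ edges and $S\subseteq V$ with $T=V\setminus S$, outputs an estimate $D'$ such that, with high probability, $\tfrac{3}{5}D_{ST}(G)\leq D'\leq D_{ST}(G)$ if $D_{ST}(G)$ is divisible by $5$, and otherwise $\tfrac{3}{5}D_{ST}(G)-\tfrac{6}{5}\leq D'\leq D_{ST}(G)$.
   Context: $d(u,v)$ denotes the shortest path distance in $G$. The $ST$-Diameter is $D_{ST}(G)=\max_{s\in S}\max_{t\in T}d(s,t)$. "With high probability" means with probability at least $1-1/n^c$ for every constant $c$. $\tilde{O}$ hides polylogarithmic factors. *)

theory Defs
  imports "HOL-Probability.Probability" "HOL-Library.Log_Nat"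
begin

section \<open>Graphs, distances and the bichromatic diameter\<close>

definition simple_graph :: "'a set \<Rightarrow> 'a set set \<Rightarrow> bool" where
  "simple_graph V E \<longleftrightarrow> finite V \<and> (\<forall>e\<in>E. \<exists>u\<in>V. \<exists>v\<in>V. u \<noteq> v \<and> e = {u, v})"

definition is_path :: "'a set set \<Rightarrow> 'a \<Rightarrow> 'a list \<Rightarrow> 'a \<Rightarrow> bool" where
  "is_path E u p v \<longleftrightarrow>
     p \<noteq> [] \<and> hd p = u \<and> last p = v \<and> successively (\<lambda>x y. {x, y} \<in> E) p"

text \<open>The distance is \<open>\<infinity>\<close> between vertices in different components
  (infimum of the empty set in \<^typ>\<open>enat\<close>).\<close>

definition gdist :: "'a set set \<Rightarrow> 'a \<Rightarrow> 'a \<Rightarrow> enat" where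
  "gdist E u v = (INF p\<in>{p. is_path E u p v}. enat (length p - 1))"

text \<open>Only meaningful for finite nonempty \<open>S\<close> and \<open>T\<close>.\<close>

definition ST_diameter :: "'a set set \<Rightarrow> 'a set \<Rightarrow> 'a set \<Rightarrow> enat" where
  "ST_diameter E S T = (MAX s\<in>S. MAX t\<in>T. gdist E s t)"

text \<open>If \<open>D = \<infinity>\<close>, both branches force \<open>D' = \<infinity>\<close>. Integrality of the estimate
  is no restriction, as rounding a real estimate up preserves all the bounds.\<close>

definition good_estimate :: "enat \<Rightarrow> enat \<Rightarrow> bool" where
  "good_estimate D D' \<longleftrightarrow>
     (if 5 dvd D
      then ereal (3/5) * ereal_of_enat D \<le> ereal_of_enat D'
      else ereal (3/5) * ereal_of_enat D - ereal (6/5) \<le> ereal_of_enat D')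
     \<and> D' \<le> D"


section \<open>Randomized random-access programs with logarithmic cost\<close>

text \<open>
  A structured version of the random access machine: finitely many scalar registers and
  finitely many unbounded random-access arrays, all holding natural numbers.
  The cost measure is the logarithmic one: every operation is charged
  the binary length of the number it produces, and operands and array indices
  are charged as subexpressions, so large numbers give no free
  computing power. For numbers polynomially bounded in the input size this agrees with the
  unit-cost word RAM up to a factor logarithmic in the input size.
\<close>

datatype aexp =
    Const nat
  | Var string
  | Read string aexp
  | Plus aexp aexp
  | Minus aexp aexp
  | Times aexp aexp
  | Div aexp aexp

datatype bexp = Less aexp aexp | BNot bexp | BAnd bexp bexp

datatype com =
    Skip
  | Assign string aexp
  | Write string aexp aexp
  | Sample string aexp
  | Seq com com
  | Cond bexp com com
  | While bexp com

record store =
  reg :: "string \<Rightarrow> nat"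
  arr :: "string \<Rightarrow> nat \<Rightarrow> nat"

definition set_reg :: "string \<Rightarrow> nat \<Rightarrow> store \<Rightarrow> store" where
  "set_reg x v s = s\<lparr>reg := (reg s)(x := v)\<rparr>"

definition set_arr :: "string \<Rightarrow> nat \<Rightarrow> nat \<Rightarrow> store \<Rightarrow> store" where
  "set_arr a i v s = s\<lparr>arr := (arr s)(a := (arr s a)(i := v))\<rparr>"

text \<open>Subtraction is truncated at \<open>0\<close>, and division by \<open>0\<close> yields \<open>0\<close>.\<close>

primrec aval :: "aexp \<Rightarrow> store \<Rightarrow> nat" where
  "aval (Const k) s = k"
| "aval (Var x) s = reg s x"
| "aval (Read a e) s = arr s a (aval e s)"
| "aval (Plus e1 e2) s = aval e1 s + aval e2 s"
| "aval (Minus e1 e2) s = aval e1 s - aval e2 s"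
| "aval (Times e1 e2) s = aval e1 s * aval e2 s"
| "aval (Div e1 e2) s = aval e1 s div aval e2 s"

primrec bval :: "bexp \<Rightarrow> store \<Rightarrow> bool" where
  "bval (Less e1 e2) s \<longleftrightarrow> aval e1 s < aval e2 s"
| "bval (BNot b) s \<longleftrightarrow> \<not> bval b s"
| "bval (BAnd b1 b2) s \<longleftrightarrow> bval b1 s \<and> bval b2 s"

text \<open>\<open>floorlog 2 v\<close> is the number of binary digits of \<open>v\<close> (and \<open>0\<close> for \<open>v = 0\<close>).\<close>

definition word_cost :: "nat \<Rightarrow> nat" where
  "word_cost v = 1 + floorlog 2 v"

primrec acost :: "aexp \<Rightarrow> store \<Rightarrow> nat" where
  "acost (Const k) s = word_cost k"
| "acost (Var x) s = word_cost (reg s x)"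
| "acost (Read a e) s = acost e s + word_cost (aval (Read a e) s)"
| "acost (Plus e1 e2) s = acost e1 s + acost e2 s + word_cost (aval (Plus e1 e2) s)"
| "acost (Minus e1 e2) s = acost e1 s + acost e2 s + word_cost (aval (Minus e1 e2) s)"
| "acost (Times e1 e2) s = acost e1 s + acost e2 s + word_cost (aval (Times e1 e2) s)"
| "acost (Div e1 e2) s = acost e1 s + acost e2 s + word_cost (aval (Div e1 e2) s)"

primrec bcost :: "bexp \<Rightarrow> store \<Rightarrow> nat" where
  "bcost (Less e1 e2) s = 1 + acost e1 s + acost e2 s"
| "bcost (BNot b) s = 1 + bcost b s"
| "bcost (BAnd b1 b2) s = 1 + bcost b1 s + bcost b2 s"

definition charge :: "nat \<Rightarrow> (store \<times> nat) pmf \<Rightarrow> (store \<times> nat) pmf" where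
  "charge t D = map_pmf (\<lambda>(s, u). (s, t + u)) D"

text \<open>
  \<open>exec c s D\<close>: started in store \<open>s\<close>, the program \<open>c\<close> terminates whatever the outcome of its
  random choices, and \<open>D\<close> is the joint distribution of the final store and the running time.
  \<open>Sample x e\<close> stores in \<open>x\<close> a fresh uniformly random element of \<open>{0..<k}\<close>, where \<open>k\<close> is the
  value of \<open>e\<close> (or \<open>1\<close> if that value is \<open>0\<close>).
\<close>

inductive exec :: "com \<Rightarrow> store \<Rightarrow> (store \<times> nat) pmf \<Rightarrow> bool" where
  exec_Skip:
    "exec Skip s (return_pmf (s, 1))"
| exec_Assign:
    "exec (Assign x e) s (return_pmf (set_reg x (aval e s) s, 1 + acost e s))"
| exec_Write:
    "exec (Write a e1 e2) s
       (return_pmf (set_arr a (aval e1 s) (aval e2 s) s, 1 + acost e1 s + acost e2 s))"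
| exec_Sample:
    "exec (Sample x e) s
       (map_pmf (\<lambda>v. (set_reg x v s, 1 + acost e s)) (pmf_of_set {0..<max 1 (aval e s)}))"
| exec_Seq:
    "exec c1 s D \<Longrightarrow> (\<forall>(s', t) \<in> set_pmf D. exec c2 s' (F s')) \<Longrightarrow>
     exec (Seq c1 c2) s (bind_pmf D (\<lambda>(s', t). charge t (F s')))"
| exec_CondTrue:
    "bval b s \<Longrightarrow> exec c1 s D \<Longrightarrow> exec (Cond b c1 c2) s (charge (bcost b s) D)"
| exec_CondFalse:
    "\<not> bval b s \<Longrightarrow> exec c2 s D \<Longrightarrow> exec (Cond b c1 c2) s (charge (bcost b s) D)"
| exec_WhileFalse:
    "\<not> bval b s \<Longrightarrow> exec (While b c) s (return_pmf (s, bcost b s))"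
| exec_WhileTrue:
    "bval b s \<Longrightarrow> exec (Seq c (While b c)) s D \<Longrightarrow>
     exec (While b c) s (charge (bcost b s) D)"

inductive_cases exec_SkipE: "exec Skip s D"
inductive_cases exec_AssignE: "exec (Assign x e) s D"
inductive_cases exec_WriteE: "exec (Write a e1 e2) s D"
inductive_cases exec_SampleE: "exec (Sample x e) s D"
inductive_cases exec_SeqE: "exec (Seq c1 c2) s D"
inductive_cases exec_CondE: "exec (Cond b c1 c2) s D"
inductive_cases exec_WhileE: "exec (While b c) s D"

lemma exec_unique: "exec c s D \<Longrightarrow> exec c s D' \<Longrightarrow> D = D'"
proof (induction arbitrary: D' rule: exec.induct)
  case exec_Skip
  then show ?case by (rule exec_SkipE) simp
next
  case exec_Assign
  then show ?case by (rule exec_AssignE) simp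
next
  case exec_Write
  then show ?case by (rule exec_WriteE) simp
next
  case exec_Sample
  then show ?case by (rule exec_SampleE) simp
next
  case (exec_Seq c1 s D c2 F)
  from exec_Seq.prems show ?case
  proof (rule exec_SeqE)
    fix D1 F1
    assume D': "D' = bind_pmf D1 (\<lambda>(s', t). charge t (F1 s'))"
      and 1: "exec c1 s D1" and 2: "\<forall>(s', t) \<in> set_pmf D1. exec c2 s' (F1 s')"
    have "D = D1" using exec_Seq.IH(1) 1 by blast
    moreover have "F s' = F1 s'" if "(s', t) \<in> set_pmf D" for s' t
      using exec_Seq.IH(2) 2 that \<open>D = D1\<close> by fastforce
    ultimately show ?case
      unfolding D' by (intro bind_pmf_cong) auto
  qed
next
  case (exec_CondTrue b s c1 D c2)
  from exec_CondTrue.prems show ?case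
    by (rule exec_CondE) (use exec_CondTrue.hyps exec_CondTrue.IH in blast)+
next
  case (exec_CondFalse b s c2 D c1)
  from exec_CondFalse.prems show ?case
    by (rule exec_CondE) (use exec_CondFalse.hyps exec_CondFalse.IH in blast)+
next
  case (exec_WhileFalse b s c)
  from exec_WhileFalse.prems show ?case
    by (rule exec_WhileE) (use exec_WhileFalse.hyps in blast)+
next
  case (exec_WhileTrue b s c D)
  from exec_WhileTrue.prems show ?case
    by (rule exec_WhileE) (use exec_WhileTrue.hyps exec_WhileTrue.IH in blast)+
qed

definition terminates :: "com \<Rightarrow> store \<Rightarrow> bool" where
  "terminates c s \<longleftrightarrow> (\<exists>D. exec c s D)"

text \<open>Only meaningful if the program terminates on \<open>s\<close>; see \<open>exec_run\<close>.\<close>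

definition run :: "com \<Rightarrow> store \<Rightarrow> (store \<times> nat) pmf" where
  "run c s = (THE D. exec c s D)"

lemma run_eqI: "exec c s D \<Longrightarrow> run c s = D"
  unfolding run_def using exec_unique by (blast intro: the_equality)

lemma exec_run: "terminates c s \<Longrightarrow> exec c s (run c s)"
  unfolding terminates_def using run_eqI by blast


section \<open>Instances and their encoding\<close>

text \<open>
  The vertices of an \<open>n\<close>-vertex graph are named \<open>0, \<dots>, n - 1\<close>. The edges are given as a list
  \<open>es\<close> that contains every edge exactly once, in arbitrary order and with arbitrarily ordered
  endpoints. Both \<open>S\<close> and its complement are nonempty, since otherwise the maximum in
  \<open>ST_diameter\<close> is undefined.
\<close>

definition ST_instance :: "nat \<Rightarrow> nat set set \<Rightarrow> nat set \<Rightarrow> (nat \<times> nat) list \<Rightarrow> bool" where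
  "ST_instance n E S es \<longleftrightarrow>
     simple_graph {0..<n} E \<and> S \<subseteq> {0..<n} \<and> S \<noteq> {} \<and> {0..<n} - S \<noteq> {} \<and>
     distinct (map (\<lambda>(u, v). {u, v}) es) \<and> (\<lambda>(u, v). {u, v}) ` set es = E"

text \<open>All registers and array cells that do not hold the input are initially \<open>0\<close>.\<close>

definition input_store :: "nat \<Rightarrow> nat set \<Rightarrow> (nat \<times> nat) list \<Rightarrow> store" where
  "input_store n S es =
     \<lparr>reg = (\<lambda>_. 0)(''n'' := n, ''m'' := length es),
      arr = (\<lambda>_ _. 0)
        (''fst'' := (\<lambda>i. if i < length es then fst (es ! i) else 0),
         ''snd'' := (\<lambda>i. if i < length es then snd (es ! i) else 0),
         ''S'' := (\<lambda>v. if v \<in> S then 1 else 0))\<rparr>"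

text \<open>The register \<open>inf\<close> flags an infinite estimate.\<close>

definition estimate :: "store \<Rightarrow> enat" where
  "estimate s = (if reg s ''inf'' = 0 then enat (reg s ''out'') else \<infinity>)"

text \<open>
  Running time in \<open>\<tilde>O(m \<surd>n)\<close>, for all inputs and all random choices. Instances have
  \<open>n \<ge> 2\<close>, so \<open>log 2 n \<ge> 1\<close>. The maximum with \<open>1\<close> only concerns the
  edgeless graphs, for which no program could run in time \<open>0\<close>.
\<close>

definition soft_O_m_sqrt_n_time :: "com \<Rightarrow> bool" where
  "soft_O_m_sqrt_n_time P \<longleftrightarrow>
     (\<exists>(C::real) (k::nat). \<forall>n E S es. ST_instance n E S es \<longrightarrow>
        terminates P (input_store n S es) \<and>
        (\<forall>(s, t) \<in> set_pmf (run P (input_store n S es)).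
           real t \<le> C * (real (max 1 (card E)) * sqrt (real n) * log 2 (real n) ^ k)))"

text \<open>
  With high probability: the failure probability is eventually below every inverse
  polynomial in \<open>n\<close>, for one and the same program. The threshold \<open>N\<close> cannot be dropped:
  for a fixed \<open>n \<ge> 2\<close>, the bound \<open>1 - 1 / n powr c\<close> for all \<open>c\<close>
  would say that the success probability is \<open>1\<close>.
\<close>

definition whp_correct :: "com \<Rightarrow> bool" where
  "whp_correct P \<longleftrightarrow>
     (\<forall>c::real. \<exists>N. \<forall>n\<ge>N. \<forall>E S es. ST_instance n E S es \<longrightarrow>
        measure_pmf.prob (run P (input_store n S es))
          {(s, t). good_estimate (ST_diameter E S ({0..<n} - S)) (estimate s)}
        \<ge> 1 - 1 / real n powr c)"

end

theory Submission
  imports Defs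
begin


text \<open>
  Testing a vertex \<open>x\<close> means running breadth-first search from \<open>x\<close> and from a nearest vertex \<open>y\<close>
  of the other colour; the estimate is the largest distance between vertices of different
  colours seen in this way. Let \<open>d(s, t) = D\<close> and suppose that all estimates are below
  \<open>q \<approx> 3D/5\<close>. Test a random set \<open>R\<close>; then \<open>R\<close> contains no vertex of \<open>S\<close> within distance about
  \<open>2D/5\<close> of \<open>s\<close> and no vertex of \<open>T\<close> within distance about \<open>D/5\<close> of \<open>s\<close>. The vertex \<open>w \<in> S\<close>
  furthest from \<open>R\<close>, where distances to \<open>T\<close> are counted twice, has the same property, so
  with high probability only few vertices of \<open>S\<close> are within \<open>2D/5\<close> and only few vertices of \<open>T\<close>
  within \<open>D/5\<close> of \<open>w\<close>, and all of them can be tested. A shortest path from \<open>w\<close> to \<open>t\<close> has length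
  below \<open>q\<close>. If its vertex at distance \<open>D/5\<close> is in \<open>T\<close>, this vertex is further than \<open>q\<close> from \<open>s\<close>.
  Otherwise, either the vertex at distance \<open>2D/5\<close> or the endpoint in \<open>S\<close> of a colour-changing
  edge before it has a nearest vertex of \<open>T\<close> that is at distance at least \<open>q\<close> from \<open>s\<close>.

  Disconnected graphs always have infinite \<open>ST\<close>-diameter because \<open>S\<close> and \<open>T\<close> cover all vertices,
  and graphs with fewer than \<open>n - 1\<close> edges are recognised as such without reading the input.
\<close>


subsection \<open>A program logic with logarithmic cost\<close>

text \<open>The fraction 3/5 balances two demands. Let q be the target and a = D - q. A tested
  vertex of \<open>S\<close> within a of s is at least q from t, and a tested vertex of
  \<open>T\<close> within a/2 of s has its nearest vertex of \<open>S\<close> within a of s, hence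
  the double weight. The route from w to t saves a/2 when it reaches \<open>T\<close> or changes
  colour after that distance. This needs 2q \<le> D + a/2, which is q \<le> 3D/5.

  The sample consists of about \<surd>n log n draws, and the same number caps the ball tested
  afterwards. A larger ball is missed with probability at most exp(-log^2 n), below every inverse
  polynomial, so one program serves all exponents. The obstacle is that w depends on the sample: a
  good sample is therefore defined by a property of all centres at once, and a union bound runs over
  them.

  Randomness is kept apart from the rest. One logic treats every run, bounds its time and proves
  correctness on the assumption of a good sample. The other bounds only the expectation of the bad
  event, which depends on the sampled array alone.\<close>

definition bounded_store :: "nat \<Rightarrow> store \<Rightarrow> bool" where
  "bounded_store B s \<longleftrightarrow> (\<forall>x. reg s x \<le> B) \<and> (\<forall>a i. arr s a i \<le> B)"

lemma reg_set_reg [simp]: "reg (set_reg x v s) = (reg s)(x := v)"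
  and arr_set_reg [simp]: "arr (set_reg x v s) = arr s"
  and reg_set_arr [simp]: "reg (set_arr a i v s) = reg s"
  and arr_set_arr [simp]: "arr (set_arr a i v s) = (arr s)(a := (arr s a)(i := v))"
  by (simp_all add: set_reg_def set_arr_def)

text \<open>
  Costs are counted in units of \<open>word_cost B\<close>, where \<open>B\<close> bounds all stored numbers:
  a value of \<open>e\<close> has length at most \<open>value_units e\<close>, and evaluating \<open>e\<close> costs at most
  \<open>aexp_units e\<close>.
\<close>

primrec value_units :: "aexp \<Rightarrow> nat" where
  "value_units (Const k) = k + 1"
| "value_units (Var x) = 1"
| "value_units (Read a e) = 1"
| "value_units (Plus e1 e2) = value_units e1 + value_units e2"
| "value_units (Minus e1 e2) = value_units e1"
| "value_units (Times e1 e2) = value_units e1 + value_units e2"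
| "value_units (Div e1 e2) = value_units e1"

primrec aexp_units :: "aexp \<Rightarrow> nat" where
  "aexp_units (Const k) = k + 1"
| "aexp_units (Var x) = 1"
| "aexp_units (Read a e) = aexp_units e + 1"
| "aexp_units (Plus e1 e2) = aexp_units e1 + aexp_units e2 + value_units (Plus e1 e2)"
| "aexp_units (Minus e1 e2) = aexp_units e1 + aexp_units e2 + value_units (Minus e1 e2)"
| "aexp_units (Times e1 e2) = aexp_units e1 + aexp_units e2 + value_units (Times e1 e2)"
| "aexp_units (Div e1 e2) = aexp_units e1 + aexp_units e2 + value_units (Div e1 e2)"

primrec bexp_units :: "bexp \<Rightarrow> nat" where
  "bexp_units (Less e1 e2) = 1 + aexp_units e1 + aexp_units e2"
| "bexp_units (BNot b) = 1 + bexp_units b"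
| "bexp_units (BAnd b1 b2) = 1 + bexp_units b1 + bexp_units b2"

lemma word_cost_mono: "x \<le> y \<Longrightarrow> word_cost x \<le> word_cost y"
  by (simp add: word_cost_def floorlog_mono)

lemma word_cost_ge_1: "1 \<le> word_cost x"
  by (simp add: word_cost_def)

text \<open>A carry lengthens the longer operand by at most one digit, and the \<open>1 +\<close> in
  the \<open>word_cost\<close> of the other operand pays for it.\<close>

lemma word_cost_add: "word_cost (x + y) \<le> word_cost x + word_cost y"
proof -
  have "x < 2 ^ floorlog 2 x" "y < 2 ^ floorlog 2 y"
    by (auto intro: floorlog_leD)
  then have "x + y < 2 * 2 ^ max (floorlog 2 x) (floorlog 2 y)"
    by (smt (verit) add_less_le_mono less_imp_le_nat max.cobounded1 max.cobounded2 mult_2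
        one_le_numeral order_less_le_trans power_increasing)
  then have "floorlog 2 (x + y) \<le> Suc (max (floorlog 2 x) (floorlog 2 y))"
    by (intro floorlog_leI) auto
  then show ?thesis
    by (simp add: word_cost_def)
qed

lemma word_cost_mult: "word_cost (x * y) \<le> word_cost x + word_cost y"
proof (cases "x * y = 0")
  case False
  have "x < 2 ^ floorlog 2 x" "y < 2 ^ floorlog 2 y"
    by (auto intro: floorlog_leD)
  then have "x * y < 2 ^ (floorlog 2 x + floorlog 2 y)"
    unfolding power_add by (intro mult_strict_mono) auto
  then have "floorlog 2 (x * y) \<le> floorlog 2 x + floorlog 2 y"
    by (intro floorlog_leI) auto
  then show ?thesis
    by (simp add: word_cost_def)
qed (auto simp: word_cost_def floorlog_def)

lemma word_cost_const: "word_cost k \<le> (k + 1) * word_cost B"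
proof -
  have "floorlog 2 k \<le> k"
    by (intro floorlog_leI) auto
  then have "word_cost k \<le> (k + 1) * 1"
    by (simp add: word_cost_def)
  also have "\<dots> \<le> (k + 1) * word_cost B"
    using word_cost_ge_1 by (intro mult_le_mono2)
  finally show ?thesis .
qed

lemma word_cost_aval:
  assumes "bounded_store B s"
  shows "word_cost (aval e s) \<le> value_units e * word_cost B"
proof (induction e)
  case (Const k)
  show ?case using word_cost_const by simp
next
  case (Plus e1 e2)
  then show ?case
    using word_cost_add[of "aval e1 s" "aval e2 s"] by (simp add: add_mult_distrib)
next
  case (Times e1 e2)
  then show ?case
    using word_cost_mult[of "aval e1 s" "aval e2 s"] by (simp add: add_mult_distrib)
next
  case (Minus e1 e2)
  then show ?case
    using word_cost_mono[of "aval e1 s - aval e2 s" "aval e1 s"] by simp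
next
  case (Div e1 e2)
  then show ?case
    using word_cost_mono[of "aval e1 s div aval e2 s" "aval e1 s"] by simp
qed (use assms in \<open>auto simp: bounded_store_def intro: word_cost_mono\<close>)

lemma acost_le:
  assumes "bounded_store B s"
  shows "acost e s \<le> aexp_units e * word_cost B"
proof (induction e)
  case (Const k)
  show ?case using word_cost_const by simp
next
  case (Read a e)
  have "word_cost (aval (Read a e) s) \<le> 1 * word_cost B"
    using word_cost_aval[OF assms, of "Read a e"] by simp
  then show ?case
    using Read by (simp add: add_mult_distrib)
next
  case (Plus e1 e2)
  then show ?case
    using word_cost_aval[OF assms, of "Plus e1 e2"] by (simp add: add_mult_distrib)
next
  case (Minus e1 e2)
  then show ?case
    using word_cost_aval[OF assms, of "Minus e1 e2"] by (simp add: add_mult_distrib)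
next
  case (Times e1 e2)
  then show ?case
    using word_cost_aval[OF assms, of "Times e1 e2"] by (simp add: add_mult_distrib)
next
  case (Div e1 e2)
  then show ?case
    using word_cost_aval[OF assms, of "Div e1 e2"] by (simp add: add_mult_distrib)
qed (use assms in \<open>auto simp: bounded_store_def intro: word_cost_mono\<close>)

lemma bcost_le:
  assumes "bounded_store B s"
  shows "bcost b s \<le> bexp_units b * word_cost B"
proof (induction b)
  case (Less e1 e2)
  show ?case
    using acost_le[OF assms, of e1] acost_le[OF assms, of e2] word_cost_ge_1[of B]
    by (simp add: add_mult_distrib)
next
  case (BNot b)
  then show ?case
    using word_cost_ge_1[of B] by (simp add: add_mult_distrib)
next
  case (BAnd b1 b2)
  then show ?case
    using word_cost_ge_1[of B] by (simp add: add_mult_distrib)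
qed

section \<open>Frame conditions and worst-case specifications\<close>

primrec mod_regs :: "com \<Rightarrow> string set" where
  "mod_regs Skip = {}"
| "mod_regs (Assign x e) = {x}"
| "mod_regs (Write a e1 e2) = {}"
| "mod_regs (Sample x e) = {x}"
| "mod_regs (Seq c1 c2) = mod_regs c1 \<union> mod_regs c2"
| "mod_regs (Cond b c1 c2) = mod_regs c1 \<union> mod_regs c2"
| "mod_regs (While b c) = mod_regs c"

primrec mod_arrs :: "com \<Rightarrow> string set" where
  "mod_arrs Skip = {}"
| "mod_arrs (Assign x e) = {}"
| "mod_arrs (Write a e1 e2) = {a}"
| "mod_arrs (Sample x e) = {}"
| "mod_arrs (Seq c1 c2) = mod_arrs c1 \<union> mod_arrs c2"
| "mod_arrs (Cond b c1 c2) = mod_arrs c1 \<union> mod_arrs c2"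
| "mod_arrs (While b c) = mod_arrs c"

definition agree :: "com \<Rightarrow> store \<Rightarrow> store \<Rightarrow> bool" where
  "agree c s s' \<longleftrightarrow>
     (\<forall>x. x \<notin> mod_regs c \<longrightarrow> reg s' x = reg s x) \<and> (\<forall>a. a \<notin> mod_arrs c \<longrightarrow> arr s' a = arr s a)"

lemma agree_refl: "agree c s s"
  by (simp add: agree_def)

lemma agree_reg: "agree c s s' \<Longrightarrow> x \<notin> mod_regs c \<Longrightarrow> reg s' x = reg s x"
  and agree_arr: "agree c s s' \<Longrightarrow> a \<notin> mod_arrs c \<Longrightarrow> arr s' a = arr s a"
  by (auto simp: agree_def)

lemma agree_trans:
  "agree c s s' \<Longrightarrow> agree c' s' s'' \<Longrightarrow> mod_regs c \<subseteq> mod_regs d \<Longrightarrow> mod_arrs c \<subseteq> mod_arrs d \<Longrightarrow>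
   mod_regs c' \<subseteq> mod_regs d \<Longrightarrow> mod_arrs c' \<subseteq> mod_arrs d \<Longrightarrow> agree d s s''"
  unfolding agree_def by (metis subsetD)

lemma exec_agree: "exec c s D \<Longrightarrow> (s', t) \<in> set_pmf D \<Longrightarrow> agree c s s'"
proof (induction arbitrary: s' t rule: exec.induct)
  case (exec_Seq c1 s D c2 F)
  from exec_Seq.prems obtain s1 t1 t2
    where 1: "(s1, t1) \<in> set_pmf D" "(s', t2) \<in> set_pmf (F s1)"
    by (auto simp: charge_def)
  have "agree c1 s s1" "agree c2 s1 s'"
    using exec_Seq.IH 1 by blast+
  then show ?case
    by (rule agree_trans) auto
next
  case (exec_CondTrue b s c1 D c2)
  then obtain u where "(s', u) \<in> set_pmf D" by (auto simp: charge_def)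
  then show ?case using exec_CondTrue.IH by (auto simp: agree_def)
next
  case (exec_CondFalse b s c2 D c1)
  then obtain u where "(s', u) \<in> set_pmf D" by (auto simp: charge_def)
  then show ?case using exec_CondFalse.IH by (auto simp: agree_def)
next
  case (exec_WhileTrue b s c D)
  then obtain u where "(s', u) \<in> set_pmf D" by (auto simp: charge_def)
  then show ?case using exec_WhileTrue.IH by (auto simp: agree_def)
qed (auto simp: agree_def)

text \<open>Termination, cost and postcondition are claimed for a single start store, so that
  sequencing nests \<open>wp\<close> in the postcondition. Boundedness is a guard before and a claim
  after: each command owes only that the number it stores is at most \<open>B\<close>.\<close>

definition wp :: "nat \<Rightarrow> com \<Rightarrow> store \<Rightarrow> nat \<Rightarrow> (store \<Rightarrow> bool) \<Rightarrow> bool" where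
  "wp B c s C Q \<longleftrightarrow> (bounded_store B s \<longrightarrow>
     (\<exists>D. exec c s D \<and>
       (\<forall>(s', t) \<in> set_pmf D. bounded_store B s' \<and> t \<le> C * word_cost B \<and> Q s')))"

text \<open>The premise \<open>agree c s s'\<close> carries the frame: specifications speak only
  about what a program writes, and every use recovers the untouched registers and arrays from the
  syntax of the program.\<close>

lemma wp_conseq:
  assumes "wp B c s C Q" and "C \<le> C'"
    and "\<And>s'. Q s' \<Longrightarrow> agree c s s' \<Longrightarrow> bounded_store B s' \<Longrightarrow> Q' s'"
  shows "wp B c s C' Q'"
  unfolding wp_def
proof
  assume "bounded_store B s"
  with assms(1) obtain D where D: "exec c s D"
    and *: "\<forall>(s', t) \<in> set_pmf D. bounded_store B s' \<and> t \<le> C * word_cost B \<and> Q s'"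
    unfolding wp_def by blast
  have "bounded_store B s' \<and> t \<le> C' * word_cost B \<and> Q' s'" if "(s', t) \<in> set_pmf D" for s' t
  proof -
    have "t \<le> C * word_cost B" using * that by blast
    also have "\<dots> \<le> C' * word_cost B" using assms(2) by (rule mult_le_mono1)
    finally show ?thesis
      using * that assms(3) exec_agree[OF D that] by blast
  qed
  with D show "\<exists>D. exec c s D \<and>
      (\<forall>(s', t) \<in> set_pmf D. bounded_store B s' \<and> t \<le> C' * word_cost B \<and> Q' s')"
    by blast
qed

lemma wp_bounded: "(bounded_store B s \<Longrightarrow> wp B c s C Q) \<Longrightarrow> wp B c s C Q"
  by (auto simp: wp_def)

lemma wp_Skip: "Q s \<Longrightarrow> wp B Skip s 1 Q"
  unfolding wp_def using exec_Skip[of s] word_cost_ge_1[of B] by fastforce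

lemma wp_Assign:
  assumes "bounded_store B s \<Longrightarrow> aval e s \<le> B" and "Q (set_reg x (aval e s) s)"
  shows "wp B (Assign x e) s (1 + aexp_units e) Q"
  unfolding wp_def
proof
  assume s: "bounded_store B s"
  have "bounded_store B (set_reg x (aval e s) s)"
    using s assms(1)[OF s] by (auto simp: bounded_store_def)
  moreover have "1 + acost e s \<le> (1 + aexp_units e) * word_cost B"
    using acost_le[OF s, of e] word_cost_ge_1[of B] by (simp add: add_mult_distrib)
  ultimately show "\<exists>D. exec (Assign x e) s D \<and>
      (\<forall>(s', t) \<in> set_pmf D. bounded_store B s' \<and> t \<le> (1 + aexp_units e) * word_cost B \<and> Q s')"
    using assms(2) by - (rule exI, rule conjI, rule exec_Assign, simp)
qed

lemma wp_Write:
  assumes "bounded_store B s \<Longrightarrow> aval e2 s \<le> B" and "Q (set_arr a (aval e1 s) (aval e2 s) s)"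
  shows "wp B (Write a e1 e2) s (1 + aexp_units e1 + aexp_units e2) Q"
  unfolding wp_def
proof
  assume s: "bounded_store B s"
  have "bounded_store B (set_arr a (aval e1 s) (aval e2 s) s)"
    using s assms(1)[OF s] by (auto simp: bounded_store_def)
  moreover have "1 + acost e1 s + acost e2 s \<le> (1 + aexp_units e1 + aexp_units e2) * word_cost B"
    using acost_le[OF s, of e1] acost_le[OF s, of e2] word_cost_ge_1[of B]
    by (simp add: add_mult_distrib)
  ultimately show "\<exists>D. exec (Write a e1 e2) s D \<and>
      (\<forall>(s', t) \<in> set_pmf D.
         bounded_store B s' \<and> t \<le> (1 + aexp_units e1 + aexp_units e2) * word_cost B \<and> Q s')"
    using assms(2) by - (rule exI, rule conjI, rule exec_Write, simp)
qed

lemma wp_Sample: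
  assumes "bounded_store B s \<Longrightarrow> aval e s \<le> B" and "0 < aval e s"
    and "\<And>v. v < aval e s \<Longrightarrow> Q (set_reg x v s)"
  shows "wp B (Sample x e) s (1 + aexp_units e) Q"
  unfolding wp_def
proof
  assume s: "bounded_store B s"
  have "bounded_store B (set_reg x v s)" if "v < aval e s" for v
    using s assms(1)[OF s] that by (auto simp: bounded_store_def)
  moreover have "1 + acost e s \<le> (1 + aexp_units e) * word_cost B"
    using acost_le[OF s, of e] word_cost_ge_1[of B] by (simp add: add_mult_distrib)
  ultimately show "\<exists>D. exec (Sample x e) s D \<and>
      (\<forall>(s', t) \<in> set_pmf D. bounded_store B s' \<and> t \<le> (1 + aexp_units e) * word_cost B \<and> Q s')"
    using assms(2,3) by - (rule exI, rule conjI, rule exec_Sample, auto)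
qed

text \<open>\<open>exec_Seq\<close> asks for a function that picks a distribution for every
  intermediate store. Distributions are unique, so \<open>run\<close> is such a function.\<close>

lemma exec_Seq_run:
  "exec c1 s D \<Longrightarrow> (\<forall>(s', t) \<in> set_pmf D. terminates c2 s') \<Longrightarrow>
   exec (Seq c1 c2) s (bind_pmf D (\<lambda>(s', t). charge t (run c2 s')))"
  by (rule exec_Seq) (auto intro: exec_run)

lemma wp_Seq:
  assumes "wp B c1 s C1 (\<lambda>s'. wp B c2 s' C2 Q)"
  shows "wp B (Seq c1 c2) s (C1 + C2) Q"
  unfolding wp_def
proof
  assume s: "bounded_store B s"
  obtain D where D: "exec c1 s D"
    and *: "\<forall>(s', t) \<in> set_pmf D. bounded_store B s' \<and> t \<le> C1 * word_cost B \<and> wp B c2 s' C2 Q"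
    using assms s unfolding wp_def[of B c1] by blast
  have **: "terminates c2 s'
      \<and> (\<forall>(s'', t') \<in> set_pmf (run c2 s'). bounded_store B s'' \<and> t' \<le> C2 * word_cost B \<and> Q s'')"
    if st: "(s', t) \<in> set_pmf D" for s' t
  proof -
    from * st obtain D' where D': "exec c2 s' D'"
      "\<forall>(s'', t') \<in> set_pmf D'. bounded_store B s'' \<and> t' \<le> C2 * word_cost B \<and> Q s''"
      unfolding wp_def by blast
    then show ?thesis
      using run_eqI[OF D'(1)] by (auto simp: terminates_def)
  qed
  show "\<exists>D. exec (Seq c1 c2) s D \<and>
      (\<forall>(s', t) \<in> set_pmf D. bounded_store B s' \<and> t \<le> (C1 + C2) * word_cost B \<and> Q s')"
  proof (intro exI conjI)
    show "exec (Seq c1 c2) s (bind_pmf D (\<lambda>(s', t). charge t (run c2 s')))"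
      using D ** by (intro exec_Seq_run) auto
    show "\<forall>(s', t) \<in> set_pmf (bind_pmf D (\<lambda>(s', t). charge t (run c2 s'))).
        bounded_store B s' \<and> t \<le> (C1 + C2) * word_cost B \<and> Q s'"
      using * ** by (fastforce simp: charge_def add_mult_distrib intro: add_mono)
  qed
qed

lemma wp_charge:
  assumes "bounded_store B s \<Longrightarrow> wp B c s C Q"
    and "\<And>D. exec c s D \<Longrightarrow> exec c' s (charge (bcost b s) D)"
  shows "wp B c' s (bexp_units b + C) Q"
  unfolding wp_def
proof
  assume s: "bounded_store B s"
  then obtain D where D: "exec c s D"
    and *: "\<forall>(s', t) \<in> set_pmf D. bounded_store B s' \<and> t \<le> C * word_cost B \<and> Q s'"
    using assms(1) unfolding wp_def by blast
  show "\<exists>D. exec c' s D \<and>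
      (\<forall>(s', t) \<in> set_pmf D. bounded_store B s' \<and> t \<le> (bexp_units b + C) * word_cost B \<and> Q s')"
  proof (intro exI conjI)
    show "exec c' s (charge (bcost b s) D)"
      by (rule assms(2)[OF D])
    show "\<forall>(s', t) \<in> set_pmf (charge (bcost b s) D).
        bounded_store B s' \<and> t \<le> (bexp_units b + C) * word_cost B \<and> Q s'"
      using * bcost_le[OF s, of b] by (force simp: charge_def add_mult_distrib intro: add_mono)
  qed
qed

lemma wp_Cond:
  assumes "bval b s \<Longrightarrow> wp B c1 s C1 Q" and "\<not> bval b s \<Longrightarrow> wp B c2 s C2 Q"
  shows "wp B (Cond b c1 c2) s (bexp_units b + max C1 C2) Q"
proof (cases "bval b s")
  case True
  then show ?thesis
    by (intro wp_charge[where c = c1] wp_conseq[OF assms(1)]) (auto intro: exec_CondTrue)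
next
  case False
  then show ?thesis
    by (intro wp_charge[where c = c2] wp_conseq[OF assms(2)]) (auto intro: exec_CondFalse)
qed

lemma wp_WhileFalse:
  assumes "\<not> bval b s" and "Q s"
  shows "wp B (While b c) s (bexp_units b) Q"
  unfolding wp_def using bcost_le[of B s b] exec_WhileFalse[OF assms(1)] assms(2) by fastforce

lemma wp_WhileTrue:
  assumes "bval b s" and "wp B c s C1 (\<lambda>s'. wp B (While b c) s' C2 Q)"
  shows "wp B (While b c) s (bexp_units b + (C1 + C2)) Q"
  using assms by (intro wp_charge[where c = "Seq c (While b c)"] wp_Seq)
    (auto intro: exec_WhileTrue)

lemma bexp_units_pos: "0 < bexp_units b"
  by (cases b) auto

text \<open>The potential \<open>\<Phi>\<close> pays for the loop and, as every guard has positive cost, makes it terminate.\<close>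

lemma wp_While:
  fixes \<Phi> :: "store \<Rightarrow> nat"
  assumes "I s"
    and step: "\<And>s. I s \<Longrightarrow> bval b s \<Longrightarrow> bounded_store B s \<Longrightarrow>
      \<exists>C. wp B c s C (\<lambda>s'. I s' \<and> \<Phi> s' + C + bexp_units b \<le> \<Phi> s)"
    and exit: "\<And>s. I s \<Longrightarrow> \<not> bval b s \<Longrightarrow> bounded_store B s \<Longrightarrow> Q s \<and> bexp_units b \<le> \<Phi> s"
  shows "wp B (While b c) s (\<Phi> s) Q"
  using assms(1)
proof (induction "\<Phi> s" arbitrary: s rule: less_induct)
  case less
  show ?case
  proof (rule wp_bounded)
    assume bd: "bounded_store B s"
    show "wp B (While b c) s (\<Phi> s) Q"
    proof (cases "bval b s")
      case True
      from step[OF less.prems True bd]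
      obtain C where C: "wp B c s C (\<lambda>s'. I s' \<and> \<Phi> s' + C + bexp_units b \<le> \<Phi> s)"
        by blast
      obtain D where D: "exec c s D"
        and *: "\<forall>(s', t) \<in> set_pmf D. \<Phi> s' + C + bexp_units b \<le> \<Phi> s"
        using C bd unfolding wp_def by fast
      \<comment> \<open>Some final store exists, so the inequality holds without reference to it. It
        is needed because the remaining budget is written with truncated subtraction.\<close>
      from set_pmf_not_empty[of D] * have le: "C + bexp_units b \<le> \<Phi> s"
        by force
      have "wp B c s C (\<lambda>s'. wp B (While b c) s' (\<Phi> s - C - bexp_units b) Q)"
      proof (rule wp_conseq[OF C])
        fix s' assume s': "I s' \<and> \<Phi> s' + C + bexp_units b \<le> \<Phi> s"
        then have "\<Phi> s' < \<Phi> s" using bexp_units_pos[of b] by linarith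
        with less.hyps s' have "wp B (While b c) s' (\<Phi> s') Q" by blast
        then show "wp B (While b c) s' (\<Phi> s - C - bexp_units b) Q"
          by (rule wp_conseq) (use s' in auto)
      qed simp
      from wp_WhileTrue[of b s B c, OF True this] show ?thesis
        by (rule wp_conseq) (use le in auto)
    next
      case False
      with exit less.prems bd have "Q s" "bexp_units b \<le> \<Phi> s" by blast+
      with wp_WhileFalse[of b s Q B c] False show ?thesis
        by (blast intro: wp_conseq)
    qed
  qed
qed

definition For :: "string \<Rightarrow> string \<Rightarrow> com \<Rightarrow> com" where
  "For v b c = Seq (Assign v (Const 0))
     (While (Less (Var v) (Var b)) (Seq c (Assign v (Plus (Var v) (Const 1)))))"

lemma mod_For [simp]:
  "mod_regs (For v b c) = insert v (mod_regs c)" "mod_arrs (For v b c) = mod_arrs c"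
  by (auto simp: For_def)

text \<open>\<open>J k\<close> describes the store in which the counter already has value
  \<open>k\<close>. The surcharge 12 covers the guard (3 units) and the increment (7 units) of a
  round; the extra round in \<open>reg s b + 1\<close> pays for the initialisation and the last
  test.\<close>

lemma wp_For:
  assumes vb: "v \<noteq> b" "v \<notin> mod_regs c" "b \<notin> mod_regs c"
    and init: "J 0 (set_reg v 0 s)"
    and step: "\<And>k s'. k < reg s b \<Longrightarrow> reg s' v = k \<Longrightarrow> agree (For v b c) s s' \<Longrightarrow>
      bounded_store B s' \<Longrightarrow> J k s' \<Longrightarrow> wp B c s' C (\<lambda>s''. J (Suc k) (set_reg v (Suc k) s''))"
    and fin: "\<And>s'. agree (For v b c) s s' \<Longrightarrow> bounded_store B s' \<Longrightarrow> J (reg s b) s' \<Longrightarrow> Q s'"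
  shows "wp B (For v b c) s ((reg s b + 1) * (C + 12)) Q"
proof (rule wp_bounded)
  assume bd: "bounded_store B s"
  define N where "N = reg s b"
  have NB: "N \<le> B" using bd by (simp add: N_def bounded_store_def)
  define b' where "b' = Less (Var v) (Var b)"
  define c' where "c' = Seq c (Assign v (Plus (Var v) (Const 1)))"
  define I where "I s' \<longleftrightarrow> reg s' v \<le> N \<and> J (reg s' v) s' \<and> agree (For v b c) s s'" for s'
  define \<Phi> where "\<Phi> s' = (N - reg s' v) * (C + 12) + 3" for s' :: store
  have b_same: "reg s' b = N" if "agree (For v b c) s s'" for s'
    using agree_reg[OF that, of b] vb by (simp add: N_def)
  have loop: "wp B (While b' c') (set_reg v 0 s) (\<Phi> (set_reg v 0 s)) Q"
  proof (rule wp_While[where I = I])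
    show "I (set_reg v 0 s)"
      using init by (auto simp: I_def agree_def)
  next
    fix s' assume I: "I s'" and b: "bval b' s'" and bd': "bounded_store B s'"
    define k where "k = reg s' v"
    have k: "k < N" and J: "J k s'" and ag: "agree (For v b c) s s'"
      using I b b_same by (auto simp: I_def b'_def k_def)
    have "wp B c s' C (\<lambda>s''. wp B (Assign v (Plus (Var v) (Const 1))) s''
        (1 + aexp_units (Plus (Var v) (Const 1)))
        (\<lambda>s'''. I s''' \<and> \<Phi> s''' + (C + (1 + aexp_units (Plus (Var v) (Const 1)))) + bexp_units b' \<le> \<Phi> s'))"
    proof (rule wp_conseq[OF step[OF _ _ ag bd' J]])
      show "k < reg s b" "reg s' v = k" using k by (auto simp: N_def k_def)
      fix s'' assume J': "J (Suc k) (set_reg v (Suc k) s'')" and ag': "agree c s' s''"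
      have v: "reg s'' v = k" using agree_reg[OF ag' vb(2)] by (simp add: k_def)
      have ag'': "agree (For v b c) s (set_reg v (Suc k) s'')"
        using ag ag' by (auto simp: agree_def)
      show "wp B (Assign v (Plus (Var v) (Const 1))) s''
        (1 + aexp_units (Plus (Var v) (Const 1)))
        (\<lambda>s'''. I s''' \<and> \<Phi> s''' + (C + (1 + aexp_units (Plus (Var v) (Const 1)))) + bexp_units b' \<le> \<Phi> s')"
      proof (intro wp_Assign)
        have "N - k = Suc (N - Suc k)" using k by simp
        then show "I (set_reg v (aval (Plus (Var v) (Const 1)) s'') s'') \<and>
          \<Phi> (set_reg v (aval (Plus (Var v) (Const 1)) s'') s'') +
          (C + (1 + aexp_units (Plus (Var v) (Const 1)))) + bexp_units b' \<le> \<Phi> s'"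
          using J' v k ag''
          by (simp add: I_def \<Phi>_def b'_def flip: k_def)
      qed (use k v NB in auto)
    qed simp
    then have "wp B c' s' (C + (1 + aexp_units (Plus (Var v) (Const 1))))
      (\<lambda>s'''. I s''' \<and> \<Phi> s''' + (C + (1 + aexp_units (Plus (Var v) (Const 1)))) + bexp_units b' \<le> \<Phi> s')"
      unfolding c'_def by (rule wp_Seq)
    then show "\<exists>C. wp B c' s' C (\<lambda>s''. I s'' \<and> \<Phi> s'' + C + bexp_units b' \<le> \<Phi> s')"
      by blast
  next
    fix s' assume I: "I s'" and b: "\<not> bval b' s'" and bd': "bounded_store B s'"
    have "agree (For v b c) s s'" "reg s' v = N"
      using I b b_same by (auto simp: I_def b'_def)
    then show "Q s' \<and> bexp_units b' \<le> \<Phi> s'"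
      using I fin bd' by (auto simp: I_def N_def \<Phi>_def b'_def)
  qed
  have "wp B (For v b c) s (1 + aexp_units (Const 0) + \<Phi> (set_reg v 0 s)) Q"
    unfolding For_def using loop unfolding b'_def c'_def
    by (intro wp_Seq wp_Assign) auto
  then show ?thesis
    by (rule wp_conseq) (simp_all add: \<Phi>_def N_def)
qed

text \<open>Counterpart of \<open>wp\<close> for expectations, with time left out. With an indicator
  for \<open>f\<close> it bounds a probability, and values in \<open>ennreal\<close> avoid
  integrability conditions.\<close>

definition qwp :: "com \<Rightarrow> store \<Rightarrow> (store \<Rightarrow> ennreal) \<Rightarrow> ennreal \<Rightarrow> bool" where
  "qwp c s f p \<longleftrightarrow> (\<exists>D. exec c s D \<and> (\<integral>\<^sup>+z. f (fst z) \<partial>measure_pmf D) \<le> p)"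

lemma nn_integral_charge:
  "(\<integral>\<^sup>+z. f (fst z) \<partial>measure_pmf (charge u D)) = (\<integral>\<^sup>+z. f (fst z) \<partial>measure_pmf D)"
  by (simp add: charge_def case_prod_beta)

lemma qwp_Assign: "f (set_reg x (aval e s) s) \<le> p \<Longrightarrow> qwp (Assign x e) s f p"
  unfolding qwp_def using exec_Assign[of x e s] by fastforce

lemma qwp_Write: "f (set_arr a (aval e1 s) (aval e2 s) s) \<le> p \<Longrightarrow> qwp (Write a e1 e2) s f p"
  unfolding qwp_def using exec_Write[of a e1 e2 s] by fastforce

lemma qwp_Sample:
  assumes "0 < aval e s" and "(\<Sum>v<aval e s. f (set_reg x v s)) / of_nat (aval e s) \<le> p"
  shows "qwp (Sample x e) s f p"
  unfolding qwp_def
proof (intro exI conjI)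
  have "max 1 (aval e s) = aval e s" using assms(1) by simp
  then show "(\<integral>\<^sup>+z. f (fst z) \<partial>measure_pmf
      (map_pmf (\<lambda>v. (set_reg x v s, 1 + acost e s)) (pmf_of_set {0..<max 1 (aval e s)}))) \<le> p"
    using assms by (simp add: nn_integral_pmf_of_set lessThan_atLeast0)
qed (rule exec_Sample)

text \<open>Law of total expectation: \<open>g\<close> bounds the expectation of \<open>f\<close>
  given the intermediate store, and the bound is required only at stores that \<open>c1\<close> can
  reach.\<close>

lemma qwp_Seq:
  assumes "qwp c1 s g p"
    and c2: "\<And>D s' t. exec c1 s D \<Longrightarrow> (s', t) \<in> set_pmf D \<Longrightarrow> qwp c2 s' f (g s')"
  shows "qwp (Seq c1 c2) s f p"
proof -
  obtain D where D: "exec c1 s D" "(\<integral>\<^sup>+z. g (fst z) \<partial>measure_pmf D) \<le> p"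
    using assms(1) by (auto simp: qwp_def)
  have *: "terminates c2 s' \<and> (\<integral>\<^sup>+z. f (fst z) \<partial>measure_pmf (run c2 s')) \<le> g s'"
    if st: "(s', t) \<in> set_pmf D" for s' t
    using c2[OF D(1) st] run_eqI by (fastforce simp: terminates_def qwp_def)
  have "(\<integral>\<^sup>+z. f (fst z) \<partial>measure_pmf (bind_pmf D (\<lambda>(s', t). charge t (run c2 s'))))
      = (\<integral>\<^sup>+y. (\<integral>\<^sup>+z. f (fst z) \<partial>measure_pmf (run c2 (fst y))) \<partial>measure_pmf D)"
    by (simp add: nn_integral_bind_pmf split_beta nn_integral_charge)
  also have "\<dots> \<le> (\<integral>\<^sup>+z. g (fst z) \<partial>measure_pmf D)"
    using * by (intro nn_integral_mono_AE) (auto simp: AE_measure_pmf_iff)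
  also note D(2)
  finally show ?thesis
    unfolding qwp_def using exec_Seq_run[OF D(1), of c2] * by blast
qed

lemma qwp_WhileFalse: "\<not> bval b s \<Longrightarrow> f s \<le> p \<Longrightarrow> qwp (While b c) s f p"
  unfolding qwp_def using exec_WhileFalse[of b s c] by fastforce

lemma qwp_WhileTrue: "bval b s \<Longrightarrow> qwp (Seq c (While b c)) s f p \<Longrightarrow> qwp (While b c) s f p"
  unfolding qwp_def using exec_WhileTrue[of b s c] nn_integral_charge by metis


subsection \<open>Distances\<close>

abbreviation edge_rel :: "'a set set \<Rightarrow> 'a \<Rightarrow> 'a \<Rightarrow> bool" where
  "edge_rel E \<equiv> \<lambda>x y. {x, y} \<in> E"

text \<open>A natural number in place of an \<open>enat\<close>, taken through relational powers,
  where walks are concatenated by \<open>relpowp_add\<close>. It is meaningful only if some walk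
  exists.\<close>

definition walk_dist :: "'a set set \<Rightarrow> 'a \<Rightarrow> 'a \<Rightarrow> nat" where
  "walk_dist E u v = (LEAST k. (edge_rel E ^^ k) u v)"

text \<open>\<open>is_path\<close> allows repeated vertices, so its lists are exactly the walks,
  with one vertex more than there are steps.\<close>

lemma ex_path_iff_relpowp:
  "(\<exists>p. is_path E u p v \<and> length p = Suc k) \<longleftrightarrow> (edge_rel E ^^ k) u v"
proof (induction k arbitrary: u)
  case 0
  show ?case
  proof
    assume "\<exists>p. is_path E u p v \<and> length p = Suc 0"
    then show "(edge_rel E ^^ 0) u v"
      by (auto simp: is_path_def length_Suc_conv)
  next
    assume "(edge_rel E ^^ 0) u v"
    then have "is_path E u [u] v \<and> length [u] = Suc 0"
      by (simp add: is_path_def)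
    then show "\<exists>p. is_path E u p v \<and> length p = Suc 0" ..
  qed
next
  case (Suc k)
  show ?case
  proof
    assume "\<exists>p. is_path E u p v \<and> length p = Suc (Suc k)"
    then obtain p' where p': "is_path E u p' v" "length p' = Suc (Suc k)" by blast
    then obtain p where "p' = u # p" "length p = Suc k"
      by (cases p') (auto simp: is_path_def)
    with p' have "is_path E (hd p) p v \<and> length p = Suc k" "{u, hd p} \<in> E"
      by (auto simp: is_path_def successively_Cons split: if_splits)
    with Suc.IH have "{u, hd p} \<in> E" "(edge_rel E ^^ k) (hd p) v" by blast+
    then show "(edge_rel E ^^ Suc k) u v" by (rule relpowp_Suc_I2)
  next
    assume "(edge_rel E ^^ Suc k) u v"
    then obtain u' where u': "{u, u'} \<in> E" "(edge_rel E ^^ k) u' v"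
      using relpowp_Suc_D2[of k "edge_rel E"] by blast
    then obtain p where "is_path E u' p v" "length p = Suc k"
      using Suc.IH by blast
    with u' have "is_path E u (u # p) v \<and> length (u # p) = Suc (Suc k)"
      by (auto simp: is_path_def successively_Cons)
    then show "\<exists>p. is_path E u p v \<and> length p = Suc (Suc k)" ..
  qed
qed

lemma gdist_eq_walk_dist:
  assumes "(edge_rel E ^^ k) u v"
  shows "gdist E u v = enat (walk_dist E u v)"
  unfolding gdist_def
proof (rule antisym)
  have "(edge_rel E ^^ walk_dist E u v) u v"
    unfolding walk_dist_def using assms by (rule LeastI)
  then obtain p where "is_path E u p v" "length p = Suc (walk_dist E u v)"
    using ex_path_iff_relpowp by metis
  then show "(INF p\<in>{p. is_path E u p v}. enat (length p - 1)) \<le> enat (walk_dist E u v)"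
    by (intro INF_lower2[of p]) auto
next
  show "enat (walk_dist E u v) \<le> (INF p\<in>{p. is_path E u p v}. enat (length p - 1))"
  proof (rule INF_greatest)
    fix p assume "p \<in> {p. is_path E u p v}"
    then have "is_path E u p v \<and> length p = Suc (length p - 1)"
      by (cases p) (auto simp: is_path_def)
    then have "(edge_rel E ^^ (length p - 1)) u v"
      using ex_path_iff_relpowp by metis
    then show "enat (walk_dist E u v) \<le> enat (length p - 1)"
      unfolding walk_dist_def by (simp add: Least_le)
  qed
qed

lemma gdist_unreachable:
  assumes "\<And>k. \<not> (edge_rel E ^^ k) u v"
  shows "gdist E u v = \<infinity>"
proof -
  have "\<not> is_path E u p v" for p
  proof
    assume p: "is_path E u p v"
    then have "length p = Suc (length p - 1)" by (cases p) (auto simp: is_path_def)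
    with p show False using assms ex_path_iff_relpowp[of E u v "length p - 1"] by blast
  qed
  then show ?thesis
    by (simp add: gdist_def top_enat_def)
qed

lemma relpowp_edge_rel_sym: "(edge_rel E ^^ k) u v \<Longrightarrow> (edge_rel E ^^ k) v u"
proof (induction k arbitrary: v)
  case (Suc k)
  then obtain w where "(edge_rel E ^^ k) u w" "{w, v} \<in> E" by auto
  with Suc.IH have "(edge_rel E ^^ k) w u" "{v, w} \<in> E" by (auto simp: insert_commute)
  then show ?case by (rule relpowp_Suc_I2[rotated])
qed auto

lemma relpowp_edge_rel_closed:
  assumes "(edge_rel E ^^ k) u v" and "u \<in> V" and "\<And>x y. {x, y} \<in> E \<Longrightarrow> y \<in> V"
  shows "v \<in> V"
proof (cases k)
  case 0
  then show ?thesis using assms(1,2) by simp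
next
  case (Suc j)
  then obtain w where "{w, v} \<in> E" using assms(1) by auto
  then show ?thesis by (rule assms(3))
qed

lemma walk_dist_le: "(edge_rel E ^^ k) u v \<Longrightarrow> walk_dist E u v \<le> k"
  unfolding walk_dist_def by (rule Least_le)

lemma walk_dist_walk: "(edge_rel E ^^ k) u v \<Longrightarrow> (edge_rel E ^^ walk_dist E u v) u v"
  unfolding walk_dist_def by (rule LeastI)

lemma walk_dist_sym: "walk_dist E u v = walk_dist E v u"
proof -
  have "(edge_rel E ^^ k) u v \<longleftrightarrow> (edge_rel E ^^ k) v u" for k
    by (rule iffI; rule relpowp_edge_rel_sym)
  then show ?thesis by (simp add: walk_dist_def)
qed

lemma walk_dist_self [simp]: "walk_dist E u u = 0"
  using walk_dist_le[of 0 E u u] by simp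

section \<open>Connected graphs: geodesics and the quality of the estimate\<close>

locale connected_graph =
  fixes V :: "'a set" and E :: "'a set set"
  assumes graph: "simple_graph V E"
    and reach: "\<And>u v. u \<in> V \<Longrightarrow> v \<in> V \<Longrightarrow> \<exists>k. (edge_rel E ^^ k) u v"
begin

abbreviation d where "d \<equiv> walk_dist E"

lemma finite_V: "finite V"
  using graph by (simp add: simple_graph_def)

lemma edge_in_V: "{x, y} \<in> E \<Longrightarrow> y \<in> V"
  using graph unfolding simple_graph_def by (metis doubleton_eq_iff)

lemma d_walk: "u \<in> V \<Longrightarrow> v \<in> V \<Longrightarrow> (edge_rel E ^^ d u v) u v"
  unfolding walk_dist_def using LeastI_ex[OF reach] .

lemma d_triangle:
  assumes "u \<in> V" "v \<in> V" "w \<in> V"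
  shows "d u w \<le> d u v + d v w"
proof -
  have "(edge_rel E ^^ (d u v + d v w)) u w"
    unfolding relpowp_add using d_walk[OF assms(1,2)] d_walk[OF assms(2,3)] by blast
  then show ?thesis by (rule walk_dist_le)
qed

text \<open>The two parts of a shortest walk, cut after \<open>j\<close> steps, are walks of lengths
  \<open>j\<close> and \<open>d u v - j\<close>, which bounds both distances from above; the
  triangle inequality then forces equality.\<close>

lemma geodesic:
  assumes uv: "u \<in> V" "v \<in> V"
  obtains f where "f 0 = u" "f (d u v) = v"
    "\<And>j. j \<le> d u v \<Longrightarrow> f j \<in> V \<and> d u (f j) = j \<and> d (f j) v = d u v - j"
    "\<And>j. j < d u v \<Longrightarrow> d (f j) (f (Suc j)) \<le> 1"
proof -
  obtain f where f: "f 0 = u" "f (d u v) = v" "\<And>i. i < d u v \<Longrightarrow> {f i, f (Suc i)} \<in> E"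
    using d_walk[OF uv] by (auto simp: relpowp_fun_conv)
  have seg: "(edge_rel E ^^ j) (f i) (f (i + j))" if "i + j \<le> d u v" for i j
    unfolding relpowp_fun_conv using that f(3)
    by (intro exI[of _ "\<lambda>k. f (i + k)"]) auto
  have "f j \<in> V \<and> d u (f j) = j \<and> d (f j) v = d u v - j" if j: "j \<le> d u v" for j
  proof -
    have V: "f j \<in> V"
      using relpowp_edge_rel_closed[OF seg[of 0 j]] j f(1) uv edge_in_V by auto
    have "d u (f j) \<le> j" "d (f j) v \<le> d u v - j"
      using seg[of 0 j] seg[of j "d u v - j"] j f(1,2) by (auto intro: walk_dist_le)
    moreover have "d u v \<le> d u (f j) + d (f j) v"
      using d_triangle uv V by blast
    ultimately show ?thesis using V j by auto
  qed
  moreover have "d (f j) (f (Suc j)) \<le> 1" if "j < d u v" for j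
    using walk_dist_le[OF seg[of j 1]] that by simp
  ultimately show ?thesis using that f(1,2) by blast
qed

text \<open>The vertices on a geodesic have pairwise different distances from \<open>u\<close>, so
  there are \<open>d u v + 1\<close> of them.\<close>

lemma d_less_card:
  assumes "u \<in> V" "v \<in> V"
  shows "d u v < card V"
proof -
  obtain f where f: "\<And>j. j \<le> d u v \<Longrightarrow> f j \<in> V \<and> d u (f j) = j"
    by (rule geodesic[OF assms]) (rule that, blast)
  have "inj_on f {..d u v}"
    using f by (intro inj_on_inverseI[where g = "d u"]) simp
  then have "card {..d u v} \<le> card V"
    using f finite_V by (intro card_inj_on_le) auto
  then show ?thesis by simp
qed

lemma gdist_eq: "u \<in> V \<Longrightarrow> v \<in> V \<Longrightarrow> gdist E u v = enat (d u v)"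
  by (rule gdist_eq_walk_dist[OF d_walk])

text \<open>
  The distance used for sampling counts double towards \<open>T\<close>: a vertex of \<open>T\<close> at distance \<open>b\<close>
  is only useful through its nearest vertex of \<open>S\<close>, which may be at distance \<open>2 b\<close>.
\<close>

definition weighted_dist :: "'a set \<Rightarrow> 'a \<Rightarrow> 'a \<Rightarrow> nat" where
  "weighted_dist S v x = (if x \<in> S then d v x else 2 * d v x)"

text \<open>
  Here \<open>q\<close> is the quality to be reached, \<open>a = D - q\<close> and \<open>b = a div 2\<close>. If the estimate \<open>r\<close>
  were below \<open>q\<close>, no sampled vertex would be within weighted distance \<open>a\<close> of \<open>s\<close>,
  so \<open>X\<close> would contain the weighted ball of radius \<open>a\<close> around \<open>w\<close>. A shortest path
  from \<open>w\<close> to \<open>t\<close> has length below \<open>q\<close> and, between distance \<open>b\<close> and \<open>a\<close> from \<open>w\<close>, it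
  either meets \<open>T\<close> at distance \<open>b\<close>, or stays in \<open>S\<close>, or crosses from \<open>S\<close> to \<open>T\<close>.
\<close>

lemma estimate_ge:
  assumes SV: "S \<subseteq> V" and XV: "X \<subseteq> V" and RX: "R \<subseteq> X"
    and ecc: "\<And>x v. x \<in> X \<Longrightarrow> v \<in> V \<Longrightarrow> (v \<in> S) \<noteq> (x \<in> S) \<Longrightarrow> d x v \<le> r"
    and near: "\<And>x. x \<in> X \<Longrightarrow> \<exists>y\<in>V. (y \<in> S) \<noteq> (x \<in> S) \<and>
        (\<forall>v\<in>V. (v \<in> S) \<noteq> (x \<in> S) \<longrightarrow> d x y \<le> d x v) \<and>
        (\<forall>v\<in>V. (v \<in> S) \<noteq> (y \<in> S) \<longrightarrow> d y v \<le> r)"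
    and w: "w \<in> S" "\<And>v. v \<in> S \<Longrightarrow> key v \<le> key w"
    and key: "\<And>v c. v \<in> V \<Longrightarrow> c \<le> N \<Longrightarrow> (\<And>x. x \<in> R \<Longrightarrow> c \<le> weighted_dist S v x) \<Longrightarrow> c \<le> key v"
    and cand: "\<And>u. u \<in> V \<Longrightarrow> weighted_dist S w u < key w \<Longrightarrow> u \<in> X"
    and s: "s \<in> S" and t: "t \<in> V - S"
    and arith: "a + q = d s t" "2 * b \<le> a" "a \<le> 2 * b + 1" "2 * q \<le> d s t + b"
      "3 * q \<le> d s t + 2 + 2 * a" "a < N"
  shows "q \<le> r"
proof (rule ccontr)
  assume "\<not> q \<le> r"
  then have r: "r < q" by simp
  have sV: "s \<in> V" and tV: "t \<in> V" and wV: "w \<in> V" and tS: "t \<notin> S"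
    using s t w SV by auto
  \<comment> \<open>A sampled vertex too close to s would make the estimate reach q. In
    \<open>S\<close> it is itself far from t. In \<open>T\<close>, its nearest vertex y of
    \<open>S\<close> is at most as far from it as s is, so the detour from s to y costs at most
    twice the distance, and y is far from t.\<close>
  have far: "Suc a \<le> weighted_dist S s x" if "x \<in> R" for x
  proof (cases "x \<in> S")
    case True
    have "x \<in> X" "x \<in> V" using that RX XV by auto
    then have "d x t \<le> r" using ecc True tV tS by blast
    moreover have "d s t \<le> d s x + d x t" using d_triangle sV tV \<open>x \<in> V\<close> by blast
    ultimately show ?thesis using arith(1) r True by (simp add: weighted_dist_def)
  next
    case False
    have x: "x \<in> X" "x \<in> V" using that RX XV by auto
    then obtain y where y: "y \<in> V" "y \<in> S" "d x y \<le> d x s"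
      "\<And>v. v \<in> V \<Longrightarrow> v \<notin> S \<Longrightarrow> d y v \<le> r"
      using near[OF x(1)] False s sV by blast
    have "d s t \<le> d s y + d y t" "d s y \<le> d s x + d x y" "d y t \<le> r"
      using d_triangle sV tV y x tS by blast+
    then show ?thesis
      using arith(1) r False y(3) walk_dist_sym[of E x s] by (simp add: weighted_dist_def)
  qed
  have "Suc a \<le> key s" using key[OF sV] far arith(6) by simp
  then have kw: "a < key w" using w(2)[OF s] by simp
  have ballS: "u \<in> X" if "u \<in> V" "u \<in> S" "d w u \<le> a" for u
    using cand[OF that(1)] that kw by (simp add: weighted_dist_def)
  have ballT: "u \<in> X" if "u \<in> V" "u \<notin> S" "d w u \<le> b" for u
    using cand[OF that(1)] that kw arith(2) by (simp add: weighted_dist_def)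
  have len: "d w t \<le> r" using ecc[OF ballS[OF wV w(1)] tV] w(1) tS by simp
  obtain f where fl: "f (d w t) = t"
    and f: "\<And>j. j \<le> d w t \<Longrightarrow> f j \<in> V \<and> d w (f j) = j \<and> d (f j) t = d w t - j"
    and f1: "\<And>j. j < d w t \<Longrightarrow> d (f j) (f (Suc j)) \<le> 1"
    by (rule geodesic[OF wV tV]) (rule that)
  \<comment> \<open>The estimate bounds d(z, s), and d(z, t) is at most r - b, so the distance of s
    and t would be at most 2r - b, against 2q \<le> D + b. The alternative z = t gives D \<le> r
    directly.\<close>
  have in_T: False if "z \<in> V" "z \<notin> S" "d w z \<le> b" "d z t + b \<le> d w t \<or> z = t" for z
  proof -
    have "d z s \<le> r" using ecc[OF ballT[OF that(1-3)] sV] that(2) s by simp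
    moreover have "d s t \<le> d s z + d z t" using d_triangle sV tV that(1) by blast
    ultimately show False using that(4) arith r len walk_dist_sym[of E z s] by auto
  qed
  \<comment> \<open>Here z has the same colour as s and says nothing about s itself; the vertex y of
    \<open>T\<close> nearest to z does. Any v in \<open>T\<close> bounds d(z, y), so a v close to z
    suffices.\<close>
  have in_S: False if z: "z \<in> V" "z \<in> S" "d w z \<le> a" and v: "v \<in> V" "v \<notin> S"
    and h: "d z v + d z t + r < d s t" for z v
  proof -
    obtain y where y: "y \<in> V" "y \<notin> S" "d z y \<le> d z v" "d y s \<le> r"
      using near[OF ballS[OF z]] z(2) v s sV by blast
    have "d s t \<le> d s y + d y t" "d y t \<le> d y z + d z t"
      using d_triangle sV tV y(1) z(1) by blast+
    then show False using y(3,4) h r walk_dist_sym[of E y s] walk_dist_sym[of E y z] by linarith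
  qed
  consider "d w t < b" | "b \<le> d w t" "f b \<notin> S" | "b \<le> d w t" "f b \<in> S" "a \<le> d w t" "f a \<in> S"
    | "b \<le> d w t" "f b \<in> S" "a \<le> d w t \<longrightarrow> f a \<notin> S" by linarith
  then show False
  proof cases
    case 1
    then show ?thesis using in_T[of t] tV tS by simp
  next
    case 2
    then show ?thesis using in_T[of "f b"] f[of b] by auto
  next
    case 3
    \<comment> \<open>The witness v is t itself. Both summands are at most r - a, so the total is at
      most 3r - 2a; the slack 2 in the bound on 3q is affordable because r \<le> q - 1.\<close>
    then have "d (f a) t + d (f a) t + r < d s t" using f[of a] arith len r by linarith
    then show ?thesis using in_S[of "f a" t] 3 f[of a] tV tS by simp
  next
    case 4
    \<comment> \<open>The path may end before distance a, but then it ends at t, which is in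
      \<open>T\<close>. In either case vertex e is in \<open>T\<close> while vertex b is in
      \<open>S\<close>, so the colour changes on some edge between them. Its endpoint in
      \<open>T\<close> is at distance at most 1 from its endpoint in \<open>S\<close>.\<close>
    define e where "e = min a (d w t)"
    have e: "e \<le> a" "e \<le> d w t" "f e \<notin> S" "b \<le> e"
      using 4 fl tS arith(2) unfolding e_def min_def by auto
    have "\<exists>j. b \<le> j \<and> j < e \<and> f j \<in> S \<and> f (Suc j) \<notin> S"
    proof (rule ccontr)
      assume "\<not> ?thesis"
      then have "b + i \<le> e \<longrightarrow> f (b + i) \<in> S" for i
        by (induction i) (use 4 in auto)
      then show False using e by (metis le_add_diff_inverse order_refl)
    qed
    then obtain j where j: "b \<le> j" "j < e" "f j \<in> S" "f (Suc j) \<notin> S" by blast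
    have "j < d w t" "j \<le> a" "Suc j \<le> d w t" using j e by auto
    then have "d (f j) (f (Suc j)) + d (f j) t + r < d s t"
      using f[of j] f1[of j] j(1) arith len r by linarith
    then show ?thesis
      using in_S[of "f j" "f (Suc j)"] f[of j] f[of "Suc j"] j \<open>j \<le> a\<close> \<open>Suc j \<le> d w t\<close> by simp
  qed
qed

text \<open>\<open>upper\<close> is phrased through arbitrary bounds on the bichromatic distances, a
  form that already holds for the initial estimate 0. \<open>lower\<close> offers every integer
  choice allowed by the distance argument, so that all rounding takes place here.\<close>

lemma good_estimateI:
  assumes SV: "S \<subseteq> V" and S: "S \<noteq> {}" and T: "V - S \<noteq> {}"
    and upper: "\<And>D. (\<And>u v. u \<in> S \<Longrightarrow> v \<in> V - S \<Longrightarrow> d u v \<le> D) \<Longrightarrow> r \<le> D"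
    and lower: "\<And>s t q a b. s \<in> S \<Longrightarrow> t \<in> V - S \<Longrightarrow> a + q = d s t \<Longrightarrow> 2 * b \<le> a \<Longrightarrow>
      a \<le> 2 * b + 1 \<Longrightarrow> 2 * q \<le> d s t + b \<Longrightarrow> 3 * q \<le> d s t + 2 + 2 * a \<Longrightarrow> q \<le> r"
  shows "good_estimate (ST_diameter E S (V - S)) (enat r)"
proof -
  have fin: "finite S" "finite (V - S)" using SV finite_V finite_subset by auto
  define D where "D = ST_diameter E S (V - S)"
  have "D \<in> (\<lambda>s. MAX t\<in>V - S. gdist E s t) ` S"
    unfolding D_def ST_diameter_def using fin S by (intro Max_in) auto
  then obtain s where s: "s \<in> S" "D = (MAX t\<in>V - S. gdist E s t)" by blast
  have "D \<in> (\<lambda>t. gdist E s t) ` (V - S)"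
    unfolding s(2) using fin T by (intro Max_in) auto
  then obtain t where t: "t \<in> V - S" "D = gdist E s t" by blast
  then have D: "D = enat (d s t)" using gdist_eq s(1) SV by auto
  have "d u v \<le> d s t" if uv: "u \<in> S" "v \<in> V - S" for u v
  proof -
    have "gdist E u v \<le> (MAX t\<in>V - S. gdist E u t)" using fin uv by (intro Max_ge) auto
    also have "\<dots> \<le> D" unfolding D_def ST_diameter_def using fin uv by (intro Max_ge) auto
    finally show ?thesis using gdist_eq uv SV D by auto
  qed
  then have le: "r \<le> d s t" by (rule upper)
  define k where "k = d s t div 5"
  \<comment> \<open>For remainders 0 to 4 of D modulo 5, the loss 3D - 5q is 0, 3, 6, 4, 2: nothing
    is lost if 5 divides D, and remainder 2 uses up the allowance of 6/5. Truncated subtraction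
    makes q equal to 3k for remainders up to 2.\<close>
  define q where "q = 3 * k + (d s t mod 5 - 2)"
  have ds: "d s t = 5 * k + d s t mod 5" by (simp add: k_def)
  have "d s t mod 5 < 5" by simp
  then consider "d s t mod 5 = 0" | "d s t mod 5 = 1" | "d s t mod 5 = 2" | "d s t mod 5 = 3"
    | "d s t mod 5 = 4" by linarith
  then have q: "q \<le> r \<and> (d s t mod 5 = 0 \<longrightarrow> 3 * d s t \<le> 5 * q) \<and> 3 * d s t \<le> 5 * q + 6"
  proof cases
    case 1
    then show ?thesis using lower[OF s(1) t(1), of "2 * k" q k] ds by (simp add: q_def)
  next
    case 2
    then show ?thesis using lower[OF s(1) t(1), of "2 * k + 1" q k] ds by (simp add: q_def)
  next
    case 3
    then show ?thesis using lower[OF s(1) t(1), of "2 * k + 2" q "k + 1"] ds by (simp add: q_def)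
  next
    case 4
    then show ?thesis using lower[OF s(1) t(1), of "2 * k + 2" q "k + 1"] ds by (simp add: q_def)
  next
    case 5
    then show ?thesis using lower[OF s(1) t(1), of "2 * k + 2" q "k + 1"] ds by (simp add: q_def)
  qed
  then have q: "d s t mod 5 = 0 \<Longrightarrow> 3 * d s t \<le> 5 * r" "3 * d s t \<le> 5 * r + 6"
    by auto
  \<comment> \<open>Divisibility is meant in \<open>enat\<close>, where the cofactor could be
    infinite; a finite product excludes this.\<close>
  have dvd: "5 dvd enat (d s t) \<longleftrightarrow> d s t mod 5 = 0"
  proof
    assume "5 dvd enat (d s t)"
    then obtain c where c: "enat (d s t) = 5 * c" by (auto simp: dvd_def)
    then obtain c' where "c = enat c'" by (cases c) (auto simp: numeral_eq_enat)
    with c show "d s t mod 5 = 0" by (simp add: numeral_eq_enat)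
  next
    assume "d s t mod 5 = 0"
    then have "enat (d s t) = 5 * enat k" using ds by (simp add: numeral_eq_enat)
    then show "5 dvd enat (d s t)" by (rule dvdI)
  qed
  have "3 / 5 * real (d s t) \<le> real r" if "d s t mod 5 = 0"
  proof -
    have "real (3 * d s t) \<le> real (5 * r)" using q that by (simp only: of_nat_le_iff)
    then show ?thesis by simp
  qed
  moreover have "3 / 5 * real (d s t) - 6 / 5 \<le> real r"
  proof -
    have "real (3 * d s t) \<le> real (5 * r + 6)" using q by (simp only: of_nat_le_iff)
    then show ?thesis by simp
  qed
  ultimately show ?thesis
    using le unfolding D_def[symmetric] D good_estimate_def dvd by simp
qed

end


subsection \<open>Straight-line code\<close>

text \<open>Deterministic loop-free code can be run by the simplifier: \<open>step\<close> is its
  effect, \<open>safe\<close> the obligation that stored values are at most \<open>B\<close>, and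
  \<open>units\<close> its cost. The values at \<open>Sample\<close> and \<open>While\<close> are
  mere placeholders, since \<open>straight\<close> excludes both.\<close>

primrec straight :: "com \<Rightarrow> bool" where
  "straight Skip = True"
| "straight (Assign x e) = True"
| "straight (Write a e1 e2) = True"
| "straight (Sample x e) = False"
| "straight (Seq c1 c2) = (straight c1 \<and> straight c2)"
| "straight (Cond b c1 c2) = (straight c1 \<and> straight c2)"
| "straight (While b c) = False"

primrec step :: "com \<Rightarrow> store \<Rightarrow> store" where
  "step Skip s = s"
| "step (Assign x e) s = set_reg x (aval e s) s"
| "step (Write a e1 e2) s = set_arr a (aval e1 s) (aval e2 s) s"
| "step (Sample x e) s = s"
| "step (Seq c1 c2) s = step c2 (step c1 s)"
| "step (Cond b c1 c2) s = (if bval b s then step c1 s else step c2 s)"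
| "step (While b c) s = s"

primrec safe :: "nat \<Rightarrow> com \<Rightarrow> store \<Rightarrow> bool" where
  "safe B Skip s = True"
| "safe B (Assign x e) s = (aval e s \<le> B)"
| "safe B (Write a e1 e2) s = (aval e2 s \<le> B)"
| "safe B (Sample x e) s = True"
| "safe B (Seq c1 c2) s = (safe B c1 s \<and> safe B c2 (step c1 s))"
| "safe B (Cond b c1 c2) s = (if bval b s then safe B c1 s else safe B c2 s)"
| "safe B (While b c) s = True"

primrec units :: "com \<Rightarrow> nat" where
  "units Skip = 1"
| "units (Assign x e) = 1 + aexp_units e"
| "units (Write a e1 e2) = 1 + aexp_units e1 + aexp_units e2"
| "units (Sample x e) = 0"
| "units (Seq c1 c2) = units c1 + units c2"
| "units (Cond b c1 c2) = bexp_units b + max (units c1) (units c2)"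
| "units (While b c) = 0"

lemma wp_straight_aux:
  "straight c \<Longrightarrow> safe B c s \<Longrightarrow> Q (step c s) \<Longrightarrow> wp B c s (units c) Q"
proof (induction c arbitrary: s Q)
  case (Cond b c1 c2)
  then show ?case
    using wp_Cond[of b s B c1 "units c1" Q c2 "units c2"] by (simp split: if_splits)
qed (auto intro: wp_Skip[simplified] wp_Assign[simplified] wp_Write[simplified] wp_Seq)

lemma wp_straight:
  assumes "straight c" and "bounded_store B s \<Longrightarrow> safe B c s \<and> Q (step c s)" and "units c \<le> C"
  shows "wp B c s C Q"
  using assms wp_straight_aux[of c B s Q] by (blast intro: wp_bounded wp_conseq)

lemma bounded_storeD: "bounded_store B s \<Longrightarrow> reg s x \<le> B" "bounded_store B s \<Longrightarrow> arr s a i \<le> B"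
  by (auto simp: bounded_store_def)


subsection \<open>Breadth-first search\<close>

text \<open>Linked lists of neighbours; cell \<open>0\<close> ends a list and \<open>b\<close> bounds the cells in use.\<close>

primrec chain :: "nat \<Rightarrow> (nat \<Rightarrow> nat) \<Rightarrow> (nat \<Rightarrow> nat) \<Rightarrow> nat \<Rightarrow> nat list \<Rightarrow> bool" where
  "chain b nx to e [] = (e = 0)"
| "chain b nx to e (v # vs) = (0 < e \<and> e \<le> b \<and> to e = v \<and> chain b nx to (nx e) vs)"

text \<open>A list only visits cells up to \<open>b\<close>, so it survives writes to fresh cells
  beyond \<open>b\<close>.\<close>

lemma chain_cong:
  "chain b nx to e vs \<Longrightarrow> b \<le> b' \<Longrightarrow> (\<And>i. i \<le> b \<Longrightarrow> nx' i = nx i \<and> to' i = to i) \<Longrightarrow>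
   chain b' nx' to' e vs"
  by (induction vs arbitrary: e) auto

text \<open>\<open>L\<close> is the queue including the \<open>h\<close> finished vertices; \<open>P\<close> are the neighbours of \<open>L ! h\<close> scanned so far.\<close>

definition bfs_inv ::
  "nat set set \<Rightarrow> nat \<Rightarrow> nat \<Rightarrow> (nat \<Rightarrow> nat) \<Rightarrow> nat list \<Rightarrow> nat \<Rightarrow> nat set \<Rightarrow> bool" where
  "bfs_inv E n r \<delta> L h P \<longleftrightarrow>
     distinct L \<and> set L \<subseteq> {..<n} \<and> r \<in> set L \<and> h \<le> length L \<and> \<delta> r = 1 \<and>
     (\<forall>v<n. v \<notin> set L \<longrightarrow> \<delta> v = 0) \<and>
     (\<forall>v\<in>set L. 0 < \<delta> v \<and> (edge_rel E ^^ (\<delta> v - 1)) r v) \<and>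
     (\<forall>i<length L. \<delta> (L ! i) \<le> i + 1) \<and>
     (\<forall>i<h. \<forall>v. {L ! i, v} \<in> E \<longrightarrow> v \<in> set L \<and> \<delta> v \<le> \<delta> (L ! i) + 1) \<and>
     sorted (map \<delta> L) \<and>
     (h < length L \<longrightarrow> (\<forall>v\<in>set L. \<delta> v \<le> \<delta> (L ! h) + 1) \<and> P \<subseteq> set L)"

lemma bfs_inv_init:
  assumes "r < n" and "\<delta> r = 1" and "\<And>v. v < n \<Longrightarrow> v \<noteq> r \<Longrightarrow> \<delta> v = 0"
  shows "bfs_inv E n r \<delta> [r] 0 {}"
  using assms by (auto simp: bfs_inv_def)

lemma bfs_inv_seen:
  assumes "bfs_inv E n r \<delta> L h P" and "0 < \<delta> v" and "v < n"
  shows "bfs_inv E n r \<delta> L h (insert v P)"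
proof -
  have "v \<in> set L" using assms unfolding bfs_inv_def by (metis less_numeral_extra(3))
  then show ?thesis using assms(1) unfolding bfs_inv_def by (simp only: insert_subset) blast
qed

text \<open>No label in the queue exceeds the label of its head by more than one. The new label is
  therefore maximal, and appending the vertex keeps the labels sorted.\<close>

lemma bfs_inv_new:
  assumes inv: "bfs_inv E n r \<delta> L h P" and h: "h < length L"
    and v: "\<delta> v = 0" "v < n" "{L ! h, v} \<in> E"
  shows "bfs_inv E n r (\<delta>(v := \<delta> (L ! h) + 1)) (L @ [v]) h (insert v P)"
proof -
  have pos: "\<forall>v\<in>set L. 0 < \<delta> v"
    using inv by (auto simp: bfs_inv_def)
  have vL: "v \<notin> set L" using pos v(1) by auto
  have nth: "L ! i \<noteq> v" if "i < length L" for i using that vL nth_mem by blast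
  have hL: "L ! h \<in> set L" using h by simp
  have "(edge_rel E ^^ Suc (\<delta> (L ! h) - 1)) r v"
    using inv hL v(3) unfolding bfs_inv_def by (intro relpowp_Suc_I) auto
  moreover have "Suc (\<delta> (L ! h) - 1) = \<delta> (L ! h)" using pos hL by force
  ultimately have walk: "(edge_rel E ^^ \<delta> (L ! h)) r v" by simp
  have map: "map (\<delta>(v := \<delta> (L ! h) + 1)) L = map \<delta> L" using vL by auto
  have ih: "\<delta> (L ! h) \<le> h + 1" "\<forall>u\<in>set L. \<delta> u \<le> \<delta> (L ! h) + 1" "sorted (map \<delta> L)"
    using inv h unfolding bfs_inv_def by blast+
  show ?thesis
    unfolding bfs_inv_def
  proof (intro conjI)
    show "\<forall>u\<in>set (L @ [v]). 0 < (\<delta>(v := \<delta> (L ! h) + 1)) u \<and>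
        (edge_rel E ^^ ((\<delta>(v := \<delta> (L ! h) + 1)) u - 1)) r u"
      using inv walk vL unfolding bfs_inv_def by (simp del: relpowp.simps)
    show "\<forall>i<length (L @ [v]). (\<delta>(v := \<delta> (L ! h) + 1)) ((L @ [v]) ! i) \<le> i + 1"
      using inv ih(1) h nth unfolding bfs_inv_def by (auto simp: nth_append less_Suc_eq)
    show "\<forall>i<h. \<forall>u. {(L @ [v]) ! i, u} \<in> E \<longrightarrow> u \<in> set (L @ [v]) \<and>
        (\<delta>(v := \<delta> (L ! h) + 1)) u \<le> (\<delta>(v := \<delta> (L ! h) + 1)) ((L @ [v]) ! i) + 1"
    proof (intro allI impI)
      fix i u assume i: "i < h" "{(L @ [v]) ! i, u} \<in> E"
      then have "{L ! i, u} \<in> E" using h by (simp add: nth_append)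
      then have "u \<in> set L" "\<delta> u \<le> \<delta> (L ! i) + 1"
        using inv i(1) unfolding bfs_inv_def by blast+
      then show "u \<in> set (L @ [v]) \<and>
        (\<delta>(v := \<delta> (L ! h) + 1)) u \<le> (\<delta>(v := \<delta> (L ! h) + 1)) ((L @ [v]) ! i) + 1"
        using i(1) h nth[of i] vL by (auto simp: nth_append)
    qed
    show "sorted (map (\<delta>(v := \<delta> (L ! h) + 1)) (L @ [v]))"
      using ih vL map by (auto simp: sorted_append)
    show "h < length (L @ [v]) \<longrightarrow> (\<forall>u\<in>set (L @ [v]). (\<delta>(v := \<delta> (L ! h) + 1)) u
        \<le> (\<delta>(v := \<delta> (L ! h) + 1)) ((L @ [v]) ! h) + 1) \<and> insert v P \<subseteq> set (L @ [v])"
      using inv h nth[of h] ih(2) vL unfolding bfs_inv_def by (auto simp: nth_append)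
    show "(\<delta>(v := \<delta> (L ! h) + 1)) r = 1"
      using inv vL unfolding bfs_inv_def by auto
    show "\<forall>u<n. u \<notin> set (L @ [v]) \<longrightarrow> (\<delta>(v := \<delta> (L ! h) + 1)) u = 0"
      using inv unfolding bfs_inv_def by (simp del: relpowp.simps)
  qed (use inv vL v(2) in \<open>auto simp: bfs_inv_def\<close>)
qed

text \<open>By sortedness the next head has at least the label of the finished one, so all labels
  are still at most one larger than that of the head.\<close>

lemma bfs_inv_next:
  assumes inv: "bfs_inv E n r \<delta> L h P" and h: "h < length L"
    and P: "\<And>v. {L ! h, v} \<in> E \<Longrightarrow> v \<in> P"
  shows "bfs_inv E n r \<delta> L (Suc h) {}"
proof -
  have max: "\<forall>v\<in>set L. \<delta> v \<le> \<delta> (L ! h) + 1" "P \<subseteq> set L" and sorted: "sorted (map \<delta> L)"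
    using inv h unfolding bfs_inv_def by blast+
  have "\<forall>i<Suc h. \<forall>v. {L ! i, v} \<in> E \<longrightarrow> v \<in> set L \<and> \<delta> v \<le> \<delta> (L ! i) + 1"
  proof (intro allI impI)
    fix i v assume "i < Suc h" "{L ! i, v} \<in> E"
    then show "v \<in> set L \<and> \<delta> v \<le> \<delta> (L ! i) + 1"
      using inv max P unfolding bfs_inv_def by (cases "i = h") (blast, metis less_SucE)
  qed
  moreover have "\<forall>v\<in>set L. \<delta> v \<le> \<delta> (L ! Suc h) + 1" if "Suc h < length L"
  proof -
    have "\<delta> (L ! h) \<le> \<delta> (L ! Suc h)"
      using sorted_nth_mono[OF sorted, of h "Suc h"] that by simp
    then show ?thesis using max(1) by fastforce
  qed
  ultimately show ?thesis
    using inv h unfolding bfs_inv_def by (simp only: empty_subsetI Suc_le_eq simp_thms) blast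
qed

text \<open>When every queued vertex is finished, the visited set is closed under edges and labels
  grow by at most one along an edge, so no walk beats a label. Conversely, every label is realised
  by a walk.\<close>

lemma bfs_inv_final:
  assumes inv: "bfs_inv E n r \<delta> L (length L) P" and V: "\<And>x y. {x, y} \<in> E \<Longrightarrow> y < n"
  shows "v \<in> set L \<longleftrightarrow> (\<exists>k. (edge_rel E ^^ k) r v)"
    and "v \<in> set L \<Longrightarrow> \<delta> v = Suc (walk_dist E r v)"
proof -
  have closed: "v \<in> set L \<and> \<delta> v \<le> \<delta> u + 1" if "u \<in> set L" "{u, v} \<in> E" for u v
    using inv that unfolding bfs_inv_def by (metis in_set_conv_nth)
  have reach: "v \<in> set L \<and> \<delta> v \<le> Suc k" if "(edge_rel E ^^ k) r v" for k v
    using that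
  proof (induction k arbitrary: v)
    case 0
    then show ?case using inv by (simp add: bfs_inv_def)
  next
    case (Suc k)
    then obtain w where "(edge_rel E ^^ k) r w" "{w, v} \<in> E" by auto
    with Suc.IH closed show ?case by fastforce
  qed
  have walk: "0 < \<delta> v \<and> (edge_rel E ^^ (\<delta> v - 1)) r v" if "v \<in> set L" for v
    using inv that by (simp only: bfs_inv_def)
  show "v \<in> set L \<longleftrightarrow> (\<exists>k. (edge_rel E ^^ k) r v)"
  proof
    assume "v \<in> set L"
    then show "\<exists>k. (edge_rel E ^^ k) r v" using walk by (intro exI) (rule conjunct2)
  next
    assume "\<exists>k. (edge_rel E ^^ k) r v"
    then show "v \<in> set L" using reach by (elim exE) simp
  qed
  assume v: "v \<in> set L"
  have "(edge_rel E ^^ walk_dist E r v) r v"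
    by (rule walk_dist_walk[OF conjunct2[OF walk[OF v]]])
  then have "\<delta> v \<le> Suc (walk_dist E r v)" by (rule conjunct2[OF reach])
  moreover have "walk_dist E r v \<le> \<delta> v - 1" by (rule walk_dist_le[OF conjunct2[OF walk[OF v]]])
  ultimately show "\<delta> v = Suc (walk_dist E r v)" using conjunct1[OF walk[OF v]] by linarith
qed

text \<open>\<open>dist\<close> holds the distance plus one, so that 0 can mark undiscovered
  vertices. All code that reads distances compensates for this shift.\<close>

definition scan_body :: com where
  "scan_body =
     Seq (Assign ''v'' (Read ''to'' (Var ''e'')))
    (Seq (Cond (Less (Const 0) (Read ''dist'' (Var ''v''))) Skip
       (Seq (Write ''dist'' (Var ''v'') (Plus (Read ''dist'' (Var ''u'')) (Const 1)))
       (Seq (Write ''queue'' (Var ''t'') (Var ''v''))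
            (Assign ''t'' (Plus (Var ''t'') (Const 1))))))
         (Assign ''e'' (Read ''nx'' (Var ''e''))))"

definition bfs_body :: com where
  "bfs_body =
     Seq (Assign ''u'' (Read ''queue'' (Var ''h'')))
    (Seq (Assign ''e'' (Read ''hd'' (Var ''u'')))
    (Seq (While (Less (Const 0) (Var ''e'')) scan_body)
         (Assign ''h'' (Plus (Var ''h'') (Const 1)))))"

definition bfs :: com where
  "bfs =
     Seq (For ''v'' ''n'' (Write ''dist'' (Var ''v'') (Const 0)))
    (Seq (Seq (Write ''dist'' (Var ''x'') (Const 1))
         (Seq (Write ''queue'' (Const 0) (Var ''x''))
         (Seq (Assign ''h'' (Const 0)) (Assign ''t'' (Const 1)))))
         (While (Less (Var ''h'') (Var ''t'')) bfs_body))"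

lemma mod_scan_body [simp]:
  "mod_regs scan_body = {''v'', ''t'', ''e''}" "mod_arrs scan_body = {''dist'', ''queue''}"
  by (auto simp: scan_body_def)

lemma mod_bfs_body [simp]:
  "mod_regs bfs_body = {''u'', ''h'', ''v'', ''t'', ''e''}" "mod_arrs bfs_body = {''dist'', ''queue''}"
  by (auto simp: bfs_body_def)

lemma mod_bfs [simp]:
  "mod_regs bfs = {''u'', ''h'', ''v'', ''t'', ''e''}" "mod_arrs bfs = {''dist'', ''queue''}"
  by (auto simp: bfs_def)

definition bfs_store :: "nat set set \<Rightarrow> nat \<Rightarrow> nat \<Rightarrow> nat list \<Rightarrow> nat set \<Rightarrow> store \<Rightarrow> bool" where
  "bfs_store E n r L P s \<longleftrightarrow> bfs_inv E n r (arr s ''dist'') L (reg s ''h'') P \<and>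
     reg s ''t'' = length L \<and> (\<forall>i<length L. arr s ''queue'' i = L ! i)"

lemma bfs_inv_length:
  assumes "bfs_inv E n r \<delta> L h P"
  shows "length L \<le> n"
proof -
  have "card (set L) \<le> card {..<n}" using assms unfolding bfs_inv_def by (intro card_mono) auto
  then show ?thesis using assms by (simp add: bfs_inv_def distinct_card)
qed

lemma scan_body_step:
  assumes "bfs_store E n r L P s" and "reg s ''h'' < length L" and "reg s ''u'' = L ! reg s ''h''"
    and "arr s ''to'' (reg s ''e'') = v" "v < n" "{L ! reg s ''h'', v} \<in> E"
    and "n \<le> B" and bd: "bounded_store B s"
  shows "safe B scan_body s" "\<exists>L'. bfs_store E n r (L @ L') (insert v P) (step scan_body s)"
    "reg (step scan_body s) ''e'' = arr s ''nx'' (reg s ''e'')"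
proof -
  have inv: "bfs_inv E n r (arr s ''dist'') L (reg s ''h'') P" and t: "reg s ''t'' = length L"
    and Q: "\<forall>i<length L. arr s ''queue'' i = L ! i"
    using assms(1) by (auto simp: bfs_store_def)
  show "reg (step scan_body s) ''e'' = arr s ''nx'' (reg s ''e'')"
    by (simp add: scan_body_def)
  have "safe B scan_body s \<and> (\<exists>L'. bfs_store E n r (L @ L') (insert v P) (step scan_body s))"
  proof (cases "0 < arr s ''dist'' v")
    case True
    then have "bfs_store E n r (L @ []) (insert v P) (step scan_body s)"
      using bfs_inv_seen[OF inv True assms(5)] t Q assms(4)
      by (simp add: bfs_store_def scan_body_def)
    moreover have "safe B scan_body s"
      using True assms(4,5,7) bounded_storeD[OF bd] by (simp add: scan_body_def)
    ultimately show ?thesis by blast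
  next
    case False
    then have 0: "arr s ''dist'' v = 0" by simp
    have new: "bfs_inv E n r ((arr s ''dist'')(v := arr s ''dist'' (L ! reg s ''h'') + 1)) (L @ [v])
        (reg s ''h'') (insert v P)"
      by (rule bfs_inv_new[OF inv assms(2) 0 assms(5,6)])
    \<comment> \<open>A label exceeds its queue position by at most one. This keeps labels below
      \<open>B\<close> while the search is still running and they are not yet known to be
      distances.\<close>
    have "arr s ''dist'' (L ! reg s ''h'') \<le> reg s ''h'' + 1"
      using inv assms(2) unfolding bfs_inv_def by blast
    then have "arr s ''dist'' (L ! reg s ''h'') + 1 \<le> n" "length L + 1 \<le> n"
      using bfs_inv_length[OF new] assms(2) by auto
    then have "safe B scan_body s"
      using 0 assms(3,4,5,7) t bounded_storeD[OF bd] by (simp add: scan_body_def)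
    moreover have "bfs_store E n r (L @ [v]) (insert v P) (step scan_body s)"
      using new t Q 0 assms(3,4)
      by (simp add: bfs_store_def scan_body_def nth_append)
    ultimately show ?thesis by blast
  qed
  then show "safe B scan_body s" "\<exists>L'. bfs_store E n r (L @ L') (insert v P) (step scan_body s)"
    by blast+
qed

lemma agree_step: "straight c \<Longrightarrow> agree c s (step c s)"
  by (induction c arbitrary: s) (auto simp: agree_def)

lemma wp_scan_loop:
  assumes "chain b (arr s ''nx'') (arr s ''to'') (reg s ''e'') vs"
    and "bfs_store E n r L P s" and "reg s ''h'' < length L" and "reg s ''u'' = L ! reg s ''h''"
    and "\<And>v. v \<in> set vs \<Longrightarrow> v < n \<and> {L ! reg s ''h'', v} \<in> E" and "n \<le> B"
  shows "wp B (While (Less (Const 0) (Var ''e'')) scan_body) s (40 * length vs + 10)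
    (\<lambda>s'. \<exists>L'. bfs_store E n r (L @ L') (P \<union> set vs) s')"
  using assms(1-5)
proof (induction vs arbitrary: s L P)
  case Nil
  have "bfs_store E n r (L @ []) P s" using Nil by simp
  then show ?case
    using Nil.prems(1) by (intro wp_conseq[OF wp_WhileFalse]) (auto intro!: exI[of _ "[]"])
next
  case (Cons v vs)
  have e: "0 < reg s ''e''" "arr s ''to'' (reg s ''e'') = v"
    "chain b (arr s ''nx'') (arr s ''to'') (arr s ''nx'' (reg s ''e'')) vs"
    using Cons.prems(1) by auto
  have v: "v < n" "{L ! reg s ''h'', v} \<in> E" using Cons.prems(5) by auto
  have straight: "straight scan_body" by (simp add: scan_body_def)
  have "wp B scan_body s 30 (\<lambda>s'. wp B (While (Less (Const 0) (Var ''e'')) scan_body) s'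
      (40 * length vs + 10) (\<lambda>s'. \<exists>L'. bfs_store E n r (L @ L') (P \<union> set (v # vs)) s'))"
  proof (rule wp_straight[OF straight])
    assume bd: "bounded_store B s"
    define s' where "s' = step scan_body s"
    note st = scan_body_step[OF Cons.prems(2-4) e(2) v assms(6) bd, folded s'_def]
    obtain L' where L': "bfs_store E n r (L @ L') (insert v P) s'" using st(2) by blast
    have ag: "agree scan_body s s'" unfolding s'_def by (rule agree_step[OF straight])
    then have same: "reg s' ''h'' = reg s ''h''" "reg s' ''u'' = reg s ''u''"
      "arr s' ''nx'' = arr s ''nx''" "arr s' ''to'' = arr s ''to''"
      by (simp_all add: agree_def)
    have "wp B (While (Less (Const 0) (Var ''e'')) scan_body) s' (40 * length vs + 10)
        (\<lambda>s'. \<exists>L''. bfs_store E n r ((L @ L') @ L'') (insert v P \<union> set vs) s')"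
      using e(3) L' Cons.prems st(3) by (intro Cons.IH) (auto simp: same nth_append)
    then have "wp B (While (Less (Const 0) (Var ''e'')) scan_body) s' (40 * length vs + 10)
        (\<lambda>s'. \<exists>L'. bfs_store E n r (L @ L') (P \<union> set (v # vs)) s')"
      by (rule wp_conseq) (use append_assoc in \<open>auto simp del: append_assoc simp: append_assoc\<close>)
    with st(1) show "safe B scan_body s \<and> wp B (While (Less (Const 0) (Var ''e'')) scan_body)
        (step scan_body s) (40 * length vs + 10)
        (\<lambda>s'. \<exists>L'. bfs_store E n r (L @ L') (P \<union> set (v # vs)) s')"
      by (simp add: s'_def)
  qed (simp add: scan_body_def)
  then show ?case
    using e(1) by (intro wp_conseq[OF wp_WhileTrue]) auto
qed

lemma bfs_store_take:
  assumes "bfs_store E n r L P s" and h: "h \<le> length L"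
  shows "arr s ''queue'' ` {..<h} = set (take h L)"
proof -
  have "arr s ''queue'' ` {0..<h} = (!) L ` {0..<h}"
    using assms by (intro image_cong) (auto simp: bfs_store_def)
  also have "\<dots> = set (take h L)" by (rule nth_image[OF h])
  finally show ?thesis by (simp add: lessThan_atLeast0)
qed

lemma sum_minus_single:
  fixes f :: "'a \<Rightarrow> nat"
  assumes "finite A" and "a \<in> A" and "a \<notin> P"
  shows "sum f (A - P) = f a + sum f (A - insert a P)"
proof -
  have "A - insert a P = A - P - {a}" by blast
  then show ?thesis using assms sum.remove[of "A - P" a f] by simp
qed

lemma wp_bfs_loop:
  assumes adj: "\<And>u. u < n \<Longrightarrow> set (adj u) = {v. {u, v} \<in> E}"
    and V: "\<And>x y. {x, y} \<in> E \<Longrightarrow> y < n" and n: "n \<le> B"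
    and chain: "\<And>u. u < n \<Longrightarrow> chain b (arr s ''nx'') (arr s ''to'') (arr s ''hd'' u) (adj u)"
    and init: "bfs_store E n r [r] {} s" "reg s ''h'' = 0"
  shows "wp B (While (Less (Var ''h'') (Var ''t'')) bfs_body) s
      (40 * (n + (\<Sum>u<n. length (adj u))) + 10)
      (\<lambda>s'. \<exists>L. bfs_inv E n r (arr s' ''dist'') L (length L) {} \<and> reg s' ''t'' = length L)"
proof -
  define I where "I s' \<longleftrightarrow> (\<exists>L. bfs_store E n r L {} s') \<and> agree bfs_body s s'" for s'
  \<comment> \<open>Every vertex pays once, when it leaves the queue, for itself and its neighbours.
    As a potential must be a function of the store, the finished vertices are read off as the queue
    cells before the head.\<close>
  define f where "f u = 40 + 40 * length (adj u)" for u
  define \<Phi> where "\<Phi> s' = 10 + sum f ({..<n} - arr s' ''queue'' ` {..<reg s' ''h''})" for s' :: store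
  have "wp B (While (Less (Var ''h'') (Var ''t'')) bfs_body) s (\<Phi> s)
      (\<lambda>s'. \<exists>L. bfs_inv E n r (arr s' ''dist'') L (length L) {} \<and> reg s' ''t'' = length L)"
  proof (rule wp_While[where I = I])
    show "I s" using init agree_refl by (auto simp: I_def)
  next
    fix s1 assume I: "I s1" and b: "bval (Less (Var ''h'') (Var ''t'')) s1"
      and bd: "bounded_store B s1"
    then obtain L where L: "bfs_store E n r L {} s1" and ag: "agree bfs_body s s1"
      by (auto simp: I_def)
    define h where "h = reg s1 ''h''"
    define u where "u = L ! h"
    have inv: "bfs_inv E n r (arr s1 ''dist'') L h {}" and h: "h < length L"
      and Q: "arr s1 ''queue'' h = u"
      using L b by (auto simp: bfs_store_def h_def u_def)
    have "set L \<subseteq> {..<n}" using inv by (simp add: bfs_inv_def)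
    then have u: "u < n" using nth_mem[OF h] by (auto simp: u_def)
    define pre where "pre = Seq (Assign ''u'' (Read ''queue'' (Var ''h'')))
      (Assign ''e'' (Read ''hd'' (Var ''u'')))"
    define s2 where "s2 = step pre s1"
    have s2: "reg s2 = (reg s1)(''u'' := u, ''e'' := arr s1 ''hd'' u)" "arr s2 = arr s1"
      using Q by (simp_all add: s2_def pre_def h_def)
    have same: "arr s2 a = arr s a" if "a \<in> {''nx'', ''to'', ''hd''}" for a
      using agree_arr[OF ag, of a] that s2 by auto
    have L2: "bfs_store E n r L {} s2" using L s2 by (simp add: bfs_store_def)
    have "wp B (While (Less (Const 0) (Var ''e'')) scan_body) s2 (40 * length (adj u) + 10)
        (\<lambda>s'. \<exists>L'. bfs_store E n r (L @ L') ({} \<union> set (adj u)) s')"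
    proof (rule wp_scan_loop[OF _ L2])
      show "chain b (arr s2 ''nx'') (arr s2 ''to'') (reg s2 ''e'') (adj u)"
        using chain[OF u] s2 same[of "''hd''"] same[of "''nx''"] same[of "''to''"] by simp
    qed (use h u adj V n s2 in \<open>auto simp: h_def u_def\<close>)
    then have loop: "wp B (While (Less (Const 0) (Var ''e'')) scan_body) s2
        (40 * length (adj u) + 10)
        (\<lambda>s3. wp B (Assign ''h'' (Plus (Var ''h'') (Const 1))) s3 7
          (\<lambda>s'. I s' \<and> \<Phi> s' + (40 * length (adj u) + 23) + 3 \<le> \<Phi> s1))"
    proof (rule wp_conseq)
      fix s3 assume "\<exists>L'. bfs_store E n r (L @ L') ({} \<union> set (adj u)) s3"
        and ag3: "agree (While (Less (Const 0) (Var ''e'')) scan_body) s2 s3"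
      then obtain L' where L3: "bfs_store E n r (L @ L') (set (adj u)) s3" by auto
      have h3: "reg s3 ''h'' = h" using agree_reg[OF ag3, of "''h''"] s2 by (simp add: h_def)
      have inv3: "bfs_inv E n r (arr s3 ''dist'') (L @ L') h (set (adj u))"
        using L3 h3 by (simp add: bfs_store_def)
      have nxt: "bfs_inv E n r (arr s3 ''dist'') (L @ L') (Suc h) {}"
        by (rule bfs_inv_next[OF inv3]) (use h adj[OF u] in \<open>auto simp: nth_append u_def\<close>)
      define s4 where "s4 = set_reg ''h'' (Suc h) s3"
      have L4: "bfs_store E n r (L @ L') {} s4"
        using L3 nxt by (simp add: bfs_store_def s4_def)
      have h4: "reg s4 ''h'' = Suc h" by (simp add: s4_def)
      have "agree bfs_body s s4"
        using ag ag3 s2 by (auto simp: agree_def s4_def)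
      with L4 have I4: "I s4" unfolding I_def by blast
      have P1: "arr s1 ''queue'' ` {..<h} = set (take h L)"
        using bfs_store_take[OF L] h by simp
      have "arr s4 ''queue'' ` {..<Suc h} = set (take (Suc h) (L @ L'))"
        using bfs_store_take[OF L4, of "Suc h"] h by simp
      then have P4: "arr s4 ''queue'' ` {..<Suc h} = insert u (set (take h L))"
        using h take_Suc_conv_app_nth[OF h] by (simp add: u_def)
      have "distinct (take (Suc h) L)" using inv by (simp add: bfs_inv_def)
      then have "u \<notin> set (take h L)"
        using take_Suc_conv_app_nth[OF h] by (simp add: u_def)
      then have "\<Phi> s1 = f u + \<Phi> s4"
        unfolding \<Phi>_def h_def[symmetric] h4 P1 P4 using u by (subst sum_minus_single) auto
      moreover have "Suc h \<le> B"
        using h bfs_inv_length[OF inv] n by simp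
      ultimately show "wp B (Assign ''h'' (Plus (Var ''h'') (Const 1))) s3 7
          (\<lambda>s'. I s' \<and> \<Phi> s' + (40 * length (adj u) + 23) + 3 \<le> \<Phi> s1)"
        using I4 h3 by (intro wp_straight) (auto simp: f_def s4_def)
    qed simp
    have "wp B bfs_body s1 (3 + (3 + ((40 * length (adj u) + 10) + 7)))
        (\<lambda>s'. I s' \<and> \<Phi> s' + (40 * length (adj u) + 23) + 3 \<le> \<Phi> s1)"
      unfolding bfs_body_def
    proof (rule wp_Seq, rule wp_straight)
      have "wp B (Seq (Assign ''e'' (Read ''hd'' (Var ''u'')))
        (Seq (While (Less (Const 0) (Var ''e'')) scan_body)
         (Assign ''h'' (Plus (Var ''h'') (Const 1))))) (set_reg ''u'' u s1)
        (3 + ((40 * length (adj u) + 10) + 7))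
        (\<lambda>s'. I s' \<and> \<Phi> s' + (40 * length (adj u) + 23) + 3 \<le> \<Phi> s1)"
      proof (rule wp_Seq, rule wp_straight)
        show "safe B (Assign ''e'' (Read ''hd'' (Var ''u''))) (set_reg ''u'' u s1) \<and>
          wp B (Seq (While (Less (Const 0) (Var ''e'')) scan_body)
           (Assign ''h'' (Plus (Var ''h'') (Const 1))))
          (step (Assign ''e'' (Read ''hd'' (Var ''u''))) (set_reg ''u'' u s1))
          ((40 * length (adj u) + 10) + 7)
          (\<lambda>s'. I s' \<and> \<Phi> s' + (40 * length (adj u) + 23) + 3 \<le> \<Phi> s1)"
          using wp_Seq[OF loop] bounded_storeD[OF bd] Q by (simp add: s2_def pre_def h_def)
      qed auto
      then show "safe B (Assign ''u'' (Read ''queue'' (Var ''h''))) s1 \<and>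
        wp B (Seq (Assign ''e'' (Read ''hd'' (Var ''u'')))
        (Seq (While (Less (Const 0) (Var ''e'')) scan_body)
         (Assign ''h'' (Plus (Var ''h'') (Const 1)))))
        (step (Assign ''u'' (Read ''queue'' (Var ''h''))) s1)
        (3 + ((40 * length (adj u) + 10) + 7))
        (\<lambda>s'. I s' \<and> \<Phi> s' + (40 * length (adj u) + 23) + 3 \<le> \<Phi> s1)"
        using u n Q by (simp add: h_def)
    qed auto
    then show "\<exists>C. wp B bfs_body s1 C (\<lambda>s'. I s' \<and>
        \<Phi> s' + C + bexp_units (Less (Var ''h'') (Var ''t'')) \<le> \<Phi> s1)"
      by (intro exI) (rule wp_conseq, assumption, auto)
  next
    fix s1 assume I: "I s1" and b: "\<not> bval (Less (Var ''h'') (Var ''t'')) s1"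
    then obtain L where L: "bfs_store E n r L {} s1" by (auto simp: I_def)
    then have "reg s1 ''h'' = length L" "reg s1 ''t'' = length L"
      using b by (auto simp: bfs_store_def bfs_inv_def)
    then show "(\<exists>L. bfs_inv E n r (arr s1 ''dist'') L (length L) {} \<and> reg s1 ''t'' = length L) \<and>
        bexp_units (Less (Var ''h'') (Var ''t'')) \<le> \<Phi> s1"
      using L by (auto simp: bfs_store_def \<Phi>_def)
  qed
  then show ?thesis
    by (rule wp_conseq)
      (simp_all add: \<Phi>_def f_def init(2) sum.distrib sum_distrib_left)
qed

lemma wp_bfs:
  assumes adj: "\<And>u. u < n \<Longrightarrow> set (adj u) = {v. {u, v} \<in> E}"
    and V: "\<And>x y. {x, y} \<in> E \<Longrightarrow> y < n" and n: "n \<le> B" "reg s ''n'' = n"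
    and chain: "\<And>u. u < n \<Longrightarrow> chain b (arr s ''nx'') (arr s ''to'') (arr s ''hd'' u) (adj u)"
    and r: "reg s ''x'' = r" "r < n"
  shows "wp B bfs s (100 * (n + (\<Sum>u<n. length (adj u)) + 1))
      (\<lambda>s'. \<exists>L. bfs_inv E n r (arr s' ''dist'') L (length L) {} \<and> reg s' ''t'' = length L)"
proof -
  let ?C = "40 * (n + (\<Sum>u<n. length (adj u))) + 10"
  let ?Q = "\<lambda>s'. \<exists>L. bfs_inv E n r (arr s' ''dist'') L (length L) {} \<and> reg s' ''t'' = length L"
  let ?clear = "For ''v'' ''n'' (Write ''dist'' (Var ''v'') (Const 0))"
  have "wp B ?clear s ((reg s ''n'' + 1) * (3 + 12))
      (\<lambda>s'. \<forall>v<n. arr s' ''dist'' v = 0)"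
    by (rule wp_For[where J = "\<lambda>k s'. \<forall>v<k. arr s' ''dist'' v = 0"], (simp; fail)+)
      (rule wp_straight, auto simp: less_Suc_eq n(2))
  then have "wp B ?clear s (15 * (n + 1)) (\<lambda>s1. wp B (Seq (Seq (Write ''dist'' (Var ''x'') (Const 1))
         (Seq (Write ''queue'' (Const 0) (Var ''x''))
         (Seq (Assign ''h'' (Const 0)) (Assign ''t'' (Const 1)))))
         (While (Less (Var ''h'') (Var ''t'')) bfs_body)) s1 (20 + ?C) ?Q)"
  proof (rule wp_conseq)
    fix s1 assume d: "\<forall>v<n. arr s1 ''dist'' v = 0" and ag: "agree ?clear s s1"
    have same: "reg s1 ''x'' = r" "\<And>a. a \<noteq> ''dist'' \<Longrightarrow> arr s1 a = arr s a"
      using ag r by (simp_all add: agree_def)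
    have inv: "bfs_inv E n r ((arr s1 ''dist'')(r := 1)) [r] 0 {}"
      by (rule bfs_inv_init) (use d r in auto)
    show "wp B (Seq (Seq (Write ''dist'' (Var ''x'') (Const 1))
         (Seq (Write ''queue'' (Const 0) (Var ''x''))
         (Seq (Assign ''h'' (Const 0)) (Assign ''t'' (Const 1)))))
         (While (Less (Var ''h'') (Var ''t'')) bfs_body)) s1 (20 + ?C) ?Q"
    proof (rule wp_Seq, rule wp_straight, simp, intro conjI)
      show "wp B (While (Less (Var ''h'') (Var ''t'')) bfs_body)
        (step (Seq (Write ''dist'' (Var ''x'') (Const 1))
         (Seq (Write ''queue'' (Const 0) (Var ''x''))
         (Seq (Assign ''h'' (Const 0)) (Assign ''t'' (Const 1))))) s1) ?C ?Q"
        using chain inv by (intro wp_bfs_loop[OF adj V n(1)]) (auto simp: same bfs_store_def)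
    qed (use r n same in auto)
  qed (simp add: n(2))
  then have "wp B bfs s (15 * (n + 1) + (20 + ?C)) ?Q"
    unfolding bfs_def by (rule wp_Seq)
  then show ?thesis by (rule wp_conseq) auto
qed


subsection \<open>Building the adjacency lists\<close>

text \<open>The abstract content of the linked lists after \<open>i\<close> edges; later edges come
  first because cells are pushed at the front.\<close>

primrec adj_upto :: "(nat \<times> nat) list \<Rightarrow> nat \<Rightarrow> nat \<Rightarrow> nat list" where
  "adj_upto es 0 u = []"
| "adj_upto es (Suc i) u =
     (if u = snd (es ! i) then [fst (es ! i)] else []) @
     (if u = fst (es ! i) then [snd (es ! i)] else []) @ adj_upto es i u"

lemma set_adj_upto:
  "set (adj_upto es k u) = {v. \<exists>j<k. es ! j = (u, v) \<or> es ! j = (v, u)}"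
  by (induction k) (auto simp: less_Suc_eq prod_eq_iff)

lemma sum_length_adj_upto:
  assumes "\<And>j. j < k \<Longrightarrow> fst (es ! j) < n \<and> snd (es ! j) < n"
  shows "(\<Sum>u<n. length (adj_upto es k u)) = 2 * k"
  using assms
proof (induction k)
  case (Suc k)
  have "length (adj_upto es (Suc k) u) = (if u = snd (es ! k) then 1 else 0) +
      (if u = fst (es ! k) then 1 else 0) + length (adj_upto es k u)" for u
    by simp
  then have "(\<Sum>u<n. length (adj_upto es (Suc k) u)) =
      (\<Sum>u<n. if u = snd (es ! k) then 1 else 0) + (\<Sum>u<n. if u = fst (es ! k) then 1 else 0) +
      (\<Sum>u<n. length (adj_upto es k u))"
    by (simp only: sum.distrib)
  then show ?case using Suc by simp
qed simp

text \<open>Edge \<open>i\<close> owns the cells \<open>2 * i + 1\<close> and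
  \<open>2 * i + 2\<close>, one for each direction. Starting at 1 leaves cell 0 as end mark, so the
  initially cleared heads already represent empty lists.\<close>

definition build_body :: com where
  "build_body =
    (let c1 = Plus (Plus (Var ''i'') (Var ''i'')) (Const 1);
         c2 = Plus (Plus (Var ''i'') (Var ''i'')) (Const 2)
     in Seq (Assign ''u'' (Read ''fst'' (Var ''i'')))
       (Seq (Assign ''v'' (Read ''snd'' (Var ''i'')))
       (Seq (Write ''nx'' c1 (Read ''hd'' (Var ''u'')))
       (Seq (Write ''to'' c1 (Var ''v''))
       (Seq (Write ''hd'' (Var ''u'') c1)
       (Seq (Write ''nx'' c2 (Read ''hd'' (Var ''v'')))
       (Seq (Write ''to'' c2 (Var ''u''))
            (Write ''hd'' (Var ''v'') c2))))))))"

definition build :: com where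
  "build = For ''i'' ''m'' build_body"

lemma mod_build [simp]:
  "mod_regs build_body = {''u'', ''v''}" "mod_arrs build_body = {''nx'', ''to'', ''hd''}"
  "mod_regs build = {''i'', ''u'', ''v''}" "mod_arrs build = {''nx'', ''to'', ''hd''}"
  by (auto simp: build_def build_body_def Let_def)

lemma wp_build:
  assumes m: "reg s ''m'' = length es" and n: "n \<le> B" and B: "2 * length es \<le> B"
    and es: "\<And>i. i < length es \<Longrightarrow> arr s ''fst'' i = fst (es ! i) \<and> arr s ''snd'' i = snd (es ! i) \<and>
      fst (es ! i) \<noteq> snd (es ! i) \<and> fst (es ! i) < n \<and> snd (es ! i) < n"
    and hd: "\<And>u. arr s ''hd'' u = 0"
  shows "wp B build s (200 * (length es + 1)) (\<lambda>s'. \<forall>u.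
      chain (2 * length es) (arr s' ''nx'') (arr s' ''to'') (arr s' ''hd'' u) (adj_upto es (length es) u))"
proof -
  define J where "J k s' \<longleftrightarrow> (\<forall>u. arr s' ''hd'' u \<le> 2 * k \<and>
    chain (2 * k) (arr s' ''nx'') (arr s' ''to'') (arr s' ''hd'' u) (adj_upto es k u))" for k and s' :: store
  have "wp B build s ((reg s ''m'' + 1) * (90 + 12)) (J (length es))"
    unfolding build_def
  proof (rule wp_For[where J = J])
    show "J 0 (set_reg ''i'' 0 s)" using hd by (simp add: J_def)
  next
    fix k s' assume k: "k < reg s ''m''" "reg s' ''i'' = k" and J: "J k s'"
      and ag: "agree (For ''i'' ''m'' build_body) s s'" and bd: "bounded_store B s'"
    obtain a b where ab: "es ! k = (a, b)" by force
    have f: "arr s' ''fst'' k = a" "arr s' ''snd'' k = b" "a \<noteq> b" "a < n" "b < n"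
      using es[of k] k m ab ag by (auto simp: agree_def)
    define s'' where "s'' = step build_body s'"
    have hd'': "arr s'' ''hd'' = (arr s' ''hd'')(a := 2 * k + 1, b := 2 * k + 2)"
      and nx'': "arr s'' ''nx'' =
        (arr s' ''nx'')(2 * k + 1 := arr s' ''hd'' a, 2 * k + 2 := arr s' ''hd'' b)"
      and to'': "arr s'' ''to'' = (arr s' ''to'')(2 * k + 1 := b, 2 * k + 2 := a)"
      using f k(2) by (simp_all add: s''_def build_body_def Let_def flip: mult_2)
    have old: "chain (2 * Suc k) (arr s'' ''nx'') (arr s'' ''to'') (arr s' ''hd'' u) (adj_upto es k u)"
      for u
    proof (rule chain_cong)
      show "chain (2 * k) (arr s' ''nx'') (arr s' ''to'') (arr s' ''hd'' u) (adj_upto es k u)"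
        using J by (simp add: J_def)
    qed (simp_all add: nx'' to'')
    have le: "arr s' ''hd'' u \<le> 2 * k" for u using J by (simp add: J_def)
    have "J (Suc k) s''"
      unfolding J_def
    proof (intro allI conjI)
      fix u
      show "arr s'' ''hd'' u \<le> 2 * Suc k" using le[of u] by (simp add: hd'')
      consider "u = a" | "u = b" | "u \<noteq> a" "u \<noteq> b" by blast
      then show "chain (2 * Suc k) (arr s'' ''nx'') (arr s'' ''to'') (arr s'' ''hd'' u) (adj_upto es (Suc k) u)"
      proof cases
        case 1
        have "arr s'' ''hd'' u = 2 * k + 1" "arr s'' ''nx'' (2 * k + 1) = arr s' ''hd'' a"
          "arr s'' ''to'' (2 * k + 1) = b"
          using f(3) 1 by (simp_all add: hd'' nx'' to'')
        then show ?thesis using old[of a] f(3) 1 ab by simp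
      next
        case 2
        have "arr s'' ''hd'' u = 2 * k + 2" "arr s'' ''nx'' (2 * k + 2) = arr s' ''hd'' b"
          "arr s'' ''to'' (2 * k + 2) = a"
          using f(3) 2 by (simp_all add: hd'' nx'' to'')
        then show ?thesis using old[of b] f(3) 2 ab by simp
      next
        case 3
        then show ?thesis using old[of u] ab by (simp add: hd'')
      qed
    qed
    moreover have "safe B build_body s'"
      using f k m B n bounded_storeD[OF bd] by (simp add: build_body_def Let_def)
    ultimately show "wp B build_body s' 90 (\<lambda>s''. J (Suc k) (set_reg ''i'' (Suc k) s''))"
      by (intro wp_straight)
        (simp_all add: J_def flip: s''_def, simp_all add: build_body_def Let_def)
  next
    fix s' assume "J (reg s ''m'') s'"
    then show "J (length es) s'" using m by simp
  qed simp_all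
  then show ?thesis
    by (rule wp_conseq) (simp_all add: m J_def)
qed


subsection \<open>Testing a vertex\<close>

text \<open>\<open>z\<close> is the label of the best candidate \<open>y\<close> and starts above
  all possible labels. Only vertices of the other colour can raise \<open>out\<close>, which keeps
  it a lower bound on the diameter. Equality of colours is the absence of both strict
  inequalities.\<close>

definition explore :: com where
  "explore = Seq bfs (Seq (Assign ''z'' (Plus (Var ''n'') (Const 1)))
     (For ''v'' ''n''
       (Cond (BAnd (BNot (Less (Read ''S'' (Var ''v'')) (Read ''S'' (Var ''x''))))
                   (BNot (Less (Read ''S'' (Var ''x'')) (Read ''S'' (Var ''v'')))))
         Skip
         (Seq (Cond (Less (Plus (Var ''out'') (Const 1)) (Read ''dist'' (Var ''v'')))
                (Assign ''out'' (Minus (Read ''dist'' (Var ''v'')) (Const 1))) Skip)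
              (Cond (Less (Read ''dist'' (Var ''v'')) (Var ''z''))
                (Seq (Assign ''z'' (Read ''dist'' (Var ''v''))) (Assign ''y'' (Var ''v''))) Skip)))))"

lemma mod_explore [simp]:
  "mod_regs explore = {''u'', ''h'', ''v'', ''t'', ''e'', ''z'', ''out'', ''y''}"
  "mod_arrs explore = {''dist'', ''queue''}"
  by (auto simp: explore_def)

text \<open>The factor \<open>2 - S x\<close> is 1 if \<open>x\<close> is in \<open>S\<close> and 2
  otherwise, the weight of \<open>x\<close> as a target in \<open>weighted_dist\<close>.\<close>

definition update_key :: com where
  "update_key = For ''v'' ''n''
     (Seq (Assign ''d'' (Times (Minus (Read ''dist'' (Var ''v'')) (Const 1))
             (Minus (Const 2) (Read ''S'' (Var ''x'')))))
          (Cond (Less (Var ''d'') (Read ''key'' (Var ''v''))) (Write ''key'' (Var ''v'') (Var ''d'')) Skip))"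

lemma mod_update_key [simp]:
  "mod_regs update_key = {''v'', ''d''}" "mod_arrs update_key = {''key''}"
  by (auto simp: update_key_def)

text \<open>Keys are updated before \<open>x\<close> is replaced by its partner \<open>y\<close>:
  they measure distances to the chosen vertices only, because the probabilistic argument concerns
  these, whereas partners just contribute to the estimate.\<close>

definition test :: com where
  "test = Seq explore (Seq update_key (Seq (Assign ''x'' (Var ''y'')) explore))"

lemma mod_test [simp]:
  "mod_regs test = {''u'', ''h'', ''v'', ''t'', ''e'', ''z'', ''out'', ''y'', ''d'', ''x''}"
  "mod_arrs test = {''dist'', ''queue'', ''key''}"
  by (auto simp: test_def)

definition test_all :: "string \<Rightarrow> string \<Rightarrow> com" where
  "test_all a b = For ''i'' b (Seq (Assign ''x'' (Read a (Var ''i''))) test)"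

lemma mod_test_all [simp]:
  "mod_regs (test_all a b) =
     {''i'', ''u'', ''h'', ''v'', ''t'', ''e'', ''z'', ''out'', ''y'', ''d'', ''x''}"
  "mod_arrs (test_all a b) = {''dist'', ''queue'', ''key''}"
  by (auto simp: test_all_def)

text \<open>One bound for all numbers of a run on a given sample: keys and weighted distances need
  \<open>2 * n\<close>, list cells \<open>2 * length es\<close>.\<close>

locale st_instance =
  fixes n :: nat and E :: "nat set set" and S :: "nat set" and es :: "(nat \<times> nat) list" and B :: nat
  assumes inst: "ST_instance n E S es"
    and B: "2 * n + 2 * length es + 2 \<le> B"
begin

definition adj :: "nat \<Rightarrow> nat list" where
  "adj = adj_upto es (length es)"

definition graph_store :: "store \<Rightarrow> bool" where
  "graph_store s \<longleftrightarrow> reg s ''n'' = n \<and> (\<forall>v. arr s ''S'' v = (if v \<in> S then 1 else 0)) \<and>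
     (\<forall>u<n. chain (2 * length es) (arr s ''nx'') (arr s ''to'') (arr s ''hd'' u) (adj u))"

lemma graph_store_agree:
  "graph_store s \<Longrightarrow> agree c s s' \<Longrightarrow> ''n'' \<notin> mod_regs c \<Longrightarrow>
   {''S'', ''nx'', ''to'', ''hd''} \<inter> mod_arrs c = {} \<Longrightarrow> graph_store s'"
  by (simp add: graph_store_def agree_def)

lemma graph_store_set_reg [simp]: "x \<noteq> ''n'' \<Longrightarrow> graph_store (set_reg x v s) = graph_store s"
  by (simp add: graph_store_def)

lemma S_subset: "S \<subseteq> {0..<n}" and S_ne: "S \<noteq> {}" and T_ne: "{0..<n} - S \<noteq> {}"
  and simple: "simple_graph {0..<n} E"
  using inst by (auto simp: ST_instance_def)

lemma edge_less: "{x, y} \<in> E \<Longrightarrow> y < n"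
  using simple unfolding simple_graph_def by (metis atLeastLessThan_iff doubleton_eq_iff)

lemma es_nth:
  assumes "i < length es"
  shows "fst (es ! i) \<noteq> snd (es ! i) \<and> fst (es ! i) < n \<and> snd (es ! i) < n"
proof -
  obtain a b where ab: "es ! i = (a, b)" by force
  then have "(a, b) \<in> set es" using assms by (metis nth_mem)
  then have e: "{a, b} \<in> E" using inst unfolding ST_instance_def by force
  then have "{b, a} \<in> E" by (simp add: insert_commute)
  moreover have "a \<noteq> b" using e simple unfolding simple_graph_def by (metis doubleton_eq_iff)
  ultimately show ?thesis using e edge_less ab by auto
qed

lemma set_adj: "set (adj u) = {v. {u, v} \<in> E}"
proof -
  have E: "E = (\<lambda>(u, v). {u, v}) ` set es" using inst by (simp add: ST_instance_def)
  have "{u, v} \<in> E \<longleftrightarrow> (u, v) \<in> set es \<or> (v, u) \<in> set es" for v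
    unfolding E by (auto simp: image_iff doubleton_eq_iff split: prod.splits intro: rev_bexI)
  then have "{u, v} \<in> E \<longleftrightarrow> (\<exists>j<length es. es ! j = (u, v) \<or> es ! j = (v, u))" for v
    by (auto simp: in_set_conv_nth)
  then show ?thesis by (simp add: adj_def set_adj_upto)
qed

lemma sum_adj: "(\<Sum>u<n. length (adj u)) = 2 * length es"
  unfolding adj_def using es_nth by (intro sum_length_adj_upto) auto

lemma wp_bfs_graph:
  assumes "graph_store s" and "reg s ''x'' = r" "r < n"
  shows "wp B bfs s (200 * (n + length es + 1))
      (\<lambda>s'. \<exists>L. bfs_inv E n r (arr s' ''dist'') L (length L) {} \<and> reg s' ''t'' = length L)"
  by (rule wp_conseq[OF wp_bfs[where b = "2 * length es" and adj = adj]])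
    (use assms B set_adj edge_less sum_adj in \<open>simp_all add: graph_store_def\<close>)

end

locale connected_instance = st_instance +
  assumes conn: "\<And>u v. u < n \<Longrightarrow> v < n \<Longrightarrow> \<exists>k. (edge_rel E ^^ k) u v"
begin

sublocale connected_graph "{0..<n}" E
  by unfold_locales (use simple conn in auto)

lemma d_less: "u < n \<Longrightarrow> v < n \<Longrightarrow> d u v < n"
  using d_less_card[of u v] by simp

lemma wp_bfs_connected:
  assumes "graph_store s" and "reg s ''x'' = r" "r < n"
  shows "wp B bfs s (200 * (n + length es + 1)) (\<lambda>s'. \<forall>v<n. arr s' ''dist'' v = Suc (d r v))"
proof (rule wp_conseq[OF wp_bfs_graph[OF assms]])
  fix s' assume "\<exists>L. bfs_inv E n r (arr s' ''dist'') L (length L) {} \<and> reg s' ''t'' = length L"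
  then obtain L where L: "bfs_inv E n r (arr s' ''dist'') L (length L) {}" by blast
  note final = bfs_inv_final[OF L edge_less]
  show "\<forall>v<n. arr s' ''dist'' v = Suc (d r v)"
    using conn[OF assms(3)] final by simp
qed simp

definition opp :: "nat \<Rightarrow> nat \<Rightarrow> bool" where
  "opp x v \<longleftrightarrow> (v \<in> S) \<noteq> (x \<in> S)"

text \<open>That \<open>out\<close> is old or attained by an opposite vertex is recorded besides its
  lower bounds, since it later shows that the estimate never exceeds the diameter.\<close>

definition explored :: "nat \<Rightarrow> nat \<Rightarrow> nat \<Rightarrow> store \<Rightarrow> bool" where
  "explored r k out0 s \<longleftrightarrow>
     out0 \<le> reg s ''out'' \<and> (\<forall>v<k. opp r v \<longrightarrow> d r v \<le> reg s ''out'') \<and>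
     (reg s ''out'' = out0 \<or> (\<exists>v<k. opp r v \<and> reg s ''out'' = d r v)) \<and>
     (if \<exists>v<k. opp r v
      then reg s ''y'' < k \<and> opp r (reg s ''y'') \<and> reg s ''z'' = Suc (d r (reg s ''y'')) \<and>
        (\<forall>v<k. opp r v \<longrightarrow> d r (reg s ''y'') \<le> d r v)
      else reg s ''z'' = n + 1)"

lemma wp_explore:
  assumes g: "graph_store s" and x: "reg s ''x'' = r" "r < n"
  shows "wp B explore s (300 * (n + length es + 1))
      (\<lambda>s'. explored r n (reg s ''out'') s' \<and> (\<forall>v<n. arr s' ''dist'' v = Suc (d r v)))"
proof -
  define body where "body = (Cond (BAnd (BNot (Less (Read ''S'' (Var ''v'')) (Read ''S'' (Var ''x''))))
                   (BNot (Less (Read ''S'' (Var ''x'')) (Read ''S'' (Var ''v'')))))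
         Skip
         (Seq (Cond (Less (Plus (Var ''out'') (Const 1)) (Read ''dist'' (Var ''v'')))
                (Assign ''out'' (Minus (Read ''dist'' (Var ''v'')) (Const 1))) Skip)
              (Cond (Less (Read ''dist'' (Var ''v'')) (Var ''z''))
                (Seq (Assign ''z'' (Read ''dist'' (Var ''v''))) (Assign ''y'' (Var ''v''))) Skip)))"
  have m: "mod_regs body = {''out'', ''z'', ''y''}" "mod_arrs body = {}" and st: "straight body"
    and un: "units body \<le> 60"
    by (auto simp: body_def)
  let ?Q = "\<lambda>s'. explored r n (reg s ''out'') s' \<and> (\<forall>v<n. arr s' ''dist'' v = Suc (d r v))"
  have loop: "wp B (For ''v'' ''n'' body) s2 ((n + 1) * (60 + 12)) ?Q"
    if g2: "graph_store s2" and out2: "reg s2 ''out'' = reg s ''out''" and x2: "reg s2 ''x'' = r"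
      and z2: "reg s2 ''z'' = n + 1" and dist2: "\<forall>v<n. arr s2 ''dist'' v = Suc (d r v)" for s2
  proof -
    have "wp B (For ''v'' ''n'' body) s2 ((reg s2 ''n'' + 1) * (60 + 12)) ?Q"
    proof (rule wp_For[where J = "\<lambda>k s'. explored r k (reg s ''out'') s'"])
      show "explored r 0 (reg s ''out'') (set_reg ''v'' 0 s2)"
        using out2 z2 by (simp add: explored_def)
    next
      fix k s' assume k: "k < reg s2 ''n''" "reg s' ''v'' = k"
        and ag: "agree (For ''v'' ''n'' body) s2 s'" and bd: "bounded_store B s'"
        and J: "explored r k (reg s ''out'') s'"
      have kn: "k < n" using k g2 by (simp add: graph_store_def)
      have same: "arr s' = arr s2" "reg s' ''x'' = r"
        using ag x2 by (auto simp: agree_def m fun_eq_iff)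
      have Sv: "arr s' ''S'' v = (if v \<in> S then 1 else 0)" for v
        using g2 same by (simp add: graph_store_def)
      have dk: "arr s' ''dist'' k = Suc (d r k)" "d r k < n" "n \<le> B"
        using dist2 kn same d_less[OF x(2) kn] B by auto
      have "explored r (Suc k) (reg s ''out'') (step body s') \<and> safe B body s'"
      proof (cases "opp r k")
        case False
        then have "step body s' = s'" "safe B body s'"
          using k same Sv by (auto simp: body_def opp_def)
        moreover have "(\<exists>v<Suc k. opp r v) = (\<exists>v<k. opp r v)" using False by (auto simp: less_Suc_eq)
        ultimately show ?thesis using J False by (auto simp: explored_def less_Suc_eq)
      next
        case True
        define A where "A = Seq (Cond (Less (Plus (Var ''out'') (Const 1)) (Read ''dist'' (Var ''v'')))
                (Assign ''out'' (Minus (Read ''dist'' (Var ''v'')) (Const 1))) Skip)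
              (Cond (Less (Read ''dist'' (Var ''v'')) (Var ''z''))
                (Seq (Assign ''z'' (Read ''dist'' (Var ''v''))) (Assign ''y'' (Var ''v''))) Skip)"
        have stp: "step body s' = step A s'" "safe B body s' = safe B A s'"
          using True k same Sv by (auto simp: body_def A_def opp_def)
        define s3 where "s3 = step A s'"
        have r3: "reg s3 ''out'' = max (reg s' ''out'') (d r k)"
          "reg s3 ''z'' = min (reg s' ''z'') (Suc (d r k))"
          "reg s3 ''y'' = (if Suc (d r k) < reg s' ''z'' then k else reg s' ''y'')"
          using dk k by (auto simp: s3_def A_def max_def min_def)
        have saf: "safe B A s'"
          using dk k kn by (auto simp: A_def)
        have ex: "\<exists>v<Suc k. opp r v" using True by auto
        have "explored r (Suc k) (reg s ''out'') s3"
        proof (cases "\<exists>v<k. opp r v")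
          case ex': True
          then have y: "reg s' ''y'' < k" "opp r (reg s' ''y'')" "reg s' ''z'' = Suc (d r (reg s' ''y''))"
            "\<forall>v<k. opp r v \<longrightarrow> d r (reg s' ''y'') \<le> d r v"
            using J by (auto simp: explored_def)
          show ?thesis
            using J y ex True unfolding explored_def r3
            by (auto simp: less_Suc_eq max_def min_def intro: order.trans)
        next
          case ex': False
          then have z: "reg s' ''z'' = n + 1" using J by (simp add: explored_def)
          show ?thesis
            using J z ex ex' True dk unfolding explored_def r3
            by (auto simp: less_Suc_eq max_def min_def)
        qed
        then show ?thesis using saf stp by (simp add: s3_def)
      qed
      then show "wp B body s' 60 (\<lambda>s''. explored r (Suc k) (reg s ''out'') (set_reg ''v'' (Suc k) s''))"
        by (intro wp_straight[OF st _ un]) (simp add: explored_def)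
    next
      fix s' assume ag: "agree (For ''v'' ''n'' body) s2 s'" and J: "explored r (reg s2 ''n'') (reg s ''out'') s'"
      then show "?Q s'" using g2 dist2 by (simp add: agree_def m graph_store_def)
    qed (simp_all add: m)
    then show ?thesis using g2 by (simp add: graph_store_def)
  qed
  have "wp B bfs s (200 * (n + length es + 1)) (\<lambda>s1. wp B
      (Seq (Assign ''z'' (Plus (Var ''n'') (Const 1))) (For ''v'' ''n'' body)) s1
      (10 + (n + 1) * (60 + 12)) ?Q)"
  proof (rule wp_conseq[OF wp_bfs_connected[OF g x]])
    fix s1 assume ag: "agree bfs s s1" and dist1: "\<forall>v<n. arr s1 ''dist'' v = Suc (d r v)"
    have g1: "graph_store s1" using graph_store_agree[OF g ag] by simp
    have same: "reg s1 ''n'' = n" "reg s1 ''out'' = reg s ''out''" "reg s1 ''x'' = r"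
      using ag g x by (auto simp: agree_def graph_store_def)
    show "wp B (Seq (Assign ''z'' (Plus (Var ''n'') (Const 1))) (For ''v'' ''n'' body)) s1
      (10 + (n + 1) * (60 + 12)) ?Q"
    proof (rule wp_Seq, rule wp_straight)
      have "wp B (For ''v'' ''n'' body) (set_reg ''z'' (n + 1) s1) ((n + 1) * (60 + 12)) ?Q"
        by (rule loop) (use g1 same dist1 in simp_all)
      then show "safe B (Assign ''z'' (Plus (Var ''n'') (Const 1))) s1 \<and> wp B (For ''v'' ''n'' body)
          (step (Assign ''z'' (Plus (Var ''n'') (Const 1))) s1) ((n + 1) * (60 + 12)) ?Q"
        using same(1) B by (simp del: mult_Suc mult_Suc_right)
    qed simp_all
  qed simp
  then have "wp B explore s (200 * (n + length es + 1) + (10 + (n + 1) * (60 + 12))) ?Q"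
    unfolding explore_def body_def by (rule wp_Seq)
  then show ?thesis by (rule wp_conseq) auto
qed

lemma wp_update_key:
  assumes g: "graph_store s" and x: "reg s ''x'' = r" "r < n"
    and dist: "\<forall>v<n. arr s ''dist'' v = Suc (d r v)"
  shows "wp B update_key s (100 * (n + 1))
      (\<lambda>s'. \<forall>v<n. arr s' ''key'' v = min (arr s ''key'' v) (weighted_dist S v r))"
proof -
  let ?J = "\<lambda>k s'. \<forall>v<n. arr s' ''key'' v =
    (if v < k then min (arr s ''key'' v) (weighted_dist S v r) else arr s ''key'' v)"
  have "wp B update_key s ((reg s ''n'' + 1) * (60 + 12))
      (\<lambda>s'. \<forall>v<n. arr s' ''key'' v = min (arr s ''key'' v) (weighted_dist S v r))"
    unfolding update_key_def
  proof (rule wp_For[where J = ?J])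
    fix k s' assume k: "k < reg s ''n''" "reg s' ''v'' = k" and J: "?J k s'"
      and ag: "agree (For ''v'' ''n''
     (Seq (Assign ''d'' (Times (Minus (Read ''dist'' (Var ''v'')) (Const 1))
             (Minus (Const 2) (Read ''S'' (Var ''x'')))))
          (Cond (Less (Var ''d'') (Read ''key'' (Var ''v''))) (Write ''key'' (Var ''v'') (Var ''d'')) Skip))) s s'"
    have kn: "k < n" using k g by (simp add: graph_store_def)
    have same: "arr s' ''dist'' k = Suc (d r k)" "reg s' ''x'' = r"
      "arr s' ''S'' r = (if r \<in> S then 1 else 0)"
      using ag x dist kn g by (auto simp: agree_def graph_store_def)
    have w: "d r k * (2 - (if r \<in> S then 1 else 0)) = weighted_dist S k r"
      by (simp add: weighted_dist_def walk_dist_sym[of E r k])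
    have wB: "weighted_dist S k r \<le> B"
      using d_less[OF kn x(2)] B by (auto simp: weighted_dist_def)
    show "wp B (Seq (Assign ''d'' (Times (Minus (Read ''dist'' (Var ''v'')) (Const 1))
             (Minus (Const 2) (Read ''S'' (Var ''x'')))))
          (Cond (Less (Var ''d'') (Read ''key'' (Var ''v''))) (Write ''key'' (Var ''v'') (Var ''d'')) Skip))
        s' 60 (\<lambda>s''. ?J (Suc k) (set_reg ''v'' (Suc k) s''))"
    proof (rule wp_straight, goal_cases)
      case 2
      have "aval (Times (Minus (Read ''dist'' (Var ''v'')) (Const 1))
             (Minus (Const 2) (Read ''S'' (Var ''x'')))) s' = weighted_dist S k r"
        using same k w by simp
      then show ?case
        using J k kn wB by (simp del: aval.simps(4,5,6) add: less_Suc_eq min_def)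
    qed simp_all
  qed (use g in \<open>simp_all add: graph_store_def\<close>)
  then show ?thesis using g by (elim wp_conseq) (simp_all add: graph_store_def)
qed

end


subsection \<open>The algorithm for a given sample\<close>

text \<open>The comparison with \<open>c\<close> is not strict, so the first vertex of
  \<open>S\<close> is accepted even if its key equals the initial value 0.\<close>

definition pick_center :: com where
  "pick_center = Seq (Seq (Assign ''w'' (Const 0)) (Assign ''c'' (Const 0))) (For ''v'' ''n''
     (Cond (BAnd (Less (Const 0) (Read ''S'' (Var ''v''))) (BNot (Less (Read ''key'' (Var ''v'')) (Var ''c''))))
       (Seq (Assign ''w'' (Var ''v'')) (Assign ''c'' (Read ''key'' (Var ''v'')))) Skip))"

text \<open>At most \<open>K\<close> candidates are stored. The time bound must hold for unlucky
  samples too, and the whole ball is needed only when it has at most \<open>K\<close>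
  vertices.\<close>

definition collect :: com where
  "collect = Seq (Assign ''j'' (Const 0)) (For ''v'' ''n''
     (Seq (Assign ''d'' (Times (Minus (Read ''dist'' (Var ''v'')) (Const 1))
             (Minus (Const 2) (Read ''S'' (Var ''v'')))))
     (Cond (BAnd (Less (Var ''d'') (Var ''c'')) (Less (Var ''j'') (Var ''K'')))
       (Seq (Write ''cand'' (Var ''j'') (Var ''v'')) (Assign ''j'' (Plus (Var ''j'') (Const 1)))) Skip)))"

text \<open>The initial key \<open>2 * n\<close> acts as infinity, because weighted distances in a
  connected graph are smaller.\<close>

definition main :: com where
  "main =
     Seq (For ''v'' ''n'' (Write ''key'' (Var ''v'') (Plus (Var ''n'') (Var ''n''))))
    (Seq (test_all ''R'' ''K'')
    (Seq pick_center
    (Seq (Assign ''x'' (Var ''w''))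
    (Seq bfs
    (Seq collect
         (test_all ''cand'' ''j''))))))"

text \<open>After the search from vertex 0 the queue length \<open>t\<close> is the size of its
  component, so comparing it with \<open>n\<close> decides connectivity.\<close>

definition diam :: com where
  "diam = Cond (Less (Plus (Var ''m'') (Const 1)) (Var ''n'')) (Assign ''inf'' (Const 1))
     (Seq build (Seq (Assign ''x'' (Const 0)) (Seq bfs
       (Cond (Less (Var ''t'') (Var ''n'')) (Assign ''inf'' (Const 1)) main))))"

lemma mod_pick_center [simp]: "mod_regs pick_center = {''w'', ''c'', ''v''}" "mod_arrs pick_center = {}"
  and mod_collect [simp]: "mod_regs collect = {''j'', ''v'', ''d''}" "mod_arrs collect = {''cand''}"
  by (auto simp: pick_center_def collect_def)

context connected_instance
begin

text \<open>The last clause encloses \<open>key\<close> between two bounds instead of naming a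
  minimum over \<open>X\<close>, which would not exist for the empty set from which testing starts.
  The limit \<open>2 * n\<close> on \<open>c\<close> reflects the initial keys.\<close>

definition tested :: "nat set \<Rightarrow> store \<Rightarrow> bool" where
  "tested X s \<longleftrightarrow>
     (\<forall>x\<in>X. \<forall>v<n. opp x v \<longrightarrow> d x v \<le> reg s ''out'') \<and>
     (\<forall>x\<in>X. \<exists>y<n. opp x y \<and> (\<forall>v<n. opp x v \<longrightarrow> d x y \<le> d x v) \<and>
        (\<forall>v<n. opp y v \<longrightarrow> d y v \<le> reg s ''out'')) \<and>
     (\<forall>D. (\<forall>u\<in>S. \<forall>v\<in>{0..<n} - S. d u v \<le> D) \<longrightarrow> reg s ''out'' \<le> D) \<and>
     (\<forall>v<n. (\<forall>x\<in>X. arr s ''key'' v \<le> weighted_dist S v x) \<and>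
        (\<forall>c\<le>2 * n. (\<forall>x\<in>X. c \<le> weighted_dist S v x) \<longrightarrow> c \<le> arr s ''key'' v))"

lemma tested_cong:
  "reg s' ''out'' = reg s ''out'' \<Longrightarrow> arr s' ''key'' = arr s ''key'' \<Longrightarrow> tested X s' = tested X s"
  by (simp add: tested_def)

lemma testedD:
  assumes "tested X s"
  shows "x \<in> X \<Longrightarrow> v < n \<Longrightarrow> opp x v \<Longrightarrow> d x v \<le> reg s ''out''"
    and "x \<in> X \<Longrightarrow> \<exists>y<n. opp x y \<and> (\<forall>v<n. opp x v \<longrightarrow> d x y \<le> d x v) \<and>
        (\<forall>v<n. opp y v \<longrightarrow> d y v \<le> reg s ''out'')"
    and "\<forall>u\<in>S. \<forall>v\<in>{0..<n} - S. d u v \<le> D \<Longrightarrow> reg s ''out'' \<le> D"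
    and "v < n \<Longrightarrow> x \<in> X \<Longrightarrow> arr s ''key'' v \<le> weighted_dist S v x"
    and "v < n \<Longrightarrow> c \<le> 2 * n \<Longrightarrow> \<forall>x\<in>X. c \<le> weighted_dist S v x \<Longrightarrow> c \<le> arr s ''key'' v"
  using assms by (simp_all add: tested_def)

lemma ex_opp:
  assumes "r < n"
  shows "\<exists>v<n. opp r v"
proof -
  have "\<exists>v\<in>S. v < n" "\<exists>v. v < n \<and> v \<notin> S" using S_ne T_ne S_subset by fastforce+
  then show ?thesis unfolding opp_def by metis
qed

lemma opp_le:
  assumes "\<forall>u\<in>S. \<forall>v\<in>{0..<n} - S. d u v \<le> D" and "r < n" "v < n" "opp r v"
  shows "d r v \<le> D"
proof (cases "r \<in> S")
  case True
  then show ?thesis using assms by (simp add: opp_def)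
next
  case False
  then have "d v r \<le> D" using assms by (simp add: opp_def)
  then show ?thesis by (simp add: walk_dist_sym[of E r v])
qed

lemma wp_test:
  assumes g: "graph_store s" and x: "reg s ''x'' = r" "r < n" and X: "tested X s"
  shows "wp B test s (800 * (n + length es + 1)) (tested (insert r X))"
proof -
  let ?T = "n + length es + 1"
  let ?Q = "tested (insert r X)"
  have "wp B explore s (300 * ?T) (\<lambda>s1. wp B
      (Seq update_key (Seq (Assign ''x'' (Var ''y'')) explore)) s1 (100 * (n + 1) + (2 + 300 * ?T)) ?Q)"
  proof (rule wp_conseq[OF wp_explore[OF g x]])
    fix s1 assume *: "explored r n (reg s ''out'') s1 \<and> (\<forall>v<n. arr s1 ''dist'' v = Suc (d r v))"
      and ag1: "agree explore s s1"
    have g1: "graph_store s1" using graph_store_agree[OF g ag1] by simp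
    have x1: "reg s1 ''x'' = r" and key1: "arr s1 ''key'' = arr s ''key''"
      using ag1 x by (simp_all add: agree_def)
    define y where "y = reg s1 ''y''"
    have y: "y < n" "opp r y" "\<forall>v<n. opp r v \<longrightarrow> d r y \<le> d r v"
      using * ex_opp[OF x(2)] by (auto simp: explored_def y_def)
    have out1: "reg s ''out'' \<le> reg s1 ''out''" "\<forall>v<n. opp r v \<longrightarrow> d r v \<le> reg s1 ''out''"
      "reg s1 ''out'' = reg s ''out'' \<or> (\<exists>v<n. opp r v \<and> reg s1 ''out'' = d r v)"
      using * by (auto simp: explored_def)
    show "wp B (Seq update_key (Seq (Assign ''x'' (Var ''y'')) explore)) s1
        (100 * (n + 1) + (2 + 300 * ?T)) ?Q"
    proof (rule wp_Seq, rule wp_conseq[OF wp_update_key[OF g1 x1 x(2)]])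
      fix s2 assume key2: "\<forall>v<n. arr s2 ''key'' v = min (arr s1 ''key'' v) (weighted_dist S v r)"
        and ag2: "agree update_key s1 s2" and bd: "bounded_store B s2"
      have g2: "graph_store s2" using graph_store_agree[OF g1 ag2] by simp
      have same2: "reg s2 ''y'' = y" "reg s2 ''out'' = reg s1 ''out''"
        using ag2 by (simp_all add: agree_def y_def)
      have "wp B explore (set_reg ''x'' y s2) (300 * ?T) ?Q"
      proof (rule wp_conseq[OF wp_explore])
        fix s3 assume **: "explored y n (reg (set_reg ''x'' y s2) ''out'') s3 \<and>
            (\<forall>v<n. arr s3 ''dist'' v = Suc (d y v))"
          and ag3: "agree explore (set_reg ''x'' y s2) s3"
        have out3: "reg s1 ''out'' \<le> reg s3 ''out''" "\<forall>v<n. opp y v \<longrightarrow> d y v \<le> reg s3 ''out''"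
          "reg s3 ''out'' = reg s1 ''out'' \<or> (\<exists>v<n. opp y v \<and> reg s3 ''out'' = d y v)"
          using ** same2 by (auto simp: explored_def)
        have key3: "\<forall>v<n. arr s3 ''key'' v = min (arr s ''key'' v) (weighted_dist S v r)"
          using ag3 key2 key1 by (simp add: agree_def)
        have mono: "reg s ''out'' \<le> reg s3 ''out''" using out1(1) out3(1) by simp
        show "?Q s3"
          unfolding tested_def
        proof (intro conjI)
          show "\<forall>z\<in>insert r X. \<forall>v<n. opp z v \<longrightarrow> d z v \<le> reg s3 ''out''"
          proof (intro ballI allI impI)
            fix z v assume z: "z \<in> insert r X" "v < n" "opp z v"
            have "d z v \<le> reg s1 ''out'' \<or> d z v \<le> reg s ''out''"
              using z out1(2) X unfolding tested_def by blast
            then show "d z v \<le> reg s3 ''out''" using out3(1) mono by linarith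
          qed
          show "\<forall>z\<in>insert r X. \<exists>y<n. opp z y \<and> (\<forall>v<n. opp z v \<longrightarrow> d z y \<le> d z v) \<and>
              (\<forall>v<n. opp y v \<longrightarrow> d y v \<le> reg s3 ''out'')"
          proof
            fix z assume "z \<in> insert r X"
            then consider "z = r" | "z \<in> X" by blast
            then show "\<exists>y<n. opp z y \<and> (\<forall>v<n. opp z v \<longrightarrow> d z y \<le> d z v) \<and>
              (\<forall>v<n. opp y v \<longrightarrow> d y v \<le> reg s3 ''out'')"
            proof cases
              case 1
              then show ?thesis using y out3(2) by blast
            next
              case 2
              then obtain y' where "y' < n" "opp z y'" "\<forall>v<n. opp z v \<longrightarrow> d z y' \<le> d z v"
                "\<forall>v<n. opp y' v \<longrightarrow> d y' v \<le> reg s ''out''"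
                using X unfolding tested_def by blast
              then show ?thesis using mono by (meson le_trans)
            qed
          qed
          show "\<forall>D. (\<forall>u\<in>S. \<forall>v\<in>{0..<n} - S. d u v \<le> D) \<longrightarrow> reg s3 ''out'' \<le> D"
          proof (intro allI impI)
            fix D assume D: "\<forall>u\<in>S. \<forall>v\<in>{0..<n} - S. d u v \<le> D"
            then have "reg s ''out'' \<le> D" using X unfolding tested_def by blast
            then have "reg s1 ''out'' \<le> D" using out1(3) opp_le[OF D x(2)] by auto
            then show "reg s3 ''out'' \<le> D" using out3(3) opp_le[OF D y(1)] by auto
          qed
          show "\<forall>v<n. (\<forall>x\<in>insert r X. arr s3 ''key'' v \<le> weighted_dist S v x) \<and>
            (\<forall>c\<le>2 * n. (\<forall>x\<in>insert r X. c \<le> weighted_dist S v x) \<longrightarrow> c \<le> arr s3 ''key'' v)"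
          proof (intro allI impI)
            fix v assume v: "v < n"
            then have "(\<forall>x\<in>X. arr s ''key'' v \<le> weighted_dist S v x) \<and>
              (\<forall>c\<le>2 * n. (\<forall>x\<in>X. c \<le> weighted_dist S v x) \<longrightarrow> c \<le> arr s ''key'' v)"
              using X unfolding tested_def by blast
            then show "(\<forall>x\<in>insert r X. arr s3 ''key'' v \<le> weighted_dist S v x) \<and>
            (\<forall>c\<le>2 * n. (\<forall>x\<in>insert r X. c \<le> weighted_dist S v x) \<longrightarrow> c \<le> arr s3 ''key'' v)"
              using key3 v by (simp add: min_le_iff_disj)
          qed
        qed
      qed (use g2 y in simp_all)
      then show "wp B (Seq (Assign ''x'' (Var ''y'')) explore) s2 (2 + 300 * ?T) ?Q"
        by (intro wp_Seq wp_straight) (use same2 bounded_storeD[OF bd, of "''y''"] in simp_all)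
    qed (use * in simp_all)
  qed simp
  then have "wp B test s (300 * ?T + (100 * (n + 1) + (2 + 300 * ?T))) ?Q"
    unfolding test_def by (rule wp_Seq)
  then show ?thesis by (rule wp_conseq) auto
qed

lemma wp_test_all:
  assumes g: "graph_store s" and b: "reg s b = N" and A: "\<And>i. i < N \<Longrightarrow> arr s a i < n"
    and X: "tested X s"
    and names: "a \<notin> {''dist'', ''queue'', ''key''}" "b \<in> {''K'', ''j''}"
  shows "wp B (test_all a b) s (900 * (N + 1) * (n + length es + 1))
    (tested (X \<union> arr s a ` {..<N}))"
proof -
  let ?T = "n + length es + 1"
  let ?c = "Seq (Assign ''x'' (Read a (Var ''i''))) test"
  have "wp B (test_all a b) s ((reg s b + 1) * ((3 + 800 * ?T) + 12)) (tested (X \<union> arr s a ` {..<N}))"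
    unfolding test_all_def
  proof (rule wp_For[where J = "\<lambda>k s'. tested (X \<union> arr s a ` {..<k}) s'"])
    show "tested (X \<union> arr s a ` {..<0}) (set_reg ''i'' 0 s)"
      using X by (simp add: tested_def)
  next
    fix k s' assume k: "k < reg s b" "reg s' ''i'' = k" and ag: "agree (For ''i'' b ?c) s s'"
      and bd: "bounded_store B s'" and J: "tested (X \<union> arr s a ` {..<k}) s'"
    have g': "graph_store s'" using graph_store_agree[OF g ag] names by auto
    have ak: "arr s' a k = arr s a k" using ag names by (simp add: agree_def)
    have "arr s a k < n" using A k b by simp
    then have akB: "arr s a k \<le> B" using B by simp
    have "wp B test (set_reg ''x'' (arr s a k) s') (800 * ?T)
        (tested (insert (arr s a k) (X \<union> arr s a ` {..<k})))"
      by (rule wp_test) (use g' k A b J in \<open>auto simp: tested_def\<close>)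
    then have "wp B test (set_reg ''x'' (arr s a k) s') (800 * ?T)
        (\<lambda>s''. tested (X \<union> arr s a ` {..<Suc k}) (set_reg ''i'' (Suc k) s''))"
      by (rule wp_conseq) (simp_all add: tested_def lessThan_Suc)
    then show "wp B ?c s' (3 + 800 * ?T)
        (\<lambda>s''. tested (X \<union> arr s a ` {..<Suc k}) (set_reg ''i'' (Suc k) s''))"
      by (intro wp_Seq wp_straight) (use k ak akB in \<open>simp_all add: algebra_simps\<close>)
  next
    fix s' assume "tested (X \<union> arr s a ` {..<reg s b}) s'"
    then show "tested (X \<union> arr s a ` {..<N}) s'" by (simp add: b)
  qed (use names in auto)
  then show ?thesis
  proof (rule wp_conseq)
    have "(reg s b + 1) * ((3 + 800 * ?T) + 12) \<le> (N + 1) * (900 * ?T)"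
      unfolding b by (rule mult_le_mono2) simp
    then show "(reg s b + 1) * ((3 + 800 * ?T) + 12) \<le> 900 * (N + 1) * ?T"
      by (simp only: mult_ac)
  qed
qed

lemma wp_pick_center:
  assumes g: "graph_store s"
  shows "wp B pick_center s (100 * (n + 1)) (\<lambda>s'. reg s' ''w'' \<in> S \<and>
     reg s' ''c'' = arr s ''key'' (reg s' ''w'') \<and> (\<forall>v\<in>S. arr s ''key'' v \<le> reg s' ''c''))"
proof -
  define body where "body = Cond (BAnd (Less (Const 0) (Read ''S'' (Var ''v'')))
      (BNot (Less (Read ''key'' (Var ''v'')) (Var ''c''))))
      (Seq (Assign ''w'' (Var ''v'')) (Assign ''c'' (Read ''key'' (Var ''v'')))) Skip"
  have m: "mod_regs body = {''w'', ''c''}" "mod_arrs body = {}" and st: "straight body"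
    and un: "units body \<le> 60"
    by (auto simp: body_def)
  define J where "J k s' \<longleftrightarrow> (if \<exists>v<k. v \<in> S
      then reg s' ''w'' \<in> S \<and> reg s' ''c'' = arr s ''key'' (reg s' ''w'') \<and>
        (\<forall>v\<in>S. v < k \<longrightarrow> arr s ''key'' v \<le> reg s' ''c'')
      else reg s' ''c'' = 0)" for k and s' :: store
  have J_set: "J k (set_reg ''v'' x s') = J k s'" for k x s'
  proof -
    have "reg (set_reg ''v'' x s') ''w'' = reg s' ''w''" "reg (set_reg ''v'' x s') ''c'' = reg s' ''c''"
      by simp_all
    then show ?thesis unfolding J_def by (simp only: arr_set_reg)
  qed
  let ?Q = "\<lambda>s'. reg s' ''w'' \<in> S \<and>
     reg s' ''c'' = arr s ''key'' (reg s' ''w'') \<and> (\<forall>v\<in>S. arr s ''key'' v \<le> reg s' ''c'')"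
  let ?s0 = "set_reg ''c'' 0 (set_reg ''w'' 0 s)"
  have "wp B (For ''v'' ''n'' body) ?s0 ((reg ?s0 ''n'' + 1) * (60 + 12)) ?Q"
  proof (rule wp_For[where J = J])
    fix k s' assume k: "k < reg ?s0 ''n''" "reg s' ''v'' = k" and J: "J k s'"
      and ag: "agree (For ''v'' ''n'' body) ?s0 s'" and bd: "bounded_store B s'"
    have arr: "arr s' = arr s" using ag by (auto simp: agree_def m)
    have Sv: "arr s ''S'' k = (if k \<in> S then 1 else 0)" using g by (simp add: graph_store_def)
    have "J (Suc k) (step body s')"
    proof (cases "k \<in> S \<and> reg s' ''c'' \<le> arr s ''key'' k")
      case True
      then show ?thesis
        using J k arr Sv by (auto simp: J_def body_def less_Suc_eq split: if_splits)
    next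
      case False
      then have st: "step body s' = s'" using k arr Sv by (auto simp: body_def)
      show ?thesis
      proof (cases "k \<in> S")
        case True
        with False J have ex: "\<exists>v<k. v \<in> S" by (auto simp: J_def split: if_splits)
        have "reg s' ''w'' \<in> S \<and> reg s' ''c'' = arr s ''key'' (reg s' ''w'') \<and>
          (\<forall>v\<in>S. v < k \<longrightarrow> arr s ''key'' v \<le> reg s' ''c'')"
          using J unfolding J_def if_P[OF ex] .
        moreover have "\<exists>v<Suc k. v \<in> S" using True by blast
        ultimately show ?thesis using False True unfolding st J_def by (auto simp: less_Suc_eq)
      next
        case kS: False
        then have "(\<exists>v<Suc k. v \<in> S) = (\<exists>v<k. v \<in> S)" by (auto simp: less_Suc_eq)
        then show ?thesis using J kS unfolding st J_def by (auto simp: less_Suc_eq split: if_splits)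
      qed
    qed
    moreover have "safe B body s'" using bounded_storeD[OF bd] k by (auto simp: body_def)
    ultimately show "wp B body s' 60 (\<lambda>s''. J (Suc k) (set_reg ''v'' (Suc k) s''))"
      by (intro wp_straight[OF st _ un]) (simp add: J_set)
  next
    fix s' assume "J (reg ?s0 ''n'') s'"
    then have J: "J n s'" using g by (simp add: graph_store_def)
    have "\<exists>v<n. v \<in> S" using S_ne S_subset by fastforce
    then show "?Q s'" using J S_subset by (auto simp: J_def)
  qed (simp_all add: m J_def)
  then have "wp B pick_center s (4 + (reg ?s0 ''n'' + 1) * (60 + 12)) ?Q"
    unfolding pick_center_def body_def by (intro wp_Seq wp_straight) simp_all
  then show ?thesis by (rule wp_conseq) (use g in \<open>auto simp: graph_store_def\<close>)
qed

lemma wp_collect: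
  assumes g: "graph_store s" and w: "w < n" and dist: "\<forall>v<n. arr s ''dist'' v = Suc (d w v)"
    and K: "reg s ''K'' = K"
  shows "wp B collect s (100 * (n + 1)) (\<lambda>s'. reg s' ''j'' \<le> K \<and>
     (\<forall>i<reg s' ''j''. arr s' ''cand'' i < n) \<and>
     (card {v. v < n \<and> weighted_dist S w v < reg s ''c''} \<le> K \<longrightarrow>
       arr s' ''cand'' ` {..<reg s' ''j''} = {v. v < n \<and> weighted_dist S w v < reg s ''c''}))"
proof -
  define body where "body = Seq (Assign ''d'' (Times (Minus (Read ''dist'' (Var ''v'')) (Const 1))
             (Minus (Const 2) (Read ''S'' (Var ''v'')))))
     (Cond (BAnd (Less (Var ''d'') (Var ''c'')) (Less (Var ''j'') (Var ''K'')))
       (Seq (Write ''cand'' (Var ''j'') (Var ''v'')) (Assign ''j'' (Plus (Var ''j'') (Const 1)))) Skip)"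
  have m: "mod_regs body = {''d'', ''j''}" "mod_arrs body = {''cand''}" and st: "straight body"
    and un: "units body \<le> 60"
    by (auto simp: body_def)
  define A where "A k = {v. v < k \<and> weighted_dist S w v < reg s ''c''}" for k
  have fin: "finite (A k)" for k by (simp add: A_def)
  define J where "J k s' \<longleftrightarrow> reg s' ''j'' = min K (card (A k)) \<and> (\<forall>i<reg s' ''j''. arr s' ''cand'' i < n) \<and>
      (card (A k) \<le> K \<longrightarrow> arr s' ''cand'' ` {..<reg s' ''j''} = A k)" for k and s' :: store
  have J_set: "J k (set_reg ''v'' x s') = J k s'" for k x s'
  proof -
    have "reg (set_reg ''v'' x s') ''j'' = reg s' ''j''" by simp
    then show ?thesis unfolding J_def by (simp only: arr_set_reg)
  qed
  let ?Q = "\<lambda>s'. reg s' ''j'' \<le> K \<and> (\<forall>i<reg s' ''j''. arr s' ''cand'' i < n) \<and>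
     (card (A n) \<le> K \<longrightarrow> arr s' ''cand'' ` {..<reg s' ''j''} = A n)"
  let ?s0 = "set_reg ''j'' 0 s"
  have "wp B (For ''v'' ''n'' body) ?s0 ((reg ?s0 ''n'' + 1) * (60 + 12)) ?Q"
  proof (rule wp_For[where J = J])
    show "J 0 (set_reg ''v'' 0 ?s0)" by (simp add: J_def A_def)
  next
    fix k s' assume k: "k < reg ?s0 ''n''" "reg s' ''v'' = k" and J: "J k s'"
      and ag: "agree (For ''v'' ''n'' body) ?s0 s'" and bd: "bounded_store B s'"
    have kn: "k < n" using k g by (simp add: graph_store_def)
    have same: "reg s' ''c'' = reg s ''c''" "reg s' ''K'' = K" "arr s' ''dist'' k = Suc (d w k)"
      "arr s' ''S'' k = (if k \<in> S then 1 else 0)"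
      using ag K g dist kn by (auto simp: agree_def m graph_store_def)
    define dk where "dk = weighted_dist S w k"
    have dk: "aval (Times (Minus (Read ''dist'' (Var ''v'')) (Const 1))
             (Minus (Const 2) (Read ''S'' (Var ''v'')))) s' = dk"
      using same k by (simp add: dk_def weighted_dist_def)
    have dkB: "dk \<le> B" using d_less[OF w kn] B by (auto simp: dk_def weighted_dist_def)
    have ASuc: "A (Suc k) = (if dk < reg s ''c'' then insert k (A k) else A k)"
      by (auto simp: A_def dk_def less_Suc_eq)
    have kA: "k \<notin> A k" by (simp add: A_def)
    have "card (A k) \<le> card {..<k}" by (rule card_mono) (auto simp: A_def)
    then have cA: "card (A k) \<le> k" by simp
    have "J (Suc k) (step body s') \<and> safe B body s'"
    proof (cases "dk < reg s ''c'' \<and> reg s' ''j'' < K")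
      case True
      then have j: "reg s' ''j'' = card (A k)" "card (A k) < K"
        using J by (auto simp: J_def)
      then have img: "arr s' ''cand'' ` {..<card (A k)} = A k" using J by (simp add: J_def)
      have "step body s' = set_reg ''j'' (Suc (card (A k)))
          (set_arr ''cand'' (card (A k)) k (set_reg ''d'' dk s'))"
        unfolding body_def step.simps dk using True same k j by (simp del: aval.simps(4,5,6))
          (simp add: set_reg_def set_arr_def)
      moreover have "safe B body s'"
        unfolding body_def safe.simps step.simps dk
        using True same k j dkB cA kn B by (simp del: aval.simps(5,6))
      moreover have "((arr s' ''cand'')(card (A k) := k)) ` {..<Suc (card (A k))} = insert k (A k)"
      proof -
        have "((arr s' ''cand'')(card (A k) := k)) ` {..<card (A k)} = arr s' ''cand'' ` {..<card (A k)}"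
          by (intro image_cong) auto
        then show ?thesis by (simp only: lessThan_Suc image_insert img fun_upd_same)
      qed
      ultimately show ?thesis
        using J j True kn fin kA by (auto simp: J_def ASuc less_Suc_eq)
    next
      case False
      then have "step body s' = set_reg ''d'' dk s'"
        unfolding body_def step.simps dk using same by (auto simp del: aval.simps(4,5,6))
      moreover have "safe B body s'"
        unfolding body_def safe.simps step.simps dk using same dkB False by (auto simp del: aval.simps(5,6))
      ultimately show ?thesis
        using J False fin kA by (auto simp: J_def ASuc split: if_splits)
    qed
    then show "wp B body s' 60 (\<lambda>s''. J (Suc k) (set_reg ''v'' (Suc k) s''))"
      by (intro wp_straight[OF st _ un]) (simp add: J_set)
  next
    fix s' assume "J (reg ?s0 ''n'') s'"
    then show "?Q s'" using g by (auto simp: J_def graph_store_def)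
  qed (simp_all add: m)
  then have "wp B collect s (3 + (reg ?s0 ''n'' + 1) * (60 + 12)) ?Q"
    unfolding collect_def body_def by (intro wp_Seq wp_straight) simp_all
  then show ?thesis by (rule wp_conseq) (use g in \<open>auto simp: graph_store_def A_def\<close>)
qed

text \<open>Contrapositive form of the statement that every weighted ball with more than
  \<open>K\<close> vertices contains a vertex of \<open>R\<close>. All centres and radii are
  included because the centre used later depends on \<open>R\<close>.\<close>

definition hits :: "nat \<Rightarrow> nat set \<Rightarrow> bool" where
  "hits K R \<longleftrightarrow> (\<forall>w<n. \<forall>c. (\<forall>x\<in>R. c \<le> weighted_dist S w x) \<longrightarrow>
     card {v. v < n \<and> weighted_dist S w v < c} \<le> K)"

text \<open>The radius \<open>key w\<close> is at most the weighted distance from \<open>w\<close>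
  to the sample, so that ball avoids the sample and \<open>hits\<close> makes it small; the
  collected candidates are then the entire ball. Two stores occur because the keys are those at the
  choice of \<open>w\<close>, while the estimate is the final one.\<close>

lemma good_estimate_tested:
  assumes R: "tested R s2" "R \<subseteq> {..<n}" and hits: "hits K R"
    and w: "w \<in> S" "\<forall>v\<in>S. arr s2 ''key'' v \<le> arr s2 ''key'' w"
    and C: "card {v. v < n \<and> weighted_dist S w v < arr s2 ''key'' w} \<le> K \<Longrightarrow>
      C = {v. v < n \<and> weighted_dist S w v < arr s2 ''key'' w}"
    and s: "tested (R \<union> C) s"
  shows "good_estimate (ST_diameter E S ({0..<n} - S)) (enat (reg s ''out''))"
proof (rule good_estimateI[OF S_subset S_ne T_ne])
  fix D assume "\<And>u v. u \<in> S \<Longrightarrow> v \<in> {0..<n} - S \<Longrightarrow> d u v \<le> D"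
  then show "reg s ''out'' \<le> D" by (intro testedD(3)[OF s]) simp
next
  fix s' t q a b
  assume st: "s' \<in> S" "t \<in> {0..<n} - S"
    and arith: "a + q = d s' t" "2 * b \<le> a" "a \<le> 2 * b + 1" "2 * q \<le> d s' t + b"
      "3 * q \<le> d s' t + 2 + 2 * a"
  have wn: "w < n" using w(1) S_subset by auto
  have "\<forall>x\<in>R. arr s2 ''key'' w \<le> weighted_dist S w x"
    using testedD(4)[OF R(1) wn] by simp
  then have "card {v. v < n \<and> weighted_dist S w v < arr s2 ''key'' w} \<le> K"
    using hits wn unfolding hits_def by blast
  note C = C[OF this]
  have X: "R \<union> C \<subseteq> {0..<n}" using R(2) C by auto
  have "d s' t < n" using st S_subset by (intro d_less) auto
  then have aN: "a < 2 * n" using arith(1) by simp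
  show "q \<le> reg s ''out''"
  proof (rule estimate_ge[OF S_subset X Un_upper1 _ _ w(1) _ _ _ st arith aN,
        where key = "arr s2 ''key''"])
    show "d x v \<le> reg s ''out''" if "x \<in> R \<union> C" "v \<in> {0..<n}" "(v \<in> S) \<noteq> (x \<in> S)" for x v
      using testedD(1)[OF s that(1)] that(2,3) by (simp add: opp_def)
    show "\<exists>y\<in>{0..<n}. (y \<in> S) \<noteq> (x \<in> S) \<and>
        (\<forall>v\<in>{0..<n}. (v \<in> S) \<noteq> (x \<in> S) \<longrightarrow> d x y \<le> d x v) \<and>
        (\<forall>v\<in>{0..<n}. (v \<in> S) \<noteq> (y \<in> S) \<longrightarrow> d y v \<le> reg s ''out'')" if x: "x \<in> R \<union> C" for x
    proof -
      obtain y where "y < n" "opp x y" "\<forall>v<n. opp x v \<longrightarrow> d x y \<le> d x v"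
        "\<forall>v<n. opp y v \<longrightarrow> d y v \<le> reg s ''out''"
        using testedD(2)[OF s x] by blast
      then show ?thesis by (intro bexI[of _ y]) (simp_all add: opp_def)
    qed
    show "arr s2 ''key'' v \<le> arr s2 ''key'' w" if "v \<in> S" for v
      using w(2) that by blast
    show "c \<le> arr s2 ''key'' v"
      if "v \<in> {0..<n}" "c \<le> 2 * n" "\<And>x. x \<in> R \<Longrightarrow> c \<le> weighted_dist S v x" for v c
      using testedD(5)[OF R(1)] that by simp
    show "u \<in> R \<union> C" if "u \<in> {0..<n}" "weighted_dist S w u < arr s2 ''key'' w" for u
      using C that by simp
  qed
qed

lemma wp_main:
  assumes g: "graph_store s" and K: "reg s ''K'' = K" and R: "\<And>i. i < K \<Longrightarrow> arr s ''R'' i < n"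
    and out: "reg s ''out'' = 0" and inf: "reg s ''inf'' = 0"
  shows "wp B main s (3000 * (K + 1) * (n + length es + 1)) (\<lambda>s'. hits K (arr s ''R'' ` {..<K}) \<longrightarrow>
    good_estimate (ST_diameter E S ({0..<n} - S)) (estimate s'))"
proof -
  let ?T = "n + length es + 1"
  let ?R = "arr s ''R'' ` {..<K}"
  let ?Q = "\<lambda>s'. hits K ?R \<longrightarrow> good_estimate (ST_diameter E S ({0..<n} - S)) (estimate s')"
  let ?init = "For ''v'' ''n'' (Write ''key'' (Var ''v'') (Plus (Var ''n'') (Var ''n'')))"
  define C2 where "C2 = 900 * (K + 1) * ?T"
  have sub: "?R \<subseteq> {..<n}" using R by auto
  have init: "wp B ?init s ((reg s ''n'' + 1) * (6 + 12)) (\<lambda>s1. \<forall>v<n. arr s1 ''key'' v = 2 * n)"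
  proof (rule wp_For[where J = "\<lambda>k s1. \<forall>v<k. arr s1 ''key'' v = 2 * n"])
    fix k s' assume k: "reg s' ''v'' = k" and ag: "agree ?init s s'"
      and J: "\<forall>v<k. arr s' ''key'' v = 2 * n"
    have "reg s' ''n'' = n" using ag g by (simp add: agree_def graph_store_def)
    then show "wp B (Write ''key'' (Var ''v'') (Plus (Var ''n'') (Var ''n''))) s' 6
        (\<lambda>s''. \<forall>v<Suc k. arr (set_reg ''v'' (Suc k) s'') ''key'' v = 2 * n)"
      by (intro wp_straight) (use k J B in \<open>auto simp: less_Suc_eq\<close>)
  qed (use g in \<open>simp_all add: graph_store_def\<close>)
  have "wp B main s (18 * (n + 1) + (C2 + (100 * (n + 1) + (2 + (200 * ?T + (100 * (n + 1) + C2)))))) ?Q"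
    unfolding main_def
  proof (rule wp_Seq, rule wp_conseq[OF init])
    show "(reg s ''n'' + 1) * (6 + 12) \<le> 18 * (n + 1)" using g by (simp add: graph_store_def)
    fix s1 assume key1: "\<forall>v<n. arr s1 ''key'' v = 2 * n" and ag1: "agree ?init s s1"
    have g1: "graph_store s1" using graph_store_agree[OF g ag1] by simp
    have K1: "reg s1 ''K'' = K" "reg s1 ''inf'' = 0" and R1: "arr s1 ''R'' = arr s ''R''"
      and out1: "reg s1 ''out'' = 0"
      using ag1 K inf out by (simp_all add: agree_def)
    have t1: "tested {} s1" using key1 out1 by (simp add: tested_def)
    show "wp B (Seq (test_all ''R'' ''K'') (Seq pick_center (Seq (Assign ''x'' (Var ''w''))
        (Seq bfs (Seq collect (test_all ''cand'' ''j'')))))) s1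
        (C2 + (100 * (n + 1) + (2 + (200 * ?T + (100 * (n + 1) + C2))))) ?Q"
    proof (rule wp_Seq, rule wp_conseq[OF wp_test_all[OF g1 K1(1) _ t1, of "''R''"]])
      show "arr s1 ''R'' i < n" if "i < K" for i using R that R1 by simp
      show "900 * (K + 1) * ?T \<le> C2" by (simp add: C2_def)
      fix s2 assume "tested ({} \<union> arr s1 ''R'' ` {..<K}) s2" and ag2: "agree (test_all ''R'' ''K'') s1 s2"
      then have t2: "tested ?R s2" by (simp add: R1)
      have g2: "graph_store s2" using graph_store_agree[OF g1 ag2] by simp
      have K2: "reg s2 ''K'' = K" "reg s2 ''inf'' = 0" using ag2 K1 by (simp_all add: agree_def)
      show "wp B (Seq pick_center (Seq (Assign ''x'' (Var ''w''))
        (Seq bfs (Seq collect (test_all ''cand'' ''j''))))) s2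
        (100 * (n + 1) + (2 + (200 * ?T + (100 * (n + 1) + C2)))) ?Q"
      proof (rule wp_Seq, rule wp_conseq[OF wp_pick_center[OF g2]])
        fix s3 assume "reg s3 ''w'' \<in> S \<and> reg s3 ''c'' = arr s2 ''key'' (reg s3 ''w'') \<and>
          (\<forall>v\<in>S. arr s2 ''key'' v \<le> reg s3 ''c'')" and ag3: "agree pick_center s2 s3"
        moreover define w where "w = reg s3 ''w''"
        ultimately have w: "w \<in> S" "reg s3 ''c'' = arr s2 ''key'' w"
          "\<forall>v\<in>S. arr s2 ''key'' v \<le> arr s2 ''key'' w" by auto
        have wn: "w < n" using w(1) S_subset by auto
        define s4 where "s4 = set_reg ''x'' w s3"
        have g4: "graph_store s4" using graph_store_agree[OF g2 ag3] by (simp add: s4_def)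
        have same4: "reg s4 ''K'' = K" "reg s4 ''inf'' = 0" "reg s4 ''x'' = w"
          "reg s4 ''c'' = arr s2 ''key'' w" "reg s4 ''out'' = reg s2 ''out''" "arr s4 ''key'' = arr s2 ''key''"
          using ag3 K2 w(2) by (simp_all add: s4_def agree_def)
        have "wp B (Seq bfs (Seq collect (test_all ''cand'' ''j''))) s4
          (200 * ?T + (100 * (n + 1) + C2)) ?Q"
        proof (rule wp_Seq, rule wp_conseq[OF wp_bfs_connected[OF g4 same4(3) wn]])
          fix s5 assume dist5: "\<forall>v<n. arr s5 ''dist'' v = Suc (d w v)" and ag5: "agree bfs s4 s5"
          have g5: "graph_store s5" using graph_store_agree[OF g4 ag5] by simp
          have same5: "reg s5 ''K'' = K" "reg s5 ''inf'' = 0" "reg s5 ''c'' = arr s2 ''key'' w"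
            "reg s5 ''out'' = reg s2 ''out''" "arr s5 ''key'' = arr s2 ''key''"
            using ag5 same4 by (simp_all add: agree_def)
          show "wp B (Seq collect (test_all ''cand'' ''j'')) s5 (100 * (n + 1) + C2) ?Q"
          proof (rule wp_Seq, rule wp_conseq[OF wp_collect[OF g5 wn dist5 same5(1)]])
            fix s6 assume *: "reg s6 ''j'' \<le> K \<and> (\<forall>i<reg s6 ''j''. arr s6 ''cand'' i < n) \<and>
              (card {v. v < n \<and> weighted_dist S w v < reg s5 ''c''} \<le> K \<longrightarrow>
               arr s6 ''cand'' ` {..<reg s6 ''j''} = {v. v < n \<and> weighted_dist S w v < reg s5 ''c''})"
              and ag6: "agree collect s5 s6"
            have g6: "graph_store s6" using graph_store_agree[OF g5 ag6] by simp
            have same6: "reg s6 ''inf'' = 0" "reg s6 ''out'' = reg s2 ''out''"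
              "arr s6 ''key'' = arr s2 ''key''"
              using ag6 same5 by (simp_all add: agree_def)
            have t6: "tested ?R s6" using t2 tested_cong[OF same6(2,3)] by simp
            show "wp B (test_all ''cand'' ''j'') s6 C2 ?Q"
            proof (rule wp_conseq[OF wp_test_all[OF g6 refl _ t6]])
              show "900 * (reg s6 ''j'' + 1) * ?T \<le> C2"
                unfolding C2_def using * by (intro mult_le_mono) auto
              fix s7 assume t7: "tested (?R \<union> arr s6 ''cand'' ` {..<reg s6 ''j''}) s7"
                and ag7: "agree (test_all ''cand'' ''j'') s6 s7"
              have "estimate s7 = enat (reg s7 ''out'')"
                using ag7 same6(1) by (simp add: agree_def estimate_def)
              then show "?Q s7"
                using good_estimate_tested[OF t2 sub _ w(1,3) _ t7, of K] * same5(3) by auto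
            qed (use * in auto)
          qed simp
        qed simp
        then show "wp B (Seq (Assign ''x'' (Var ''w'')) (Seq bfs (Seq collect (test_all ''cand'' ''j'')))) s3
          (2 + (200 * ?T + (100 * (n + 1) + C2))) ?Q"
          using wn B by (intro wp_Seq wp_straight) (simp_all add: s4_def w_def)
      qed simp
    qed simp_all
  qed
  then show ?thesis
  proof (rule wp_conseq)
    have "?T \<le> (K + 1) * ?T" by simp
    then have "500 * ?T \<le> 500 * ((K + 1) * ?T)" by (rule mult_le_mono2)
    moreover have "18 * (n + 1) + (C2 + (100 * (n + 1) + (2 + (200 * ?T + (100 * (n + 1) + C2)))))
      \<le> 2 * C2 + 500 * ?T" by simp
    ultimately have "18 * (n + 1) + (C2 + (100 * (n + 1) + (2 + (200 * ?T + (100 * (n + 1) + C2)))))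
      \<le> 2 * C2 + 500 * ((K + 1) * ?T)" by linarith
    also have "\<dots> \<le> 3000 * (K + 1) * ?T" unfolding C2_def mult.assoc by linarith
    finally show "18 * (n + 1) + (C2 + (100 * (n + 1) + (2 + (200 * ?T + (100 * (n + 1) + C2)))))
      \<le> 3000 * (K + 1) * ?T" .
  qed
qed

end

section \<open>Disconnected instances and the outer program\<close>

context st_instance
begin

lemma reach_trans:
  "\<exists>k. (edge_rel E ^^ k) u v \<Longrightarrow> \<exists>k. (edge_rel E ^^ k) v w \<Longrightarrow> \<exists>k. (edge_rel E ^^ k) u w"
  by (elim exE) (rule exI, erule (1) relpowp_trans)

lemma reach_sym: "\<exists>k. (edge_rel E ^^ k) u v \<Longrightarrow> \<exists>k. (edge_rel E ^^ k) v u"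
  by (elim exE) (rule exI, erule relpowp_edge_rel_sym)

lemma length_es: "length es = card E"
proof -
  have "distinct (map (\<lambda>(u, v). {u, v}) es)" "set (map (\<lambda>(u, v). {u, v}) es) = E"
    using inst by (auto simp: ST_instance_def)
  then show ?thesis by (metis distinct_card length_map)
qed

lemma finite_E: "finite E"
  using inst by (auto simp: ST_instance_def)

lemma n_pos: "0 < n"
  using S_ne S_subset by auto

text \<open>Every vertex other than 0 is assigned an edge towards a vertex closer to 0. Two vertices
  cannot share such an edge, as each would be closer than the other.\<close>

lemma connected_imp_edges:
  assumes "\<And>v. v < n \<Longrightarrow> \<exists>k. (edge_rel E ^^ k) 0 v"
  shows "n \<le> length es + 1"
proof -
  have "\<exists>u. {u, v} \<in> E \<and> walk_dist E 0 u < walk_dist E 0 v" if v: "v \<in> {1..<n}" for v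
  proof -
    obtain k where "(edge_rel E ^^ k) 0 v" using assms v by auto
    then have walk: "(edge_rel E ^^ walk_dist E 0 v) 0 v" by (rule walk_dist_walk)
    then obtain j where j: "walk_dist E 0 v = Suc j" using v by (cases "walk_dist E 0 v") auto
    then obtain u where "(edge_rel E ^^ j) 0 u" "{u, v} \<in> E" using walk by auto
    then show ?thesis using walk_dist_le[of j E 0 u] j by (intro exI[of _ u]) simp
  qed
  then obtain p where p: "\<And>v. v \<in> {1..<n} \<Longrightarrow> {p v, v} \<in> E \<and> walk_dist E 0 (p v) < walk_dist E 0 v"
    by metis
  have "inj_on (\<lambda>v. {p v, v}) {1..<n}"
  proof (rule inj_onI)
    fix u v assume "u \<in> {1..<n}" "v \<in> {1..<n}" and eq: "{p u, u} = {p v, v}"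
    then have "walk_dist E 0 (p u) < walk_dist E 0 u" "walk_dist E 0 (p v) < walk_dist E 0 v"
      using p by auto
    then show "u = v" using eq by (auto simp: doubleton_eq_iff)
  qed
  then have "card {1..<n} \<le> card E" using p finite_E by (intro card_inj_on_le) auto
  then show ?thesis by (simp add: length_es)
qed

text \<open>If all bichromatic pairs were joined by walks, then for fixed s and t every vertex of
  \<open>S\<close> would reach t directly and every other vertex through s, so the graph would be
  connected.\<close>

lemma ST_diameter_infinite:
  assumes "u < n" "v < n" and nreach: "\<not> (\<exists>k. (edge_rel E ^^ k) u v)"
  shows "ST_diameter E S ({0..<n} - S) = \<infinity>"
proof -
  have "\<exists>s\<in>S. \<exists>t\<in>{0..<n} - S. \<not> (\<exists>k. (edge_rel E ^^ k) s t)"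
  proof (rule ccontr)
    assume "\<not> ?thesis"
    then have ST: "\<exists>k. (edge_rel E ^^ k) s t" if "s \<in> S" "t \<in> {0..<n} - S" for s t
      using that by blast
    obtain s t where st: "s \<in> S" "t \<in> {0..<n} - S" using S_ne T_ne by blast
    have to_t: "\<exists>k. (edge_rel E ^^ k) x t" if "x < n" for x
    proof (cases "x \<in> S")
      case True
      then show ?thesis using ST st(2) by blast
    next
      case False
      then have "x \<in> {0..<n} - S" using that by simp
      then show ?thesis using reach_trans[OF reach_sym[OF ST[OF st(1)]] ST[OF st]] by blast
    qed
    show False using nreach reach_trans[OF to_t[OF assms(1)] reach_sym[OF to_t[OF assms(2)]]] by blast
  qed
  then obtain s t where st: "s \<in> S" "t \<in> {0..<n} - S" and "\<not> (\<exists>k. (edge_rel E ^^ k) s t)"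
    by blast
  then have inf: "gdist E s t = \<infinity>" by (intro gdist_unreachable) simp
  have fin: "finite S" "finite ({0..<n} - S)" using S_subset finite_subset by auto
  have "gdist E s t \<le> (MAX t\<in>{0..<n} - S. gdist E s t)" using fin st by (intro Max_ge) auto
  also have "\<dots> \<le> ST_diameter E S ({0..<n} - S)"
    unfolding ST_diameter_def using fin st by (intro Max_ge) auto
  finally show ?thesis using inf by simp
qed

text \<open>The specification of \<open>main\<close> enters as a premise that may assume
  connectivity, since this is known only after the search has reached all vertices.\<close>

lemma wp_diam:
  assumes reg: "reg s ''n'' = n" "reg s ''m'' = length es" "reg s ''out'' = 0" "reg s ''inf'' = 0"
    and input: "\<And>v. arr s ''S'' v = (if v \<in> S then 1 else 0)" "\<And>u. arr s ''hd'' u = 0"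
      "\<And>i. i < length es \<Longrightarrow> arr s ''fst'' i = fst (es ! i) \<and> arr s ''snd'' i = snd (es ! i)"
    and inf: "\<And>s'. ST_diameter E S ({0..<n} - S) = \<infinity> \<Longrightarrow> reg s' ''inf'' = 1 \<Longrightarrow> Q s'"
    and main: "\<And>s'. (\<And>u v. u < n \<Longrightarrow> v < n \<Longrightarrow> \<exists>k. (edge_rel E ^^ k) u v) \<Longrightarrow> graph_store s' \<Longrightarrow>
      reg s' ''K'' = reg s ''K'' \<Longrightarrow> arr s' ''R'' = arr s ''R'' \<Longrightarrow> reg s' ''out'' = 0 \<Longrightarrow>
      reg s' ''inf'' = 0 \<Longrightarrow> n \<le> length es + 1 \<Longrightarrow> wp B main s' C Q"
  shows "wp B diam s (1000 * (length es + 1) + C) Q"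
proof (rule wp_bounded)
  assume bd: "bounded_store B s"
  have set_inf: "wp B (Assign ''inf'' (Const 1)) s' 10 Q"
    if "ST_diameter E S ({0..<n} - S) = \<infinity>" for s'
    by (rule wp_straight) (use inf[OF that] B in auto)
  show ?thesis
  proof (cases "length es + 1 < n")
    case True
    then obtain v where "v < n" "\<not> (\<exists>k. (edge_rel E ^^ k) 0 v)"
      using connected_imp_edges by (meson not_less)
    then have "ST_diameter E S ({0..<n} - S) = \<infinity>" by (rule ST_diameter_infinite[OF n_pos])
    then have "wp B diam s (bexp_units (Less (Plus (Var ''m'') (Const 1)) (Var ''n'')) + max 10 0) Q"
      unfolding diam_def by (intro wp_Cond set_inf) (use True reg in simp_all)
    then show ?thesis by (rule wp_conseq) simp_all
  next
    case False
    let ?T = "n + length es + 1"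
    let ?rest = "Seq (Assign ''x'' (Const 0)) (Seq bfs
       (Cond (Less (Var ''t'') (Var ''n'')) (Assign ''inf'' (Const 1)) main))"
    have "wp B build s (200 * (length es + 1)) (\<lambda>s1. wp B ?rest s1 (2 + (200 * ?T + (3 + (10 + C)))) Q)"
    proof (rule wp_conseq[OF wp_build[where es = es and n = n]])
      fix s1 assume chain: "\<forall>u. chain (2 * length es) (arr s1 ''nx'') (arr s1 ''to'') (arr s1 ''hd'' u)
          (adj_upto es (length es) u)" and ag: "agree build s s1"
      define s2 where "s2 = set_reg ''x'' 0 s1"
      have g2: "graph_store s2"
        using chain ag reg(1) input(1) by (simp add: graph_store_def s2_def adj_def agree_def)
      have same2: "reg s2 ''K'' = reg s ''K''" "reg s2 ''out'' = 0" "reg s2 ''inf'' = 0" "reg s2 ''n'' = n"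
        "arr s2 ''R'' = arr s ''R''" "reg s2 ''x'' = 0"
        using ag reg by (simp_all add: s2_def agree_def)
      have "wp B (Seq bfs (Cond (Less (Var ''t'') (Var ''n'')) (Assign ''inf'' (Const 1)) main)) s2
        (200 * ?T + (3 + (10 + C))) Q"
      proof (rule wp_Seq, rule wp_conseq[OF wp_bfs_graph[OF g2 same2(6) n_pos]])
        fix s3 assume "\<exists>L. bfs_inv E n 0 (arr s3 ''dist'') L (length L) {} \<and> reg s3 ''t'' = length L"
          and ag3: "agree bfs s2 s3"
        then obtain L where L: "bfs_inv E n 0 (arr s3 ''dist'') L (length L) {}"
          and t: "reg s3 ''t'' = length L" by blast
        have g3: "graph_store s3" using graph_store_agree[OF g2 ag3] by simp
        have same3: "reg s3 ''K'' = reg s ''K''" "reg s3 ''out'' = 0" "reg s3 ''inf'' = 0"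
          "arr s3 ''R'' = arr s ''R''" "reg s3 ''n'' = n"
          using ag3 same2 by (simp_all add: agree_def)
        have Ln: "set L \<subseteq> {..<n}" "length L = card (set L)"
          using L by (auto simp: bfs_inv_def distinct_card)
        have reach0: "v \<in> set L \<longleftrightarrow> (\<exists>k. (edge_rel E ^^ k) 0 v)" for v
          by (rule bfs_inv_final(1)[OF L]) (rule edge_less)
        have "wp B (Cond (Less (Var ''t'') (Var ''n'')) (Assign ''inf'' (Const 1)) main) s3
            (bexp_units (Less (Var ''t'') (Var ''n'')) + max 10 C) Q"
        proof (rule wp_Cond)
          assume "bval (Less (Var ''t'') (Var ''n'')) s3"
          then have "card (set L) < card {..<n}" using t Ln same3 by simp
          then obtain v where "v < n" "v \<notin> set L"
            by (metis Ln(1) lessThan_iff less_irrefl subsetI subset_antisym)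
          then have "ST_diameter E S ({0..<n} - S) = \<infinity>"
            using reach0[of v] by (intro ST_diameter_infinite[OF n_pos, of v]) simp_all
          then show "wp B (Assign ''inf'' (Const 1)) s3 10 Q" by (rule set_inf)
        next
          assume "\<not> bval (Less (Var ''t'') (Var ''n'')) s3"
          then have "card {..<n} \<le> card (set L)" using t Ln same3 by simp
          then have "set L = {..<n}" using Ln(1) by (intro card_seteq) auto
          then have r0: "\<exists>k. (edge_rel E ^^ k) 0 v" if "v < n" for v
            using reach0[of v] that by simp
          have "\<exists>k. (edge_rel E ^^ k) u v" if "u < n" "v < n" for u v
            by (rule reach_trans[OF reach_sym[OF r0] r0]) (use that in simp_all)
          then show "wp B main s3 C Q"
            using False g3 same3 by (intro main) auto
        qed
        then show "wp B (Cond (Less (Var ''t'') (Var ''n'')) (Assign ''inf'' (Const 1)) main) s3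
            (3 + (10 + C)) Q"
          by (rule wp_conseq) auto
      qed simp
      then show "wp B ?rest s1 (2 + (200 * ?T + (3 + (10 + C)))) Q"
        using B by (intro wp_Seq wp_straight) (simp_all add: s2_def)
    qed (use reg input es_nth B in auto)
    then have seq: "wp B (Seq build ?rest) s (200 * (length es + 1) + (2 + (200 * ?T + (3 + (10 + C))))) Q"
      by (rule wp_Seq)
    have "wp B diam s (bexp_units (Less (Plus (Var ''m'') (Const 1)) (Var ''n'')) +
        max 0 (200 * (length es + 1) + (2 + (200 * ?T + (3 + (10 + C)))))) Q"
      unfolding diam_def by (rule wp_Cond) (use False reg seq in simp_all)
    then show ?thesis
      by (rule wp_conseq) (use False in simp_all)
  qed
qed

end


subsection \<open>Sampling\<close>

lemma exec_Seq_Assign: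
  assumes "exec (Seq c (Assign v e)) s D" and "(s', t) \<in> set_pmf D"
  shows "\<exists>s1. agree c s s1 \<and> s' = set_reg v (aval e s1) s1"
  using assms(1)
proof (rule exec_SeqE)
  fix D1 F
  assume D: "D = bind_pmf D1 (\<lambda>(s', t). charge t (F s'))" and c: "exec c s D1"
    and F: "\<forall>(s', t) \<in> set_pmf D1. exec (Assign v e) s' (F s')"
  obtain s1 t1 t2 where 1: "(s1, t1) \<in> set_pmf D1" "(s', t2) \<in> set_pmf (F s1)"
    using assms(2) unfolding D by (auto simp: charge_def)
  have "exec (Assign v e) s1 (F s1)" using F 1(1) by blast
  then have "F s1 = return_pmf (set_reg v (aval e s1) s1, 1 + acost e s1)"
    using exec_Assign exec_unique by blast
  then show ?thesis using exec_agree[OF c 1(1)] 1(2) by auto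
qed

text \<open>Carries a quantity unchanged through a terminating program that does not touch what it
  depends on; this is how the bad event, a property of \<open>R\<close>, passes through all code
  after sampling.\<close>

lemma qwp_preserved:
  assumes "exec c s D" and "\<And>s'. agree c s s' \<Longrightarrow> f s' = f s"
  shows "qwp c s f (f s)"
  unfolding qwp_def
proof (intro exI conjI)
  show "exec c s D" by (rule assms(1))
  have "(\<integral>\<^sup>+z. f (fst z) \<partial>measure_pmf D) = (\<integral>\<^sup>+z. f s \<partial>measure_pmf D)"
    using exec_agree[OF assms(1)] assms(2)
    by (intro nn_integral_cong_AE) (auto simp: AE_measure_pmf_iff)
  then show "(\<integral>\<^sup>+z. f (fst z) \<partial>measure_pmf D) \<le> f s" by simp
qed

text \<open>The union bound, when \<open>f'\<close> and all \<open>f i\<close> are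
  indicators.\<close>

lemma qwp_sum:
  assumes "exec c s D" and "\<And>i. i \<in> I \<Longrightarrow> qwp c s (f i) (p i)" and "\<And>s'. f' s' \<le> (\<Sum>i\<in>I. f i s')"
  shows "qwp c s f' (\<Sum>i\<in>I. p i)"
  unfolding qwp_def
proof (intro exI conjI)
  show "exec c s D" by (rule assms(1))
  have "(\<integral>\<^sup>+z. f' (fst z) \<partial>measure_pmf D) \<le> (\<integral>\<^sup>+z. (\<Sum>i\<in>I. f i (fst z)) \<partial>measure_pmf D)"
    using assms(3) by (intro nn_integral_mono) auto
  also have "\<dots> = (\<Sum>i\<in>I. \<integral>\<^sup>+z. f i (fst z) \<partial>measure_pmf D)"
    by (intro nn_integral_sum) simp
  also have "\<dots> \<le> (\<Sum>i\<in>I. p i)"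
    using assms(2) exec_unique[OF assms(1)] by (intro sum_mono) (auto simp: qwp_def)
  finally show "(\<integral>\<^sup>+z. f' (fst z) \<partial>measure_pmf D) \<le> (\<Sum>i\<in>I. p i)" .
qed

definition sample_body :: com where
  "sample_body = Seq (Sample ''x'' (Var ''n'')) (Write ''R'' (Var ''i'') (Var ''x''))"

definition sample :: com where
  "sample = For ''i'' ''K'' sample_body"

lemma mod_sample [simp]:
  "mod_regs sample_body = {''x''}" "mod_arrs sample_body = {''R''}"
  "mod_regs sample = {''i'', ''x''}" "mod_arrs sample = {''R''}"
  by (auto simp: sample_body_def sample_def)

lemma wp_sample:
  assumes n: "reg s ''n'' = n" "0 < n" "n \<le> B"
  shows "wp B sample s (20 * (reg s ''K'' + 1)) (\<lambda>s'. \<forall>i<reg s ''K''. arr s' ''R'' i < n)"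
proof -
  have "wp B sample s ((reg s ''K'' + 1) * (5 + 12)) (\<lambda>s'. \<forall>i<reg s ''K''. arr s' ''R'' i < n)"
    unfolding sample_def
  proof (rule wp_For[where J = "\<lambda>k s'. \<forall>i<k. arr s' ''R'' i < n"])
    fix k s' assume k: "reg s' ''i'' = k" and ag: "agree (For ''i'' ''K'' sample_body) s s'"
      and J: "\<forall>i<k. arr s' ''R'' i < n"
    have n': "reg s' ''n'' = n" using ag n by (simp add: agree_def)
    have "wp B sample_body s' ((1 + aexp_units (Var ''n'')) + 3)
        (\<lambda>s''. \<forall>i<Suc k. arr (set_reg ''i'' (Suc k) s'') ''R'' i < n)"
      unfolding sample_body_def
      by (rule wp_Seq, rule wp_Sample)
        (use n n' k J in \<open>auto intro!: wp_straight simp: less_Suc_eq\<close>)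
    then show "wp B sample_body s' 5 (\<lambda>s''. \<forall>i<Suc k. arr (set_reg ''i'' (Suc k) s'') ''R'' i < n)"
      by simp
  qed simp_all
  then show ?thesis by (rule wp_conseq) auto
qed

definition avoids :: "nat set \<Rightarrow> nat \<Rightarrow> store \<Rightarrow> bool" where
  "avoids A k s \<longleftrightarrow> (\<forall>i<k. arr s ''R'' i \<notin> A)"

text \<open>Each of the \<open>j\<close> remaining draws misses \<open>A\<close> with probability 1
  - |A|/n independently of the past, and a hit already recorded can no longer be undone.\<close>

lemma qwp_sample_loop:
  assumes A: "A \<subseteq> {..<n}" and n: "0 < n"
    and s: "reg s ''n'' = n" "reg s ''K'' = K" "reg s ''i'' + j = K"
  shows "qwp (While (Less (Var ''i'') (Var ''K''))
      (Seq sample_body (Assign ''i'' (Plus (Var ''i'') (Const 1))))) s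
      (indicator {s'. avoids A K s'})
      (if avoids A (reg s ''i'') s then ennreal ((1 - card A / n) ^ j) else 0)"
  using s
proof (induction j arbitrary: s)
  case 0
  then show ?case by (intro qwp_WhileFalse) (auto simp: avoids_def)
next
  case (Suc j)
  have "card A \<le> card {..<n}" using A by (intro card_mono) auto
  then have cA: "card A \<le> n" by simp
  define r where "r = 1 - card A / n"
  have r: "0 \<le> r" using cA n by (simp add: r_def)
  let ?ok = "avoids A (reg s ''i'') s"
  let ?inc = "Seq sample_body (Assign ''i'' (Plus (Var ''i'') (Const 1)))"
  \<comment> \<open>The quantities are pulled back through one round: \<open>g\<close> is the claim
    for the next round, \<open>g1\<close> and \<open>g2\<close> are its values before the increment
    and before the write. Averaging \<open>g2\<close> over the draw yields one more factor
    \<open>r\<close>.\<close>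
  define g where "g s' = (if avoids A (reg s' ''i'') s' then ennreal (r ^ j) else 0)" for s'
  define g1 where "g1 s' = g (set_reg ''i'' (reg s' ''i'' + 1) s')" for s'
  define g2 where "g2 s' = g1 (set_arr ''R'' (reg s' ''i'') (reg s' ''x'') s')" for s'
  have g2: "g2 (set_reg ''x'' v s) = (if ?ok \<and> v \<notin> A then ennreal (r ^ j) else 0)" for v
    by (auto simp: g2_def g1_def g_def avoids_def less_Suc_eq)
  have "(\<Sum>v<n. g2 (set_reg ''x'' v s)) / of_nat n \<le> (if ?ok then ennreal (r ^ Suc j) else 0)"
  proof (cases ?ok)
    case True
    have "(\<Sum>v<n. g2 (set_reg ''x'' v s)) = (\<Sum>v\<in>{..<n} - A. ennreal (r ^ j))"
      unfolding g2 using True by (simp add: sum.If_cases Diff_eq Compl_eq)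
    also have "\<dots> = of_nat (n - card A) * ennreal (r ^ j)"
      using A by (simp add: card_Diff_subset finite_subset)
    also have "\<dots> = ennreal (real (n - card A) * r ^ j)"
      using r by (simp add: ennreal_mult ennreal_of_nat_eq_real_of_nat)
    also have "real (n - card A) = r * n"
      using cA n by (simp add: r_def of_nat_diff field_simps)
    finally have "(\<Sum>v<n. g2 (set_reg ''x'' v s)) / of_nat n = ennreal (r * n * r ^ j / n)"
      using n r by (simp add: divide_ennreal ennreal_of_nat_eq_real_of_nat)
    then show ?thesis using True n by simp
  next
    case False
    then show ?thesis unfolding g2 by simp
  qed
  then have "qwp (Sample ''x'' (Var ''n'')) s g2 (if ?ok then ennreal (r ^ Suc j) else 0)"
    using Suc.prems n by (intro qwp_Sample) simp_all
  then have "qwp sample_body s g1 (if ?ok then ennreal (r ^ Suc j) else 0)"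
    unfolding sample_body_def by (rule qwp_Seq) (intro qwp_Write, simp add: g2_def)
  then have "qwp ?inc s g (if ?ok then ennreal (r ^ Suc j) else 0)"
    by (rule qwp_Seq) (intro qwp_Assign, simp add: g1_def)
  then have "qwp (Seq ?inc (While (Less (Var ''i'') (Var ''K'')) ?inc)) s
      (indicator {s'. avoids A K s'}) (if ?ok then ennreal (r ^ Suc j) else 0)"
  proof (rule qwp_Seq)
    fix D s' t assume "exec ?inc s D" "(s', t) \<in> set_pmf D"
    then obtain s1 where s1: "agree sample_body s s1"
      "s' = set_reg ''i'' (aval (Plus (Var ''i'') (Const 1)) s1) s1"
      using exec_Seq_Assign by blast
    then have "reg s' ''n'' = n" "reg s' ''K'' = K" "reg s' ''i'' + j = K"
      using Suc.prems by (simp_all add: agree_def)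
    from Suc.IH[OF this] show "qwp (While (Less (Var ''i'') (Var ''K'')) ?inc) s'
        (indicator {s'. avoids A K s'}) (g s')"
      unfolding g_def r_def .
  qed
  then show ?case
    unfolding r_def by (rule qwp_WhileTrue[rotated]) (use Suc.prems in simp)
qed

lemma qwp_sample:
  assumes "A \<subseteq> {..<n}" and "0 < n" and "reg s ''n'' = n" "reg s ''K'' = K"
  shows "qwp sample s (indicator {s'. avoids A K s'}) (ennreal ((1 - card A / n) ^ K))"
  unfolding sample_def For_def
proof (rule qwp_Seq)
  show "qwp (Assign ''i'' (Const 0)) s (\<lambda>_. ennreal ((1 - card A / n) ^ K)) (ennreal ((1 - card A / n) ^ K))"
    by (rule qwp_Assign) simp
next
  fix D s' t assume D: "exec (Assign ''i'' (Const 0)) s D" and "(s', t) \<in> set_pmf D"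
  then have s': "s' = set_reg ''i'' 0 s"
    unfolding exec_unique[OF D exec_Assign] by simp
  show "qwp (While (Less (Var ''i'') (Var ''K''))
      (Seq sample_body (Assign ''i'' (Plus (Var ''i'') (Const 1))))) s'
      (indicator {s'. avoids A K s'}) (ennreal ((1 - card A / n) ^ K))"
    using qwp_sample_loop[OF assms(1,2), of s' K K] assms(3,4) by (simp add: s' avoids_def)
qed


subsection \<open>Parameters\<close>

text \<open>Rounded-up logarithm and square root as least solutions of integer inequalities, which
  are exactly the exit conditions of the loops that compute them.\<close>

definition log_up :: "nat \<Rightarrow> nat" where
  "log_up n = (LEAST l. n \<le> 2 ^ l)"

definition sqrt_up :: "nat \<Rightarrow> nat" where
  "sqrt_up n = (LEAST q. n \<le> q * q)"

lemma log_up: "n \<le> 2 ^ log_up n"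
  unfolding log_up_def by (rule LeastI[of _ n]) (simp add: less_imp_le)

lemma log_up_le: "n \<le> 2 ^ l \<Longrightarrow> log_up n \<le> l"
  unfolding log_up_def by (rule Least_le)

lemma sqrt_up: "n \<le> sqrt_up n * sqrt_up n"
  unfolding sqrt_up_def by (rule LeastI[of _ n]) simp

lemma sqrt_up_le: "n \<le> q * q \<Longrightarrow> sqrt_up n \<le> q"
  unfolding sqrt_up_def by (rule Least_le)

text \<open>Searching the root by counting takes about \<surd>n rounds, which is harmless beside the
  sampling.\<close>

definition params :: com where
  "params =
     Seq (Seq (Assign ''l'' (Const 0)) (Assign ''p'' (Const 1)))
    (Seq (While (Less (Var ''p'') (Var ''n''))
           (Seq (Assign ''p'' (Plus (Var ''p'') (Var ''p''))) (Assign ''l'' (Plus (Var ''l'') (Const 1)))))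
    (Seq (Assign ''q'' (Const 0))
    (Seq (While (Less (Times (Var ''q'') (Var ''q'')) (Var ''n''))
           (Assign ''q'' (Plus (Var ''q'') (Const 1))))
         (Assign ''K'' (Times (Var ''q'') (Var ''l''))))))"

lemma mod_params [simp]: "mod_regs params = {''l'', ''p'', ''q'', ''K''}" "mod_arrs params = {}"
  by (auto simp: params_def)

lemma wp_log_loop:
  assumes n: "reg s ''n'' = n" "2 * n \<le> B" and s: "reg s ''l'' = 0" "reg s ''p'' = 1"
  shows "wp B (While (Less (Var ''p'') (Var ''n''))
      (Seq (Assign ''p'' (Plus (Var ''p'') (Var ''p''))) (Assign ''l'' (Plus (Var ''l'') (Const 1))))) s
      (20 * log_up n + 3) (\<lambda>s'. reg s' ''l'' = log_up n)"
proof -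
  define \<Phi> where "\<Phi> s' = 20 * (log_up n - reg s' ''l'') + 3" for s' :: store
  define I where "I s' \<longleftrightarrow> reg s' ''n'' = n \<and> reg s' ''p'' = 2 ^ reg s' ''l'' \<and> reg s' ''l'' \<le> log_up n"
    for s' :: store
  have "wp B (While (Less (Var ''p'') (Var ''n''))
      (Seq (Assign ''p'' (Plus (Var ''p'') (Var ''p''))) (Assign ''l'' (Plus (Var ''l'') (Const 1))))) s
      (\<Phi> s) (\<lambda>s'. reg s' ''l'' = log_up n)"
  proof (rule wp_While[where I = I])
    show "I s" using n s by (simp add: I_def)
  next
    fix s' assume I: "I s'" and b: "bval (Less (Var ''p'') (Var ''n'')) s'"
    then have lt: "2 ^ reg s' ''l'' < n" "reg s' ''n'' = n" "reg s' ''p'' = 2 ^ reg s' ''l''"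
      by (auto simp: I_def)
    then have "reg s' ''l'' \<noteq> log_up n" using log_up[of n] by auto
    then have l: "Suc (reg s' ''l'') \<le> log_up n" using I by (simp add: I_def)
    have "reg s' ''l'' < 2 ^ reg s' ''l''" by simp
    then have "Suc (reg s' ''l'') \<le> B" using lt(1) n(2) by linarith
    then show "\<exists>C. wp B (Seq (Assign ''p'' (Plus (Var ''p'') (Var ''p'')))
        (Assign ''l'' (Plus (Var ''l'') (Const 1)))) s' C
        (\<lambda>s''. I s'' \<and> \<Phi> s'' + C + bexp_units (Less (Var ''p'') (Var ''n'')) \<le> \<Phi> s')"
      by (intro exI[of _ 12] wp_straight) (use lt l n in \<open>auto simp: I_def \<Phi>_def\<close>)
  next
    fix s' assume I: "I s'" and b: "\<not> bval (Less (Var ''p'') (Var ''n'')) s'"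
    then have "log_up n \<le> reg s' ''l''" by (intro log_up_le) (auto simp: I_def)
    then show "reg s' ''l'' = log_up n \<and> bexp_units (Less (Var ''p'') (Var ''n'')) \<le> \<Phi> s'"
      using I by (simp add: I_def \<Phi>_def)
  qed
  then show ?thesis by (rule wp_conseq) (simp_all add: \<Phi>_def s)
qed

lemma wp_sqrt_loop:
  assumes n: "reg s ''n'' = n" "n \<le> B" and s: "reg s ''q'' = 0"
  shows "wp B (While (Less (Times (Var ''q'') (Var ''q'')) (Var ''n''))
      (Assign ''q'' (Plus (Var ''q'') (Const 1)))) s (20 * sqrt_up n + 6) (\<lambda>s'. reg s' ''q'' = sqrt_up n)"
proof -
  define \<Phi> where "\<Phi> s' = 20 * (sqrt_up n - reg s' ''q'') + 6" for s' :: store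
  define I where "I s' \<longleftrightarrow> reg s' ''n'' = n \<and> reg s' ''q'' \<le> sqrt_up n" for s' :: store
  have qn: "sqrt_up n \<le> n" by (rule sqrt_up_le) simp
  have "wp B (While (Less (Times (Var ''q'') (Var ''q'')) (Var ''n''))
      (Assign ''q'' (Plus (Var ''q'') (Const 1)))) s (\<Phi> s) (\<lambda>s'. reg s' ''q'' = sqrt_up n)"
  proof (rule wp_While[where I = I])
    show "I s" using n s by (simp add: I_def)
  next
    fix s' assume I: "I s'" and b: "bval (Less (Times (Var ''q'') (Var ''q'')) (Var ''n'')) s'"
    then have "reg s' ''q'' \<noteq> sqrt_up n" using sqrt_up[of n] by (auto simp: I_def)
    then have "Suc (reg s' ''q'') \<le> sqrt_up n" using I by (simp add: I_def)
    then show "\<exists>C. wp B (Assign ''q'' (Plus (Var ''q'') (Const 1))) s' C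
        (\<lambda>s''. I s'' \<and> \<Phi> s'' + C + bexp_units (Less (Times (Var ''q'') (Var ''q'')) (Var ''n'')) \<le> \<Phi> s')"
      by (intro exI[of _ 7] wp_straight) (use qn n I in \<open>auto simp: I_def \<Phi>_def\<close>)
  next
    fix s' assume I: "I s'" and b: "\<not> bval (Less (Times (Var ''q'') (Var ''q'')) (Var ''n'')) s'"
    then have "sqrt_up n \<le> reg s' ''q''" by (intro sqrt_up_le) (auto simp: I_def)
    then show "reg s' ''q'' = sqrt_up n \<and>
        bexp_units (Less (Times (Var ''q'') (Var ''q'')) (Var ''n'')) \<le> \<Phi> s'"
      using I by (simp add: I_def \<Phi>_def)
  qed
  then show ?thesis by (rule wp_conseq) (simp_all add: \<Phi>_def s)
qed

lemma wp_params:
  assumes n: "reg s ''n'' = n" and B: "n * n + 2 * n + 2 \<le> B"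
  shows "wp B params s (50 * (sqrt_up n + log_up n + 1)) (\<lambda>s'. reg s' ''K'' = sqrt_up n * log_up n)"
proof -
  let ?Q = "\<lambda>s'. reg s' ''K'' = sqrt_up n * log_up n"
  let ?log = "While (Less (Var ''p'') (Var ''n''))
      (Seq (Assign ''p'' (Plus (Var ''p'') (Var ''p''))) (Assign ''l'' (Plus (Var ''l'') (Const 1))))"
  let ?sqrt = "While (Less (Times (Var ''q'') (Var ''q'')) (Var ''n''))
      (Assign ''q'' (Plus (Var ''q'') (Const 1)))"
  let ?fin = "Assign ''K'' (Times (Var ''q'') (Var ''l''))"
  have "sqrt_up n * log_up n \<le> n * n"
    by (intro mult_le_mono sqrt_up_le log_up_le) (auto simp: less_imp_le)
  then have KB: "sqrt_up n * log_up n \<le> B" using B by linarith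
  define s1 where "s1 = set_reg ''p'' 1 (set_reg ''l'' 0 s)"
  have s1: "reg s1 ''n'' = n" "reg s1 ''l'' = 0" "reg s1 ''p'' = 1" using n by (simp_all add: s1_def)
  have "wp B ?log s1 (20 * log_up n + 3)
    (\<lambda>s2. wp B (Seq (Assign ''q'' (Const 0)) (Seq ?sqrt ?fin)) s2 (2 + ((20 * sqrt_up n + 6) + 5)) ?Q)"
  proof (rule wp_conseq[OF wp_log_loop[OF s1(1) _ s1(2,3)]])
    fix s2 assume l2: "reg s2 ''l'' = log_up n" and ag2: "agree ?log s1 s2"
    define s3 where "s3 = set_reg ''q'' 0 s2"
    have s3: "reg s3 ''n'' = n" "reg s3 ''q'' = 0" "reg s3 ''l'' = log_up n"
      using ag2 s1 l2 by (simp_all add: s3_def agree_def)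
    have "wp B ?sqrt s3 (20 * sqrt_up n + 6) (\<lambda>s4. wp B ?fin s4 5 ?Q)"
    proof (rule wp_conseq[OF wp_sqrt_loop[OF s3(1) _ s3(2)]])
      fix s4 assume "reg s4 ''q'' = sqrt_up n" and ag4: "agree ?sqrt s3 s4"
      moreover have "reg s4 ''l'' = log_up n" using ag4 s3 by (simp add: agree_def)
      ultimately show "wp B ?fin s4 5 ?Q" using KB by (intro wp_straight) simp_all
    qed (use B in simp_all)
    then have "wp B (Seq ?sqrt ?fin) s3 ((20 * sqrt_up n + 6) + 5) ?Q" by (rule wp_Seq)
    then show "wp B (Seq (Assign ''q'' (Const 0)) (Seq ?sqrt ?fin)) s2 (2 + ((20 * sqrt_up n + 6) + 5)) ?Q"
      by (intro wp_Seq wp_straight) (simp_all add: s3_def)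
  qed (use B in simp_all)
  then have "wp B (Seq ?log (Seq (Assign ''q'' (Const 0)) (Seq ?sqrt ?fin))) s1
    ((20 * log_up n + 3) + (2 + ((20 * sqrt_up n + 6) + 5))) ?Q"
    by (rule wp_Seq)
  then have "wp B params s (5 + ((20 * log_up n + 3) + (2 + ((20 * sqrt_up n + 6) + 5)))) ?Q"
    unfolding params_def using B
    by (intro wp_Seq[of B "Seq (Assign ''l'' (Const 0)) (Assign ''p'' (Const 1))"] wp_straight)
      (simp_all add: s1_def)
  then show ?thesis by (rule wp_conseq) simp_all
qed

subsection \<open>The randomized algorithm\<close>

text \<open>Sampling precedes even the test for too few edges. Its cost of about \<surd>n log n fits
  the bound for edgeless graphs, and everything after it is deterministic.\<close>

definition program :: com where
  "program = Seq params (Seq sample diam)"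

context st_instance
begin

lemma n_ge_2: "2 \<le> n"
proof -
  obtain s t where "s \<in> S" "t \<in> {0..<n} - S" using S_ne T_ne by blast
  then have "s \<noteq> t" "s < n" "t < n" using S_subset by auto
  then show ?thesis by linarith
qed

lemma log_up_pos: "1 \<le> log_up n"
  using log_up[of n] n_ge_2 by (cases "log_up n") auto

lemma sqrt_up_pos: "1 \<le> sqrt_up n"
  using sqrt_up[of n] n_ge_2 by (cases "sqrt_up n") auto

definition sample_size :: nat where
  "sample_size = sqrt_up n * log_up n"

text \<open>Connectivity is a hypothesis because distances inside \<open>hits\<close> make sense
  only then; on disconnected instances every sample counts as good.\<close>

definition good_sample :: "store \<Rightarrow> bool" where
  "good_sample s \<longleftrightarrow> connected_instance n E S es B \<longrightarrow>
     connected_instance.hits n E S sample_size (arr s ''R'' ` {..<sample_size})"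

lemma wp_program:
  assumes B': "n * n + 2 * n + 2 \<le> B"
  shows "wp B program (input_store n S es) (10000 * (sample_size + 1) * (length es + 1))
    (\<lambda>s'. good_sample s' \<longrightarrow> good_estimate (ST_diameter E S ({0..<n} - S)) (estimate s'))"
proof -
  let ?K = sample_size
  let ?Q = "\<lambda>s'. good_sample s' \<longrightarrow> good_estimate (ST_diameter E S ({0..<n} - S)) (estimate s')"
  define s where "s = input_store n S es"
  have s: "reg s ''n'' = n" "reg s ''m'' = length es" "reg s ''out'' = 0" "reg s ''inf'' = 0"
    "\<And>v. arr s ''S'' v = (if v \<in> S then 1 else 0)" "\<And>u. arr s ''hd'' u = 0"
    "\<And>i. i < length es \<Longrightarrow> arr s ''fst'' i = fst (es ! i) \<and> arr s ''snd'' i = snd (es ! i)"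
    by (simp_all add: s_def input_store_def)
  define Cd where "Cd = 1000 * (length es + 1) + 3000 * (?K + 1) * (2 * length es + 2)"
  have "wp B params s (50 * (sqrt_up n + log_up n + 1)) (\<lambda>s1. wp B (Seq sample diam) s1
      (20 * (?K + 1) + Cd) ?Q)"
  proof (rule wp_conseq[OF wp_params[OF s(1) B']])
    fix s1 assume "reg s1 ''K'' = sqrt_up n * log_up n" and ag1: "agree params s s1"
    then have K1: "reg s1 ''K'' = ?K" by (simp add: sample_size_def)
    have n1: "reg s1 ''n'' = n" using ag1 s by (simp add: agree_def)
    have "n \<le> B" using B by simp
    show "wp B (Seq sample diam) s1 (20 * (?K + 1) + Cd) ?Q"
    proof (rule wp_Seq, rule wp_conseq[OF wp_sample[OF n1 n_pos \<open>n \<le> B\<close>]])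
      show "20 * (reg s1 ''K'' + 1) \<le> 20 * (?K + 1)" by (simp add: K1)
      fix s2 assume R2: "\<forall>i<reg s1 ''K''. arr s2 ''R'' i < n" and ag2: "agree sample s1 s2"
      have K2: "reg s2 ''K'' = ?K" using ag2 K1 by (simp add: agree_def)
      have reg2: "reg s2 ''n'' = n" "reg s2 ''m'' = length es" "reg s2 ''out'' = 0" "reg s2 ''inf'' = 0"
        using ag1 ag2 s by (simp_all add: agree_def)
      have arr2: "arr s2 ''S'' v = (if v \<in> S then 1 else 0)" "arr s2 ''hd'' v = 0" for v
        using ag1 ag2 s by (simp_all add: agree_def)
      have arr2': "arr s2 ''fst'' i = fst (es ! i) \<and> arr s2 ''snd'' i = snd (es ! i)"
        if "i < length es" for i
        using ag1 ag2 s(7)[OF that] by (simp add: agree_def)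
      let ?Q' = "\<lambda>s'. good_sample s2 \<longrightarrow> good_estimate (ST_diameter E S ({0..<n} - S)) (estimate s')"
      have "wp B diam s2 Cd ?Q'"
        unfolding Cd_def
      proof (rule wp_diam[OF reg2 arr2 arr2'])
        fix s' :: store assume "ST_diameter E S ({0..<n} - S) = \<infinity>" "reg s' ''inf'' = 1"
        then show "?Q' s'" by (simp add: good_estimate_def estimate_def)
      next
        fix s' assume conn: "\<And>u v. u < n \<Longrightarrow> v < n \<Longrightarrow> \<exists>k. (edge_rel E ^^ k) u v"
          and g: "graph_store s'" and K': "reg s' ''K'' = reg s2 ''K''" and R': "arr s' ''R'' = arr s2 ''R''"
          and out: "reg s' ''out'' = 0" "reg s' ''inf'' = 0" and le: "n \<le> length es + 1"
        have ci: "connected_instance n E S es B"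
          by (rule connected_instance.intro, rule st_instance_axioms,
              rule connected_instance_axioms.intro, rule conn)
        interpret c: connected_instance n E S es B by (rule ci)
        \<comment> \<open>\<open>main\<close> is reached only if n \<le> m + 1, so that the cost n +
          m of one search is linear in m alone.\<close>
        have "3000 * (?K + 1) * (n + length es + 1) \<le> 3000 * (?K + 1) * (2 * length es + 2)"
          by (rule mult_le_mono2) (use le in simp)
        then show "wp B main s' (3000 * (?K + 1) * (2 * length es + 2)) ?Q'"
          using K' K2 R' R2 K1
          by (intro wp_conseq[OF c.wp_main[OF g _ _ out, of ?K]]) (auto simp: good_sample_def ci)
      qed
      then show "wp B diam s2 Cd ?Q"
      proof (rule wp_conseq)
        fix s' :: store assume "?Q' s'" and "agree diam s2 s'"
        then show "?Q s'" by (simp add: good_sample_def agree_def diam_def main_def)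
      qed simp
    qed
  qed simp
  then have "wp B program s (50 * (sqrt_up n + log_up n + 1) + (20 * (?K + 1) + Cd)) ?Q"
    unfolding program_def by (rule wp_Seq)
  then have "wp B program s (10000 * (?K + 1) * (length es + 1)) ?Q"
  proof (rule wp_conseq)
    \<comment> \<open>For positive integers x and y, x + y \<le> xy + 1; hence the cost of computing
      the parameters is absorbed by the sample size.\<close>
    obtain a b where ab: "sqrt_up n = Suc a" "log_up n = Suc b"
      using sqrt_up_pos log_up_pos by (metis Suc_le_D One_nat_def)
    then have "sqrt_up n + log_up n \<le> ?K + 1" by (simp add: sample_size_def)
    moreover have "?K + 1 \<le> (?K + 1) * (length es + 1)" "length es + 1 \<le> (?K + 1) * (length es + 1)"
      by simp_all
    ultimately have "50 * (sqrt_up n + log_up n + 1) + (20 * (?K + 1) + Cd)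
      \<le> 50 * (2 * ((?K + 1) * (length es + 1))) + (20 * ((?K + 1) * (length es + 1)) +
        (1000 * ((?K + 1) * (length es + 1)) + 3000 * (2 * ((?K + 1) * (length es + 1)))))"
      unfolding Cd_def by (intro add_mono mult_le_mono2) (simp_all add: algebra_simps)
    also have "\<dots> \<le> 10000 * ((?K + 1) * (length es + 1))" by simp
    finally show "50 * (sqrt_up n + log_up n + 1) + (20 * (?K + 1) + Cd)
      \<le> 10000 * (?K + 1) * (length es + 1)" by (simp only: mult.assoc)
  qed
  then show ?thesis by (simp add: s_def)
qed

end

section \<open>Failure probability and final running time\<close>

lemma exec_SeqD:
  assumes "exec (Seq c1 c2) s D"
  shows "\<exists>D1. exec c1 s D1 \<and> (\<forall>(s', t) \<in> set_pmf D1. \<exists>D2. exec c2 s' D2)"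
  using assms by (rule exec_SeqE) blast

lemma wp_exec:
  assumes "wp B c s C Q" and "bounded_store B s" and "exec c s D" and "(s', t) \<in> set_pmf D"
  shows "bounded_store B s' \<and> t \<le> C * word_cost B \<and> Q s'"
  using assms exec_unique[OF assms(3)] unfolding wp_def by blast

lemma prob_le_qwp:
  assumes "qwp c s (indicator {s'. P s'}) (ennreal p)" and "0 \<le> p" and "exec c s D"
  shows "measure_pmf.prob D {z. P (fst z)} \<le> p"
proof -
  have "(\<integral>\<^sup>+z. indicator {s'. P s'} (fst z) \<partial>measure_pmf D) \<le> ennreal p"
    using assms(1) exec_unique[OF assms(3)] by (auto simp: qwp_def)
  moreover have "(\<integral>\<^sup>+z. indicator {s'. P s'} (fst z) \<partial>measure_pmf D)
      = (\<integral>\<^sup>+z. indicator {z. P (fst z)} z \<partial>measure_pmf D)"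
    by (intro nn_integral_cong) (auto simp: indicator_def)
  ultimately have "emeasure (measure_pmf D) {z. P (fst z)} \<le> ennreal p" by simp
  then show ?thesis using assms(2) by (simp add: measure_pmf.emeasure_eq_measure)
qed

context st_instance
begin

lemma bounded_input: "bounded_store B (input_store n S es)"
  using B es_nth by (force simp: bounded_store_def input_store_def intro: less_imp_le)

text \<open>With p = |A|/n and K draws, (1 - p)^K \<le> exp(-pK). Since |A| exceeds K and K^2 is at
  least n times the squared logarithm, pK is at least that square.\<close>

lemma miss_probability:
  assumes "sample_size < card A" and A: "A \<subseteq> {..<n}"
  shows "(1 - card A / n) ^ sample_size \<le> exp (- (real (log_up n))\<^sup>2)"
proof -
  have n: "0 < real n" using n_pos by simp
  have "card A \<le> card {..<n}" using A by (intro card_mono) auto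
  then have le: "card A / n \<le> 1" using n by simp
  have "(1 - card A / n) ^ sample_size \<le> exp (- (card A / n)) ^ sample_size"
    using le exp_ge_add_one_self[of "- (card A / n)"] by (intro power_mono) simp_all
  also have "\<dots> = exp (- (card A / n * sample_size))"
    by (simp flip: exp_of_nat2_mult)
  also have "\<dots> \<le> exp (- (real (log_up n))\<^sup>2)"
  proof -
    have "(real (log_up n))\<^sup>2 * n \<le> (real (log_up n))\<^sup>2 * real (sqrt_up n * sqrt_up n)"
      using sqrt_up[of n] by (intro mult_left_mono) (simp_all only: of_nat_le_iff zero_le_power2)
    also have "\<dots> = real sample_size * real sample_size"
      by (simp add: sample_size_def power2_eq_square)
    also have "\<dots> \<le> real (card A) * real sample_size"
      using assms(1) by (intro mult_right_mono) simp_all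
    finally show ?thesis using n by (simp add: field_simps)
  qed
  finally show ?thesis .
qed

text \<open>
  For each \<open>w\<close> it suffices to hit the smallest ball with more than \<open>sample_size\<close> vertices,
  which does not depend on the sample.
\<close>

lemma bad_sample_probability:
  assumes B': "n * n + 2 * n + 2 \<le> B" and D: "exec program (input_store n S es) D"
  shows "measure_pmf.prob D {z. \<not> good_sample (fst z)} \<le> n * exp (- (real (log_up n))\<^sup>2)"
proof (cases "connected_instance n E S es B")
  case False
  then show ?thesis by (simp add: good_sample_def)
next
  case True
  then interpret c: connected_instance n E S es B .
  define s where "s = input_store n S es"
  define K where "K = sample_size"
  define big where "big w c \<longleftrightarrow> K < card {v. v < n \<and> c.weighted_dist S w v < c}" for w c
  define A where "A w = {v. v < n \<and> c.weighted_dist S w v < (LEAST c. big w c)}" for w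
  define I where "I = {w. w < n \<and> (\<exists>c. big w c)}"
  define p where "p = real n * exp (- (real (log_up n))\<^sup>2)"
  have I: "finite I" "card I \<le> n"
    using card_mono[of "{..<n}" I] by (auto simp: I_def intro: finite_subset[of _ "{..<n}"])
  have A: "A w \<subseteq> {..<n}" "w \<in> I \<Longrightarrow> K < card (A w)" for w
    by (auto simp: A_def I_def) (auto simp: big_def dest: LeastI)
  have bad: "\<exists>w\<in>I. avoids (A w) K s'" if "\<not> good_sample s'" for s'
  proof -
    have "\<not> c.hits K (arr s' ''R'' ` {..<K})" using that by (simp add: good_sample_def K_def)
    then obtain w c where w: "w < n" "\<forall>x\<in>arr s' ''R'' ` {..<K}. c \<le> c.weighted_dist S w x" "big w c"
      unfolding c.hits_def big_def by (meson not_le)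
    \<comment> \<open>The radius c of the ball that violates \<open>hits\<close> is at least the
      minimal radius of a big ball around w, so avoiding the former means avoiding
      \<open>A w\<close>.\<close>
    have "(LEAST c. big w c) \<le> c" using w(3) by (rule Least_le)
    then have "arr s' ''R'' i \<notin> A w" if "i < K" for i
    proof -
      have "c \<le> c.weighted_dist S w (arr s' ''R'' i)" using w(2) that by simp
      then show ?thesis using \<open>(LEAST c. big w c) \<le> c\<close> by (simp add: A_def)
    qed
    then have "avoids (A w) K s'" by (simp add: avoids_def)
    then show ?thesis using w by (auto simp: I_def)
  qed
  obtain D1 where D1: "exec params s D1" "\<forall>(s1, t) \<in> set_pmf D1. \<exists>D2. exec (Seq sample diam) s1 D2"
    using exec_SeqD[OF D[unfolded program_def]] by (auto simp: s_def)
  have "qwp program s (indicator {s'. \<not> good_sample s'}) (ennreal p)"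
    unfolding program_def
  proof (rule qwp_Seq)
    show "qwp params s (\<lambda>_. ennreal p) (ennreal p)" by (rule qwp_preserved[OF D1(1)]) simp
  next
    fix D' s1 t assume "exec params s D'" "(s1, t) \<in> set_pmf D'"
    then have s1: "(s1, t) \<in> set_pmf D1" using exec_unique[OF D1(1)] by simp
    have "reg s ''n'' = n" by (simp add: s_def input_store_def)
    then have K1: "reg s1 ''K'' = K"
      using wp_exec[OF wp_params[OF _ B'] _ D1(1) s1] bounded_input by (simp add: K_def sample_size_def s_def)
    have n1: "reg s1 ''n'' = n"
      using exec_agree[OF D1(1) s1] \<open>reg s ''n'' = n\<close> by (simp add: agree_def)
    obtain D2 where "exec (Seq sample diam) s1 D2" using D1(2) s1 by blast
    then obtain D3 where D3: "exec sample s1 D3" "\<forall>(s2, t) \<in> set_pmf D3. \<exists>D4. exec diam s2 D4"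
      using exec_SeqD by blast
    show "qwp (Seq sample diam) s1 (indicator {s'. \<not> good_sample s'}) (ennreal p)"
    proof (rule qwp_Seq)
      have "qwp sample s1 (indicator {s'. \<not> good_sample s'}) (\<Sum>w\<in>I. ennreal ((1 - card (A w) / n) ^ K))"
      proof (rule qwp_sum[OF D3(1)])
        show "qwp sample s1 (indicator {s'. avoids (A w) K s'}) (ennreal ((1 - card (A w) / n) ^ K))" for w
          by (rule qwp_sample[OF A(1) n_pos n1 K1])
        fix s' :: store
        show "(indicator {s'. \<not> good_sample s'} s' :: ennreal) \<le> (\<Sum>w\<in>I. indicator {s'. avoids (A w) K s'} s')"
        proof (cases "good_sample s'")
          case False
          then obtain w where "w \<in> I" "avoids (A w) K s'" using bad by blast
          then have "1 \<le> (\<Sum>w\<in>I. indicator {s'. avoids (A w) K s'} s' :: ennreal)"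
            using I(1) by (intro order.trans[OF _ member_le_sum[of w]]) simp_all
          then show ?thesis using False by simp
        qed simp
      qed
      moreover have "(\<Sum>w\<in>I. ennreal ((1 - card (A w) / n) ^ K)) \<le> ennreal p"
      proof -
        have "(\<Sum>w\<in>I. ennreal ((1 - card (A w) / n) ^ K)) \<le> (\<Sum>w\<in>I. ennreal (exp (- (real (log_up n))\<^sup>2)))"
          using miss_probability A by (intro sum_mono ennreal_leI) (simp add: K_def)
        also have "\<dots> = ennreal (card I * exp (- (real (log_up n))\<^sup>2))"
          by (simp add: ennreal_mult ennreal_of_nat_eq_real_of_nat)
        also have "\<dots> \<le> ennreal p"
          unfolding p_def using I(2) by (intro ennreal_leI mult_right_mono) simp_all
        finally show ?thesis .
      qed
      ultimately show "qwp sample s1 (indicator {s'. \<not> good_sample s'}) (ennreal p)"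
        unfolding qwp_def by (meson order.trans)
    next
      fix D' s2 t assume "exec sample s1 D'" "(s2, t) \<in> set_pmf D'"
      then obtain D4 where "exec diam s2 D4" using D3 exec_unique by blast
      then show "qwp diam s2 (indicator {s'. \<not> good_sample s'}) (indicator {s'. \<not> good_sample s'} s2)"
        by (rule qwp_preserved)
          (simp add: agree_def good_sample_def diam_def main_def indicator_def)
    qed
  qed
  then show ?thesis
    using prob_le_qwp[of program s "\<lambda>s'. \<not> good_sample s'" p D] D by (simp add: p_def s_def)
qed

lemma card_E_le: "length es \<le> n * n"
proof -
  have "E \<subseteq> (\<lambda>(u, v). {u, v}) ` ({0..<n} \<times> {0..<n})"
    using simple unfolding simple_graph_def by fast
  then have "card E \<le> card ((\<lambda>(u, v). {u, v}) ` ({0..<n} \<times> {0..<n}))" by (intro card_mono) auto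
  also have "\<dots> \<le> card ({0..<n} \<times> {0..<n})" by (intro card_image_le) auto
  finally show ?thesis by (simp add: length_es)
qed

lemma log_up_le_log: "real (log_up n) \<le> 2 * log 2 n"
proof -
  obtain b where b: "log_up n = Suc b" using log_up_pos by (metis Suc_le_D One_nat_def)
  have "2 ^ b < n" using log_up_le[of n b] b by (metis not_less Suc_n_not_le_n)
  then have "(2::real) ^ b < n" by (metis of_nat_less_iff of_nat_numeral of_nat_power)
  then have "real b < log 2 n" by (simp add: less_log_iff powr_realpow)
  moreover have "1 \<le> log 2 n" using n_ge_2 by simp
  ultimately show ?thesis using b by simp
qed

lemma sqrt_up_le_sqrt: "real (sqrt_up n) \<le> 2 * sqrt n"
proof -
  obtain b where b: "sqrt_up n = Suc b" using sqrt_up_pos by (metis Suc_le_D One_nat_def)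
  have "b * b < n" using sqrt_up_le[of n b] b by (metis not_less Suc_n_not_le_n)
  then have "(real b)\<^sup>2 < real n"
    by (metis of_nat_less_iff of_nat_mult power2_eq_square)
  then have "real b < sqrt n" by (simp add: real_less_rsqrt)
  moreover have "1 \<le> sqrt n" using n_ge_2 by simp
  ultimately show ?thesis unfolding b of_nat_Suc by linarith
qed

text \<open>\<open>B\<close> is at most 5 n^2, so one unit of cost is a constant multiple of log
  n.\<close>

lemma word_cost_le:
  assumes "B = n * n + 2 * n + 2 * length es + 2"
  shows "real (word_cost B) \<le> 12 * log 2 n"
proof -
  have "2 * n \<le> n * n" "2 * 2 \<le> n * n"
    using n_ge_2 by (intro mult_le_mono; simp)+
  then have "B \<le> 5 * (n * n)" using card_E_le assms by linarith
  also have "\<dots> \<le> 5 * (2 ^ log_up n * 2 ^ log_up n)"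
    using log_up[of n] by (intro mult_le_mono) auto
  also have "\<dots> < 8 * (2 ^ log_up n * 2 ^ log_up n)" by simp
  also have "\<dots> = 2 ^ (2 * log_up n + 3)" by (simp only: power_add mult_2) simp
  finally have "floorlog 2 B \<le> 2 * log_up n + 3" by (intro floorlog_leI) auto
  then have "word_cost B \<le> 6 * log_up n" using log_up_pos by (simp add: word_cost_def)
  then have "real (word_cost B) \<le> 6 * real (log_up n)" by (metis of_nat_le_iff of_nat_mult of_nat_numeral)
  then show ?thesis using log_up_le_log by simp
qed

end

text \<open>One logarithm stems from the sample size, the other from the length of numbers. The
  constant rounds 10000 * 8 * 2 * 12 up, the factors coming from the unit count, the sample size,
  the edge number and the word length.\<close>

lemma program_instance:
  assumes inst: "ST_instance n E S es"
  shows "\<exists>D. exec program (input_store n S es) D \<and>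
    (\<forall>(s, t) \<in> set_pmf D. real t \<le> 2000000 * (real (max 1 (card E)) * sqrt n * log 2 n ^ 2)) \<and>
    measure_pmf.prob D {(s, t). good_estimate (ST_diameter E S ({0..<n} - S)) (estimate s)}
      \<ge> 1 - n * exp (- (ln n)\<^sup>2)"
proof -
  define B where "B = n * n + 2 * n + 2 * length es + 2"
  interpret st_instance n E S es B
    by (rule st_instance.intro) (use inst in \<open>simp_all add: B_def\<close>)
  have B': "n * n + 2 * n + 2 \<le> B" by (simp add: B_def)
  obtain D where D: "exec program (input_store n S es) D"
    and all: "\<forall>(s, t) \<in> set_pmf D. bounded_store B s \<and>
      t \<le> 10000 * (sample_size + 1) * (length es + 1) * word_cost B \<and>
      (good_sample s \<longrightarrow> good_estimate (ST_diameter E S ({0..<n} - S)) (estimate s))"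
    using wp_program[OF B'] bounded_input unfolding wp_def by blast
  have L: "1 \<le> log 2 n" using n_ge_2 by simp
  have "real t \<le> 2000000 * (real (max 1 (card E)) * sqrt n * log 2 n ^ 2)"
    if "(s, t) \<in> set_pmf D" for s t
  proof -
    have "sample_size + 1 \<le> 2 * sample_size" using log_up_pos sqrt_up_pos by (simp add: sample_size_def)
    then have "real (sample_size + 1) \<le> 2 * (real (sqrt_up n) * real (log_up n))"
      unfolding sample_size_def by (metis of_nat_le_iff of_nat_mult of_nat_numeral)
    also have "\<dots> \<le> 2 * ((2 * sqrt n) * (2 * log 2 n))"
      using sqrt_up_le_sqrt log_up_le_log by (intro mult_left_mono mult_mono) simp_all
    finally have K: "real (sample_size + 1) \<le> 8 * (sqrt n * log 2 n)" by simp
    have m: "real (length es + 1) \<le> 2 * real (max 1 (card E))"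
      by (simp add: length_es)
    have "t \<le> 10000 * (sample_size + 1) * (length es + 1) * word_cost B" using all that by blast
    then have "real t \<le> real (10000 * (sample_size + 1) * (length es + 1) * word_cost B)"
      by (rule of_nat_mono)
    also have "\<dots> = 10000 * (real (sample_size + 1) * real (length es + 1) * real (word_cost B))"
      by (simp only: of_nat_mult of_nat_numeral mult.assoc)
    also have "\<dots> \<le> 10000 * (8 * (sqrt n * log 2 n) * (2 * real (max 1 (card E))) * (12 * log 2 n))"
      using K m word_cost_le[OF B_def] L by (intro mult_left_mono mult_mono) simp_all
    also have "\<dots> = 1920000 * (real (max 1 (card E)) * sqrt n * log 2 n ^ 2)"
      by (simp add: power2_eq_square)
    also have "\<dots> \<le> 2000000 * (real (max 1 (card E)) * sqrt n * log 2 n ^ 2)"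
      by (intro mult_right_mono) simp_all
    finally show ?thesis .
  qed
  moreover have "measure_pmf.prob D {(s, t). good_estimate (ST_diameter E S ({0..<n} - S)) (estimate s)}
      \<ge> 1 - n * exp (- (ln n)\<^sup>2)"
  proof -
    \<comment> \<open>The natural logarithm is below the binary one, and passing to it makes the
      failure bound a plain function of n.\<close>
    have "ln n \<le> real (log_up n)"
    proof -
      have "ln (real n) \<le> ln (2 ^ log_up n)"
        using log_up[of n] n_pos by (subst ln_le_cancel_iff) (simp_all flip: of_nat_le_iff)
      also have "\<dots> = log_up n * ln 2" by (simp add: ln_realpow)
      also have "\<dots> \<le> real (log_up n) * 1" using ln_2_less_1 by (intro mult_left_mono) simp_all
      finally show ?thesis by simp
    qed
    moreover have "0 \<le> ln (real n)" using n_pos by simp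
    ultimately have "(ln n)\<^sup>2 \<le> (real (log_up n))\<^sup>2" by (intro power_mono)
    then have "n * exp (- (real (log_up n))\<^sup>2) \<le> n * exp (- (ln n)\<^sup>2)"
      by (intro mult_left_mono) simp_all
    then have "measure_pmf.prob D {z. \<not> good_sample (fst z)} \<le> n * exp (- (ln n)\<^sup>2)"
      using bad_sample_probability[OF B' D] by linarith
    moreover have "measure_pmf.prob D {z. good_sample (fst z)}
        \<le> measure_pmf.prob D {(s, t). good_estimate (ST_diameter E S ({0..<n} - S)) (estimate s)}"
      using all by (intro measure_pmf.finite_measure_mono_AE) (auto simp: AE_measure_pmf_iff)
    moreover have "measure_pmf.prob D {z. \<not> good_sample (fst z)} = 1 - measure_pmf.prob D {z. good_sample (fst z)}"
      using measure_pmf.prob_compl[of "{z. good_sample (fst z)}" D] by (simp add: Compl_eq_Diff_UNIV[symmetric] Collect_neg_eq)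
    ultimately show ?thesis by linarith
  qed
  ultimately show ?thesis using D by blast
qed

theorem theorem10:
  shows "\<exists>P. soft_O_m_sqrt_n_time P \<and> whp_correct P"
proof (intro exI conjI)
  show "soft_O_m_sqrt_n_time program"
    unfolding soft_O_m_sqrt_n_time_def
  proof (intro exI allI impI)
    fix n E S es assume "ST_instance n E S es"
    then obtain D where D: "exec program (input_store n S es) D"
      "\<forall>(s, t) \<in> set_pmf D. real t \<le> 2000000 * (real (max 1 (card E)) * sqrt n * log 2 n ^ 2)"
      using program_instance by meson
    then show "terminates program (input_store n S es) \<and>
        (\<forall>(s, t) \<in> set_pmf (run program (input_store n S es)).
           real t \<le> 2000000 * (real (max 1 (card E)) * sqrt n * log 2 n ^ 2))"
      using run_eqI[OF D(1)] by (auto simp: terminates_def)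
  qed
  show "whp_correct program"
    unfolding whp_correct_def
  proof
    fix c :: real
    show "\<exists>N. \<forall>n\<ge>N. \<forall>E S es. ST_instance n E S es \<longrightarrow>
        measure_pmf.prob (run program (input_store n S es))
          {(s, t). good_estimate (ST_diameter E S ({0..<n} - S)) (estimate s)} \<ge> 1 - 1 / real n powr c"
    \<comment> \<open>The threshold ensures ln n \<ge> |c| + 1, hence (ln n)^2 \<ge> ln n + c ln n:
      one factor n is lost to the union bound and n powr c remains. The absolute value covers
      negative c.\<close>
    proof (intro exI[of _ "nat \<lceil>exp (\<bar>c\<bar> + 1)\<rceil>"] allI impI)
      fix n E S es assume n: "nat \<lceil>exp (\<bar>c\<bar> + 1)\<rceil> \<le> n" and inst: "ST_instance n E S es"
      have big: "exp (\<bar>c\<bar> + 1) \<le> real n" using n by linarith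
      then have pos: "0 < real n" using exp_gt_zero[of "\<bar>c\<bar> + 1"] by linarith
      have ln: "\<bar>c\<bar> + 1 \<le> ln n" using big pos by (simp add: ln_ge_iff)
      have "ln n * (\<bar>c\<bar> + 1) \<le> ln n * ln n" using ln by (intro mult_left_mono) auto
      moreover have "ln n * c \<le> ln n * \<bar>c\<bar>" using ln by (intro mult_left_mono) auto
      ultimately have e: "ln n - (ln n)\<^sup>2 \<le> - (c * ln n)"
        by (simp add: power2_eq_square algebra_simps)
      have "n * exp (- (ln n)\<^sup>2) = exp (ln n - (ln n)\<^sup>2)"
        using pos by (simp add: exp_diff exp_minus field_simps)
      also have "\<dots> \<le> exp (- (c * ln n))" using e by simp
      also have "\<dots> = 1 / real n powr c" using pos by (simp add: powr_def exp_minus inverse_eq_divide)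
      finally have le: "n * exp (- (ln n)\<^sup>2) \<le> 1 / real n powr c" .
      obtain D where D: "exec program (input_store n S es) D"
        "measure_pmf.prob D {(s, t). good_estimate (ST_diameter E S ({0..<n} - S)) (estimate s)}
          \<ge> 1 - n * exp (- (ln n)\<^sup>2)"
        using program_instance[OF inst] by blast
      show "measure_pmf.prob (run program (input_store n S es))
          {(s, t). good_estimate (ST_diameter E S ({0..<n} - S)) (estimate s)} \<ge> 1 - 1 / real n powr c"
        using run_eqI[OF D(1)] D(2) le by simp
    qed
  qed
qed

end
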